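(* Consider a three-chain linkage of type $[p,q;r]$ formed by open chains $A$, $B$, $Z$, with oriented cycle $\Gamma=AB$ and with generic edge lengths; in particular none of the cycles $AB$, $AZ$, $BZ$ (as polygonal linkages) has an aligned configuration, so that the reduced configuration space is a smooth manifold. Then all critical points of the oriented area function $S$ on the reduced configuration space fall into the following two types, which are generically disjoint: (1) Circular type: $\Gamma$ is realized as a cyclic polygon, that is, all the vertices of $\Gamma$ lie on a circle. For each cyclic configuration of $\Gamma$ (up to orientation-preserving isometry) there is a critical manifold, which equals the reduced configuration space of the flexible polygon obtained from $Z$ by attaching the corresponding diagonal of the cyclic polygon, i.e. a bar connecting $I$ and $T$ whose length is the distance $|IT|$ in the cyclic configuration of $\Gamma$. (2) Aligned type: $Z$ is aligned, and each of $A$ and $B$ is cyclic, i.e. all vertices of $A$ (including $I$ and $T$) lie on a circle and all vertices of $B$ (including $I$ and $T$) lie on a circle. The two circumscribed circles generically do not coincide.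
   Context: A linkage is a graph together with an assignment of (positive) lengths to its edges. A configuration is a realization of the linkage in the Euclidean plane (self-intersections allowed); the reduced configuration space is the space of configurations modulo orientation-preserving isometries of the plane. The edge lengths are assumed to be realizable, i.e. the configuration space is non-empty. A configuration (of a linkage or of a sublinkage) is aligned if all its vertices lie on one straight line. An open chain is a linkage whose underlying graph is a path, oriented from its initial to its terminal vertex; a polygonal linkage (flexible polygon) is one whose underlying graph is a single cycle. A three-chain linkage of type $[p,q;r]$ is obtained from three oriented open chains $A$, $B$, $Z$ with $p$, $q$, $r$ edges respectively by gluing their initial points into one vertex $I$ and their terminal points into one vertex $T$. The distinguished oriented cycle $\Gamma=AB$ runs along $A$ from $I$ to $T$ and then along $B$ backwards from $T$ to $I$. The oriented area of a polygon with consecutive vertices $p_i=(x_i,y_i)$, $i=1,\dots,n$, is defined by $2S=(x_1y_2-x_2y_1)+\dots+(x_ny_1-x_1y_n)$. The oriented area $S$ of the three-chain linkage is the function on the reduced configuration space equal to the oriented area of the polygon $\Gamma$. "Generic" (or "generically") means: for all vectors of edge lengths outside a suitable finite union of submanifolds of codimension at least one in the parameter space of edge lengths (so the generic case is an open, everywhere dense set of parameters). *)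

theory Defs
  imports "HOL-Analysis.Analysis"
begin

section \<open>Smooth functions and submanifolds in coordinate spaces\<close>

text \<open>
  For a finite index set \<open>V\<close> and a Euclidean space \<open>'a\<close>, the space of all \<open>V\<close>-indexed families in
  \<open>'a\<close> is \<open>V \<rightarrow>\<^sub>E UNIV\<close>. It serves both as the space of planar point configurations
  (\<open>'a = complex\<close>) and as the space of edge lengths (\<open>'a = real\<close>).
\<close>

definition coord_space :: "'i set \<Rightarrow> ('i \<Rightarrow> 'a::euclidean_space) topology" where
  "coord_space V = product_topology (\<lambda>_. euclidean) V"

definition slice_fun ::
  "'i \<Rightarrow> 'a::euclidean_space \<Rightarrow> (('i \<Rightarrow> 'a) \<Rightarrow> real) \<Rightarrow> ('i \<Rightarrow> 'a) \<Rightarrow> real \<Rightarrow> real" where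
  "slice_fun v b f x = (\<lambda>t. f (x(v := x v + t *\<^sub>R b)))"

definition partial ::
  "'i \<Rightarrow> 'a::euclidean_space \<Rightarrow> (('i \<Rightarrow> 'a) \<Rightarrow> real) \<Rightarrow> ('i \<Rightarrow> 'a) \<Rightarrow> real" where
  "partial v b f x = deriv (slice_fun v b f x) 0"

primrec Ck_on ::
  "'i set \<Rightarrow> ('i \<Rightarrow> 'a::euclidean_space) set \<Rightarrow> nat \<Rightarrow> (('i \<Rightarrow> 'a) \<Rightarrow> real) \<Rightarrow> bool" where
  "Ck_on V U 0 f \<longleftrightarrow> continuous_map (subtopology (coord_space V) U) euclideanreal f"
| "Ck_on V U (Suc k) f \<longleftrightarrow>
     continuous_map (subtopology (coord_space V) U) euclideanreal f \<and>
     (\<forall>v\<in>V. \<forall>b\<in>Basis.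
        (\<forall>x\<in>U. slice_fun v b f x differentiable at 0) \<and> Ck_on V U k (partial v b f))"

definition smooth_fun_on ::
  "'i set \<Rightarrow> ('i \<Rightarrow> 'a::euclidean_space) set \<Rightarrow> (('i \<Rightarrow> 'a) \<Rightarrow> real) \<Rightarrow> bool" where
  "smooth_fun_on V U f \<longleftrightarrow> (\<forall>k. Ck_on V U k f)"

text \<open>
  Embedded smooth submanifold of codimension \<open>k\<close>: near each of its points it is the common zero set
  of \<open>k\<close> smooth functions whose gradients at that point are linearly independent.
\<close>

definition submanifold :: "'i set \<Rightarrow> nat \<Rightarrow> ('i \<Rightarrow> 'a::euclidean_space) set \<Rightarrow> bool" where
  "submanifold V k M \<longleftrightarrow> M \<subseteq> topspace (coord_space V) \<and>
     (\<forall>x\<in>M. \<exists>U F. openin (coord_space V) U \<and> x \<in> U \<and>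
        (\<forall>j<k. smooth_fun_on V U (F j)) \<and>
        M \<inter> U = {y\<in>U. \<forall>j<k. F j y = 0} \<and>
        (\<forall>c::nat \<Rightarrow> real.
           (\<forall>v\<in>V. \<forall>b\<in>Basis. (\<Sum>j<k. c j * partial v b (F j) x) = 0) \<longrightarrow> (\<forall>j<k. c j = 0)))"

section \<open>Generic parameters\<close>

definition positive_vectors :: "'i set \<Rightarrow> ('i \<Rightarrow> real) set" where
  "positive_vectors E = (E \<rightarrow>\<^sub>E {0<..})"

text \<open>
  A generic set of edge lengths is an open dense set of positive vectors that contains everything
  outside a finite union of submanifolds of codimension at least one.
\<close>

definition generic_set :: "'i set \<Rightarrow> ('i \<Rightarrow> real) set \<Rightarrow> bool" where
  "generic_set E G \<longleftrightarrow>
     G \<subseteq> positive_vectors E \<and> openin (coord_space E) G \<and>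
     positive_vectors E \<subseteq> coord_space E closure_of G \<and>
     (\<exists>\<M>. finite \<M> \<and> (\<forall>M\<in>\<M>. \<exists>k\<ge>1. submanifold E k M) \<and>
          positive_vectors E - \<Union>\<M> \<subseteq> G)"

section \<open>Linkages and reduced configuration spaces\<close>

text \<open>
  A linkage is given by its edges \<open>(u, v, l)\<close>, with end points \<open>u\<close>, \<open>v\<close> and length \<open>l\<close>. Parallel edges
  of different lengths are allowed. The plane is \<open>complex\<close>.
\<close>

type_synonym 'v linkage = "('v \<times> 'v \<times> real) set"

definition verts :: "'v linkage \<Rightarrow> 'v set" where
  "verts L = (\<Union>(u, v, l)\<in>L. {u, v})"

definition configs :: "'v linkage \<Rightarrow> ('v \<Rightarrow> complex) set" where
  "configs L = {x \<in> verts L \<rightarrow>\<^sub>E UNIV. \<forall>(u, v, l)\<in>L. dist (x u) (x v) = l}"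

text \<open>Orientation-preserving isometries of the plane are the maps \<open>z \<mapsto> w z + t\<close> with \<open>|w| = 1\<close>.\<close>

definition congruence :: "'v set \<Rightarrow> (('v \<Rightarrow> complex) \<times> ('v \<Rightarrow> complex)) set" where
  "congruence V = {(x, y). \<exists>w t. cmod w = 1 \<and> y = (\<lambda>v\<in>V. w * x v + t)}"

definition config_class :: "'v linkage \<Rightarrow> ('v \<Rightarrow> complex) \<Rightarrow> ('v \<Rightarrow> complex) set" where
  "config_class L x = congruence (verts L) `` {x}"

definition reduced_configs :: "'v linkage \<Rightarrow> ('v \<Rightarrow> complex) set set" where
  "reduced_configs L = configs L // congruence (verts L)"

text \<open>
  The group of orientation-preserving isometries acts freely and properly on the non-constant
  families of points indexed by \<open>V\<close>, so the quotient is a smooth manifold of dimension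
  \<open>2 * card V - 3\<close>, and the quotient map is a submersion. Hence a set \<open>K\<close> of classes is a submanifold
  of codimension \<open>k\<close> of this quotient iff its preimage \<open>\<Union>K\<close> is one in the space of families.
\<close>

definition reduced_submanifold :: "'v linkage \<Rightarrow> nat \<Rightarrow> ('v \<Rightarrow> complex) set set \<Rightarrow> bool" where
  "reduced_submanifold L k K \<longleftrightarrow> K \<subseteq> reduced_configs L \<and> submanifold (verts L) k (\<Union>K)"

text \<open>
  Tangent vectors of the reduced configuration space are velocities of curves; by the same remark
  every such curve may be taken to be the projection of a curve of configurations.
\<close>

definition critical_point ::
  "'v linkage \<Rightarrow> (('v \<Rightarrow> complex) set \<Rightarrow> real) \<Rightarrow> ('v \<Rightarrow> complex) set \<Rightarrow> bool" where
  "critical_point L f \<xi> \<longleftrightarrow> \<xi> \<in> reduced_configs L \<and>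
     (\<forall>\<gamma>. (\<forall>t::real. \<gamma> t \<in> configs L) \<and> config_class L (\<gamma> 0) = \<xi> \<and>
          (\<forall>v\<in>verts L. (\<lambda>t. \<gamma> t v) differentiable at 0) \<longrightarrow>
        ((\<lambda>t. f (config_class L (\<gamma> t))) has_real_derivative 0) (at 0))"

definition smooth_curve :: "(real \<Rightarrow> complex) \<Rightarrow> bool" where
  "smooth_curve \<gamma> \<longleftrightarrow>
     (\<exists>D. D 0 = \<gamma> \<and> (\<forall>(k::nat) t. (D k has_vector_derivative D (Suc k) t) (at t)))"

definition reduced_smooth_curve :: "'v linkage \<Rightarrow> (real \<Rightarrow> ('v \<Rightarrow> complex) set) \<Rightarrow> bool" where
  "reduced_smooth_curve L c \<longleftrightarrow>
     (\<exists>\<gamma>. (\<forall>t. \<gamma> t \<in> configs L \<and> c t = config_class L (\<gamma> t)) \<and>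
          (\<forall>v\<in>verts L. smooth_curve (\<lambda>t. \<gamma> t v)))"

text \<open>
  By Boman's theorem a map between manifolds is smooth iff it carries smooth curves to smooth
  curves; so the following describes the diffeomorphisms between submanifolds \<open>K\<close> and \<open>K'\<close> of the
  reduced configuration spaces of \<open>L\<close> and \<open>L'\<close>.
\<close>

definition reduced_diffeomorphism ::
  "'v linkage \<Rightarrow> ('v \<Rightarrow> complex) set set \<Rightarrow> 'v linkage \<Rightarrow> ('v \<Rightarrow> complex) set set \<Rightarrow>
     (('v \<Rightarrow> complex) set \<Rightarrow> ('v \<Rightarrow> complex) set) \<Rightarrow> bool" where
  "reduced_diffeomorphism L K L' K' \<phi> \<longleftrightarrow> bij_betw \<phi> K K' \<and>
     (\<forall>c. range c \<subseteq> K \<longrightarrow> (reduced_smooth_curve L c \<longleftrightarrow> reduced_smooth_curve L' (\<phi> \<circ> c)))"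

definition restrict_class :: "'v linkage \<Rightarrow> ('v \<Rightarrow> complex) set \<Rightarrow> ('v \<Rightarrow> complex) set" where
  "restrict_class L \<xi> = (\<lambda>x. restrict x (verts L)) ` \<xi>"

definition aligned :: "'v linkage \<Rightarrow> ('v \<Rightarrow> complex) \<Rightarrow> bool" where
  "aligned L x \<longleftrightarrow> collinear (x ` verts L)"

definition circumscribed :: "'v linkage \<Rightarrow> ('v \<Rightarrow> complex) \<Rightarrow> complex set \<Rightarrow> bool" where
  "circumscribed L x C \<longleftrightarrow> (\<exists>m \<rho>. \<rho> > 0 \<and> C = sphere m \<rho>) \<and> x ` verts L \<subseteq> C"

definition cyclic :: "'v linkage \<Rightarrow> ('v \<Rightarrow> complex) \<Rightarrow> bool" where
  "cyclic L x \<longleftrightarrow> (\<exists>C. circumscribed L x C)"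

section \<open>Three-chain linkages\<close>

datatype chain = ChA | ChB | ChZ

datatype vertex = VI | VT | Inner chain nat

text \<open>Below, \<open>n \<kappa>\<close> is the number of edges of the chain \<open>\<kappa>\<close>, and \<open>len (\<kappa>, i)\<close> the length of its
  edge number \<open>i\<close>, counted from \<open>0\<close>.\<close>

definition chain_vertex :: "(chain \<Rightarrow> nat) \<Rightarrow> chain \<Rightarrow> nat \<Rightarrow> vertex" where
  "chain_vertex n \<kappa> i = (if i = 0 then VI else if i = n \<kappa> then VT else Inner \<kappa> i)"

definition edge_indices :: "(chain \<Rightarrow> nat) \<Rightarrow> (chain \<times> nat) set" where
  "edge_indices n = {(\<kappa>, i). i < n \<kappa>}"

definition open_chain :: "(chain \<Rightarrow> nat) \<Rightarrow> (chain \<times> nat \<Rightarrow> real) \<Rightarrow> chain \<Rightarrow> vertex linkage" where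
  "open_chain n len \<kappa> =
     (\<lambda>i. (chain_vertex n \<kappa> i, chain_vertex n \<kappa> (Suc i), len (\<kappa>, i))) ` {..<n \<kappa>}"

definition two_chain_cycle ::
  "(chain \<Rightarrow> nat) \<Rightarrow> (chain \<times> nat \<Rightarrow> real) \<Rightarrow> chain \<Rightarrow> chain \<Rightarrow> vertex linkage" where
  "two_chain_cycle n len \<kappa> \<kappa>' = open_chain n len \<kappa> \<union> open_chain n len \<kappa>'"

definition three_chain :: "(chain \<Rightarrow> nat) \<Rightarrow> (chain \<times> nat \<Rightarrow> real) \<Rightarrow> vertex linkage" where
  "three_chain n len = open_chain n len ChA \<union> open_chain n len ChB \<union> open_chain n len ChZ"

definition chain_with_bar ::
  "(chain \<Rightarrow> nat) \<Rightarrow> (chain \<times> nat \<Rightarrow> real) \<Rightarrow> chain \<Rightarrow> real \<Rightarrow> vertex linkage" where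
  "chain_with_bar n len \<kappa> d = insert (VI, VT, d) (open_chain n len \<kappa>)"

definition oriented_area :: "complex list \<Rightarrow> real" where
  "oriented_area ps =
     (\<Sum>i<length ps. let z = ps ! i; z' = ps ! (Suc i mod length ps)
                      in Re z * Im z' - Re z' * Im z) / 2"

definition Gamma_vertices :: "(chain \<Rightarrow> nat) \<Rightarrow> vertex list" where
  "Gamma_vertices n =
     map (chain_vertex n ChA) [0..<n ChA] @ map (\<lambda>j. chain_vertex n ChB (n ChB - j)) [0..<n ChB]"

text \<open>The area is invariant under orientation-preserving isometries, hence constant on classes.\<close>

definition Gamma_area :: "(chain \<Rightarrow> nat) \<Rightarrow> (vertex \<Rightarrow> complex) set \<Rightarrow> real" where
  "Gamma_area n \<xi> = the_elem ((\<lambda>x. oriented_area (map x (Gamma_vertices n))) ` \<xi>)"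

definition circular_type ::
  "(chain \<Rightarrow> nat) \<Rightarrow> (chain \<times> nat \<Rightarrow> real) \<Rightarrow> (vertex \<Rightarrow> complex) set \<Rightarrow> bool" where
  "circular_type n len \<xi> \<longleftrightarrow> (\<forall>x\<in>\<xi>. cyclic (two_chain_cycle n len ChA ChB) x)"

definition aligned_type ::
  "(chain \<Rightarrow> nat) \<Rightarrow> (chain \<times> nat \<Rightarrow> real) \<Rightarrow> (vertex \<Rightarrow> complex) set \<Rightarrow> bool" where
  "aligned_type n len \<xi> \<longleftrightarrow>
     (\<forall>x\<in>\<xi>. aligned (open_chain n len ChZ) x \<and>
             cyclic (open_chain n len ChA) x \<and> cyclic (open_chain n len ChB) x)"

text \<open>The classes of configurations that restrict to \<open>g\<close>, up to congruence, on the cycle \<open>\<Gamma>\<close>.\<close>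

definition circular_stratum ::
  "(chain \<Rightarrow> nat) \<Rightarrow> (chain \<times> nat \<Rightarrow> real) \<Rightarrow> (vertex \<Rightarrow> complex) \<Rightarrow> (vertex \<Rightarrow> complex) set set" where
  "circular_stratum n len g =
     {\<xi> \<in> reduced_configs (three_chain n len).
        restrict_class (two_chain_cycle n len ChA ChB) \<xi> =
        config_class (two_chain_cycle n len ChA ChB) g}"

end

theory Submission
  imports Defs "HOL-Computational_Algebra.Polynomial"
begin

text \<open>
  Let \<open>u\<^sub>j\<close> and \<open>m\<^sub>j\<close> be the edge vectors and midpoints of the chains. Along a motion, the derivative of
  the area is the sum of the cross products of \<open>m\<^sub>j\<close> and \<open>u\<^sub>j'\<close> over \<open>A\<close> minus the same sum over \<open>B\<close>.
  Writing \<open>u\<^sub>j' = \<alpha>\<^sub>j \<i> u\<^sub>j\<close>, it becomes \<open>\<Sum> \<alpha>\<^sub>j (m\<^sub>j \<bullet> u\<^sub>j)\<close>, and the only constraint is that \<open>\<Sum> \<alpha>\<^sub>j u\<^sub>j\<close> is the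
  same for the three chains. Hence at a critical point there are multipliers \<open>c\<^sub>A\<close>, \<open>c\<^sub>B\<close> with
  \<open>(m\<^sub>j - c\<^sub>A) \<bullet> u\<^sub>j = 0\<close> on \<open>A\<close>, \<open>(m\<^sub>j - c\<^sub>B) \<bullet> u\<^sub>j = 0\<close> on \<open>B\<close> and \<open>(c\<^sub>A - c\<^sub>B) \<bullet> u\<^sub>j = 0\<close> on \<open>Z\<close>: the
  multipliers are circumcentres of \<open>A\<close> and \<open>B\<close>, and either they agree or \<open>Z\<close> is aligned.

  All exceptional lengths lie in zero sets of non-zero polynomials. For coincidences involving a
  cyclic polygon such a polynomial exists because there are fewer parameters (radius and half
  angles, in which the lengths are Laurent polynomials) than lengths.
\<close>

section \<open>Polynomial functions of a family of points\<close>

text \<open>\<open>critical_point\<close> quantifies over genuine curves of configurations, so the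
  multiplier argument can only start once every solution of the linearized constraints is the
  velocity of such a curve. The curves are built by hand: a chain that is not straight has two
  non-parallel edges, which act as a two-bar linkage and absorb a small prescribed motion of the end
  points, and genericity leaves at most one straight chain, whose own motion is taken as the
  prescription. The same dichotomy gives regularity: an equilibrium stress is a constant force along
  each chain, and a non-zero force needs a straight chain. All nondegeneracy rests on two numerical
  conditions, collected in \<open>generic_lengths\<close>: no non-trivial sum of lengths with
  coefficients -1, 0, 1 vanishes, and |IT| in a cyclic polygon AB is never the absolute value of
  such a sum, possibly the zero sum, over Z. The second condition comes without an explicit
  equation, since |IT| depends only algebraically on the lengths of A and B; elimination is replaced
  by a dimension count in spaces of polynomials.\<close>

inductive generated :: "('x \<Rightarrow> 'k::comm_ring_1) set \<Rightarrow> nat \<Rightarrow> ('x \<Rightarrow> 'k) \<Rightarrow> bool" for S where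
  const: "generated S d (\<lambda>x. c)"
| add: "generated S d f \<Longrightarrow> generated S d g \<Longrightarrow> generated S d (\<lambda>x. f x + g x)"
| times: "h \<in> S \<Longrightarrow> generated S d f \<Longrightarrow> generated S (Suc d) (\<lambda>x. h x * f x)"

lemma generated_mono: "generated S d f \<Longrightarrow> d \<le> e \<Longrightarrow> generated S e f"
proof (induction arbitrary: e rule: generated.induct)
  case (times h d f)
  then obtain e' where "e = Suc e'" "d \<le> e'" by (cases e) auto
  with times show ?case by (auto intro: generated.times)
qed (auto intro: generated.intros)

lemma generated_mult:
  assumes "generated S d f" "generated S e g"
  shows "generated S (d + e) (\<lambda>x. f x * g x)"
  using assms(1)
proof (induction rule: generated.induct)
  case (const d c)
  have "generated S e (\<lambda>x. c * g x)"
    using assms(2)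
  proof (induction rule: generated.induct)
    case (const d c')
    show ?case by (rule generated.const)
  next
    case (add d f g)
    show ?case using generated.add[OF add.IH] by (simp add: distrib_left)
  next
    case (times h d f)
    show ?case using generated.times[OF times.hyps(1) times.IH] by (simp add: mult_ac)
  qed
  then show ?case by (rule generated_mono) simp
next
  case (add d f g')
  show ?case using generated.add[OF add.IH] by (simp add: distrib_right)
next
  case (times h d f)
  show ?case using generated.times[OF times.hyps(1) times.IH] by (simp add: mult_ac)
qed

lemma generated_generator: "h \<in> S \<Longrightarrow> generated S 1 h"
  using generated.times[OF _ generated.const[of S 0 1], of h] by simp

text \<open>The bound \<open>d\<close> drives two arguments only: the descent through partial
  derivatives in \<open>zero_set_hypersurfaces\<close> and the count of Laurent monomials in
  \<open>laurent_dependence\<close>. Elsewhere it is forgotten, which yields closure rules that can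
  be applied without matching degrees.\<close>

definition generated_fun :: "('x \<Rightarrow> 'k::comm_ring_1) set \<Rightarrow> ('x \<Rightarrow> 'k) \<Rightarrow> bool" where
  "generated_fun S f \<longleftrightarrow> (\<exists>d. generated S d f)"

lemma generated_fun_const: "generated_fun S (\<lambda>x. c)"
  unfolding generated_fun_def using generated.const by blast

lemma generated_fun_generator: "h \<in> S \<Longrightarrow> generated_fun S h"
  unfolding generated_fun_def using generated_generator by blast

lemma generated_fun_add:
  assumes "generated_fun S f" "generated_fun S g"
  shows "generated_fun S (\<lambda>x. f x + g x)"
proof -
  obtain d e where "generated S d f" "generated S e g"
    using assms unfolding generated_fun_def by blast
  then have "generated S (max d e) f" "generated S (max d e) g"
    by (auto intro: generated_mono)
  then show ?thesis unfolding generated_fun_def using generated.add by blast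
qed

lemma generated_fun_mult:
  "generated_fun S f \<Longrightarrow> generated_fun S g \<Longrightarrow> generated_fun S (\<lambda>x. f x * g x)"
  unfolding generated_fun_def using generated_mult by blast

lemma generated_fun_minus: "generated_fun S f \<Longrightarrow> generated_fun S (\<lambda>x. - f x)"
  using generated_fun_mult[OF generated_fun_const[of S "-1"]] by simp

lemma generated_fun_diff:
  "generated_fun S f \<Longrightarrow> generated_fun S g \<Longrightarrow> generated_fun S (\<lambda>x. f x - g x)"
  using generated_fun_add[OF _ generated_fun_minus, of S f g] by simp

lemma generated_fun_power: "generated_fun S f \<Longrightarrow> generated_fun S (\<lambda>x. f x ^ k)"
  by (induction k) (simp_all add: generated_fun_const generated_fun_mult)

lemma generated_fun_sum:
  "(\<And>i. i \<in> I \<Longrightarrow> generated_fun S (f i)) \<Longrightarrow> generated_fun S (\<lambda>x. \<Sum>i\<in>I. f i x)"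
  by (induction I rule: infinite_finite_induct) (simp_all add: generated_fun_const generated_fun_add)

lemma generated_fun_prod:
  "(\<And>i. i \<in> I \<Longrightarrow> generated_fun S (f i)) \<Longrightarrow> generated_fun S (\<lambda>x. \<Prod>i\<in>I. f i x)"
  by (induction I rule: infinite_finite_induct) (simp_all add: generated_fun_const generated_fun_mult)

lemmas generated_fun_intros = generated_fun_const generated_fun_minus generated_fun_add
  generated_fun_diff generated_fun_mult generated_fun_power generated_fun_sum generated_fun_prod

section \<open>Real polynomials in the coordinates and their partial derivatives\<close>

definition coordinates :: "'i set \<Rightarrow> (('i \<Rightarrow> 'a::euclidean_space) \<Rightarrow> real) set" where
  "coordinates V = {\<lambda>x. x v \<bullet> b | v b. v \<in> V \<and> b \<in> Basis}"

abbreviation "poly_fun V \<equiv> generated (coordinates V)"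
abbreviation "polynomial_fun V \<equiv> generated_fun (coordinates V)"

lemma coordinatesI: "v \<in> V \<Longrightarrow> b \<in> Basis \<Longrightarrow> (\<lambda>x. x v \<bullet> b) \<in> coordinates V"
  unfolding coordinates_def by blast

lemma poly_fun_induct [consumes 1, case_names const add coord]:
  assumes "poly_fun V d f"
    and "\<And>d c. P d (\<lambda>x. c)"
    and "\<And>d f g. poly_fun V d f \<Longrightarrow> P d f \<Longrightarrow> poly_fun V d g \<Longrightarrow> P d g \<Longrightarrow> P d (\<lambda>x. f x + g x)"
    and "\<And>v b d f. v \<in> V \<Longrightarrow> b \<in> Basis \<Longrightarrow> poly_fun V d f \<Longrightarrow> P d f \<Longrightarrow> P (Suc d) (\<lambda>x. (x v \<bullet> b) * f x)"
  shows "P d f"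
  using assms(1)
proof (induction rule: generated.induct)
  case (times h d f)
  then obtain v b where "v \<in> V" "b \<in> Basis" "h = (\<lambda>x. x v \<bullet> b)"
    unfolding coordinates_def by blast
  with times assms(4) show ?case by simp
qed (rule assms(2,3); assumption)+

lemma polynomial_fun_Re: "v \<in> V \<Longrightarrow> polynomial_fun V (\<lambda>x. Re (x v))"
  using generated_fun_generator[OF coordinatesI, of v V "1::complex"] by (simp add: Basis_complex_def)

lemma polynomial_fun_Im: "v \<in> V \<Longrightarrow> polynomial_fun V (\<lambda>x. Im (x v))"
  using generated_fun_generator[OF coordinatesI, of v V "\<i>"] by (simp add: Basis_complex_def)

lemma polynomial_fun_real: "v \<in> V \<Longrightarrow> polynomial_fun V (\<lambda>x. (x v :: real))"
  using generated_fun_generator[OF coordinatesI, of v V "1::real"] by simp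

lemmas polynomial_fun_intros = generated_fun_intros polynomial_fun_Re polynomial_fun_Im polynomial_fun_real

lemma poly_fun_cong: "poly_fun V d f \<Longrightarrow> (\<And>v. v \<in> V \<Longrightarrow> x v = y v) \<Longrightarrow> f x = f y"
  by (induction rule: poly_fun_induct) auto

lemma poly_fun_partial:
  assumes "poly_fun V d f" "b \<in> Basis"
  shows "\<exists>g. poly_fun V (d - 1) g \<and>
    (\<forall>x. (slice_fun v b f x has_real_derivative g x) (at 0))"
  using assms(1)
proof (induction rule: poly_fun_induct)
  case (const d c)
  show ?case
    by (intro exI[of _ "\<lambda>x. 0"]) (auto simp: slice_fun_def intro: generated.const)
next
  case (add d f g)
  then obtain f' g' where "poly_fun V (d - 1) f'" "poly_fun V (d - 1) g'"
    "\<forall>x. (slice_fun v b f x has_real_derivative f' x) (at 0)"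
    "\<forall>x. (slice_fun v b g x has_real_derivative g' x) (at 0)" by blast
  then show ?case
    by (intro exI[of _ "\<lambda>x. f' x + g' x"])
       (auto intro!: generated.add DERIV_add simp: slice_fun_def)
next
  case (coord u b' d f)
  then obtain f' where f': "poly_fun V (d - 1) f'"
    "\<And>x. (slice_fun v b f x has_real_derivative f' x) (at 0)" by blast
  define k where "k = (if u = v then b \<bullet> b' else 0)"
  have c: "((\<lambda>t. (x(v := x v + t *\<^sub>R b)) u \<bullet> b') has_real_derivative k) (at 0)" for x
    by (auto simp: k_def inner_left_distrib intro!: derivative_eq_intros)
  have eq: "slice_fun v b (\<lambda>x. (x u \<bullet> b') * f x) x =
      (\<lambda>t. ((x(v := x v + t *\<^sub>R b)) u \<bullet> b') * slice_fun v b f x t)" for x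
    by (simp add: slice_fun_def)
  have der: "(slice_fun v b (\<lambda>x. (x u \<bullet> b') * f x) x has_real_derivative k * f x + (x u \<bullet> b') * f' x) (at 0)" for x
    unfolding eq using DERIV_mult[OF c[of x] f'(2)[of x]]
    by (auto simp: slice_fun_def algebra_simps)
  have "poly_fun V d (\<lambda>x. k * f x + (x u \<bullet> b') * f' x)"
  proof (rule generated.add)
    show "poly_fun V d (\<lambda>x. k * f x)"
      using generated_mult[OF generated.const[of _ 0 k] coord.hyps(3)] by simp
    show "poly_fun V d (\<lambda>x. (x u \<bullet> b') * f' x)"
    proof (cases d)
      \<comment> \<open>Here \<open>d - 1\<close> is truncated to 0, so multiplying
        \<open>f'\<close> by a coordinate would exceed the allowed degree. But a function of degree
        0 is constant, hence \<open>f' = 0\<close>.\<close>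
      case 0
      have "f z = f w" for z w
        using coord.hyps(3) unfolding 0
        by (induction "0::nat" f rule: poly_fun_induct) auto
      then obtain k' where "f = (\<lambda>x. k')" by blast
      then have "slice_fun v b f x = (\<lambda>t. k')" for x by (auto simp: slice_fun_def)
      with f'(2) have "f' x = 0" for x using DERIV_unique[OF f'(2)[of x]] by simp
      then show ?thesis by (simp add: generated.const)
    next
      case (Suc d')
      with f'(1) show ?thesis using generated.times[OF coordinatesI[OF coord.hyps(1,2)]] by auto
    qed
  qed
  with der show ?case by auto
qed

lemma poly_fun_partial':
  assumes "poly_fun V d f" "b \<in> Basis"
  shows "poly_fun V (d - 1) (partial v b f)"
    and "(slice_fun v b f x has_real_derivative partial v b f x) (at 0)"
proof -
  obtain g where g: "poly_fun V (d - 1) g"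
    "\<And>x. (slice_fun v b f x has_real_derivative g x) (at 0)"
    using poly_fun_partial[OF assms] by blast
  then have "partial v b f = g" unfolding partial_def by (intro ext DERIV_imp_deriv)
  with g show "poly_fun V (d - 1) (partial v b f)"
    and "(slice_fun v b f x has_real_derivative partial v b f x) (at 0)" by auto
qed

lemma partialI:
  "((\<lambda>t. f (x(v := x v + t *\<^sub>R b))) has_real_derivative D) (at 0) \<Longrightarrow> partial v b f x = D"
  unfolding partial_def slice_fun_def by (rule DERIV_imp_deriv)

section \<open>Continuity and smoothness of polynomials, and submanifolds cut out by them\<close>

lemma topspace_coord_space [simp]: "topspace (coord_space V) = V \<rightarrow>\<^sub>E UNIV"
  by (simp add: coord_space_def)

lemma poly_fun_continuous:
  "poly_fun V d f \<Longrightarrow> continuous_map (coord_space V) euclideanreal f"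
proof (induction rule: poly_fun_induct)
  case (coord v b d f)
  have "continuous_map (coord_space V) euclidean (\<lambda>x. x v)"
    unfolding coord_space_def using coord.hyps(1) by (rule continuous_map_product_projection)
  then have "continuous_map (coord_space V) euclideanreal (\<lambda>x. x v \<bullet> b)"
    by (intro continuous_map_compose[of _ _ "\<lambda>x. x v" _ "\<lambda>z. z \<bullet> b", unfolded comp_def])
       (auto intro!: continuous_intros)
  then show ?case using coord.IH by (rule continuous_map_real_mult)
qed (auto intro: continuous_map_add)

lemma poly_fun_Ck_on: "poly_fun V d f \<Longrightarrow> Ck_on V U k f"
proof (induction k arbitrary: d f)
  case 0
  then show ?case by (simp add: poly_fun_continuous continuous_map_from_subtopology)
next
  case (Suc k)
  have "slice_fun v b f x differentiable at 0" if "b \<in> Basis" for v b x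
    using poly_fun_partial'(2)[OF Suc.prems that] by (auto simp: real_differentiable_def)
  then show ?case
    using Suc.IH[OF poly_fun_partial'(1)[OF Suc.prems]]
    by (simp add: poly_fun_continuous[OF Suc.prems] continuous_map_from_subtopology)
qed

lemma polynomial_fun_smooth: "polynomial_fun V f \<Longrightarrow> smooth_fun_on V U f"
  unfolding generated_fun_def smooth_fun_on_def using poly_fun_Ck_on by blast

text \<open>Polynomials are smooth everywhere, so the whole space serves as the neighbourhood of
  every point. The equations may be indexed by any finite set, such as the edges of a linkage; the
  numbering demanded by \<open>submanifold\<close> is supplied by a bijection.\<close>

lemma submanifoldI:
  assumes "finite J" "card J = k" "M = {y \<in> V \<rightarrow>\<^sub>E UNIV. \<forall>j\<in>J. F j y = 0}"
    and poly: "\<And>j. j \<in> J \<Longrightarrow> polynomial_fun V (F j)"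
    and indep: "\<And>x c. x \<in> M \<Longrightarrow>
      (\<And>v b. v \<in> V \<Longrightarrow> b \<in> Basis \<Longrightarrow> (\<Sum>j\<in>J. c j * partial v b (F j) x) = 0) \<Longrightarrow>
      \<forall>j\<in>J. c j = 0"
  shows "submanifold V k M"
  unfolding submanifold_def
proof (intro conjI ballI)
  show "M \<subseteq> topspace (coord_space V)" using assms(3) by auto
  fix x assume x: "x \<in> M"
  obtain h where h: "bij_betw h {..<k} J"
    using ex_bij_betw_nat_finite[OF assms(1)] assms(2) by (auto simp: atLeast0LessThan)
  have hJ: "\<And>j. j < k \<Longrightarrow> h j \<in> J" using h bij_betwE by fastforce
  have all: "(\<forall>j<k. P (h j)) \<longleftrightarrow> (\<forall>j\<in>J. P j)" for P
    using h unfolding bij_betw_def by (metis image_iff lessThan_iff)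
  show "\<exists>U F. openin (coord_space V) U \<and> x \<in> U \<and> (\<forall>j<k. smooth_fun_on V U (F j)) \<and>
      M \<inter> U = {y \<in> U. \<forall>j<k. F j y = 0} \<and>
      (\<forall>c::nat \<Rightarrow> real. (\<forall>v\<in>V. \<forall>b\<in>Basis. (\<Sum>j<k. c j * partial v b (F j) x) = 0) \<longrightarrow> (\<forall>j<k. c j = 0))"
  proof (intro exI[of _ "V \<rightarrow>\<^sub>E UNIV"] exI[of _ "\<lambda>j. F (h j)"] conjI allI impI)
    show "openin (coord_space V) (V \<rightarrow>\<^sub>E UNIV)"
      using openin_topspace[of "coord_space V"] by simp
    show "x \<in> V \<rightarrow>\<^sub>E UNIV" using x assms(3) by blast
    show "smooth_fun_on V (V \<rightarrow>\<^sub>E UNIV) (F (h j))" if "j < k" for j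
      using poly hJ[OF that] polynomial_fun_smooth by blast
    show "M \<inter> (V \<rightarrow>\<^sub>E UNIV) = {y \<in> V \<rightarrow>\<^sub>E UNIV. \<forall>j<k. F (h j) y = 0}"
      using assms(3) all[of "\<lambda>j. F j _ = 0"] by auto
    fix c :: "nat \<Rightarrow> real" and j
    assume c: "\<forall>v\<in>V. \<forall>b\<in>Basis. (\<Sum>j<k. c j * partial v b (F (h j)) x) = 0" and "j < k"
    define c' where "c' = c \<circ> the_inv_into {..<k} h"
    have c': "c' (h i) = c i" if "i < k" for i
      using h that by (simp add: c'_def bij_betw_def the_inv_into_f_f)
    have "(\<Sum>j\<in>J. c' j * partial v b (F j) x) = (\<Sum>j<k. c j * partial v b (F (h j)) x)" for v b
      using sum.reindex_bij_betw[OF h, of "\<lambda>j. c' j * partial v b (F j) x"] c' by simp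
    with c have "\<forall>j\<in>J. c' j = 0" by (intro indep[OF x]) auto
    then show "c j = 0" using hJ[OF \<open>j < k\<close>] c'[OF \<open>j < k\<close>] by auto
  qed
qed

section \<open>Generic sets\<close>

lemma poly_fun_0_const: "poly_fun V 0 f \<Longrightarrow> f x = f y"
  by (induction "0::nat" f rule: poly_fun_induct) auto

lemma poly_fun_line:
  "poly_fun V d f \<Longrightarrow> \<exists>p. \<forall>t. f (\<lambda>i. x i + t *\<^sub>R (y i - x i)) = poly p t"
proof (induction rule: poly_fun_induct)
  case (const d c)
  show ?case by (intro exI[of _ "[:c:]"]) simp
next
  case (add d f g)
  then show ?case by (metis poly_add)
next
  case (coord v b d f)
  then obtain p where p: "\<forall>t. f (\<lambda>i. x i + t *\<^sub>R (y i - x i)) = poly p t" by blast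
  show ?case
    by (rule exI[of _ "[:x v \<bullet> b, (y v - x v) \<bullet> b:] * p"]) (simp add: p inner_left_distrib distrib_left distrib_right mult_ac)
qed

text \<open>Vanishing partial derivatives allow one coordinate to be changed at a time, and finitely
  many such changes lead from \<open>x\<close> to \<open>y\<close> on \<open>V\<close>; the
  coordinates outside \<open>V\<close> do not influence a polynomial in \<open>V\<close>.\<close>

lemma poly_fun_constant:
  fixes f :: "('i \<Rightarrow> real) \<Rightarrow> real"
  assumes "finite V" "poly_fun V d f" "\<And>v x. v \<in> V \<Longrightarrow> partial v 1 f x = 0"
  shows "f x = f y"
proof -
  have step: "f (x(v := s)) = f x" if "v \<in> V" for x v s
  proof -
    have "((\<lambda>t. f (x(v := t))) has_real_derivative 0) (at t)" for t
      using poly_fun_partial'(2)[OF assms(2), of "1::real" v "x(v := t)"] assms(3)[OF that, of "x(v := t)"]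
        DERIV_shift[of "\<lambda>t. f (x(v := t))" 0 0 t]
      by (simp add: slice_fun_def add_ac)
    then have "f (x(v := s)) = f (x(v := x v))" using DERIV_isconst_all[of "\<lambda>t. f (x(v := t))"] by blast
    then show ?thesis by simp
  qed
  have "F \<subseteq> V \<Longrightarrow> f (\<lambda>i. if i \<in> F then y i else x i) = f x" if "finite F" for F
    using that
  proof (induction F)
    case (insert e F)
    have "(\<lambda>i. if i \<in> insert e F then y i else x i) = (\<lambda>i. if i \<in> F then y i else x i)(e := y e)"
      by auto
    with insert show ?case using step[of e "\<lambda>i. if i \<in> F then y i else x i" "y e"] by simp
  qed simp
  from this[of V] have "f (\<lambda>i. if i \<in> V then y i else x i) = f x" using assms(1) by simp
  moreover have "f (\<lambda>i. if i \<in> V then y i else x i) = f y"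
    by (rule poly_fun_cong[OF assms(2)]) simp
  ultimately show ?thesis by simp
qed

lemma openin_nonzero:
  assumes "polynomial_fun V f"
  shows "openin (coord_space V) {x \<in> V \<rightarrow>\<^sub>E UNIV. f x \<noteq> 0}"
proof -
  have "continuous_map (coord_space V) euclideanreal f"
    using assms poly_fun_continuous unfolding generated_fun_def by blast
  then have "openin (coord_space V) {x \<in> topspace (coord_space V). f x \<in> - {0}}"
    by (rule openin_continuous_map_preimage) auto
  then show ?thesis by simp
qed

text \<open>A zero set splits into the part where some partial derivative is non-zero, which is a
  hypersurface, and a part of the zero set of that partial derivative, which has smaller degree.\<close>

lemma zero_set_hypersurfaces:
  fixes f :: "('i \<Rightarrow> real) \<Rightarrow> real"
  assumes "finite V" "poly_fun V d f" "f a \<noteq> 0"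
  shows "\<exists>\<M>. finite \<M> \<and> (\<forall>M\<in>\<M>. submanifold V 1 M) \<and> {x \<in> V \<rightarrow>\<^sub>E UNIV. f x = 0} \<subseteq> \<Union>\<M>"
  using assms(2,3)
proof (induction d arbitrary: f a)
  case 0
  then have "f x \<noteq> 0" for x using poly_fun_0_const by metis
  then show ?case by (intro exI[of _ "{}"]) auto
next
  case (Suc d)
  show ?case
  proof (cases "\<forall>v\<in>V. \<forall>x. partial v 1 f x = 0")
    case True
    then have "f x \<noteq> 0" for x using poly_fun_constant[OF assms(1) Suc.prems(1)] Suc.prems(2) by metis
    then show ?thesis by (intro exI[of _ "{}"]) auto
  next
    case False
    then obtain v a' where v: "v \<in> V" "partial v 1 f a' \<noteq> 0" by blast
    have pd: "poly_fun V d (partial v 1 f)" using poly_fun_partial'(1)[OF Suc.prems(1)] by simp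
    from Suc.IH[OF pd v(2)] obtain \<M> where M: "finite \<M>" "\<forall>M\<in>\<M>. submanifold V 1 M"
      "{x \<in> V \<rightarrow>\<^sub>E UNIV. partial v 1 f x = 0} \<subseteq> \<Union>\<M>" by blast
    define U where "U = {x \<in> V \<rightarrow>\<^sub>E UNIV. partial v 1 f x \<noteq> 0}"
    have "openin (coord_space V) U"
      unfolding U_def using pd by (intro openin_nonzero) (auto simp: generated_fun_def)
    moreover have "smooth_fun_on V U f"
      using Suc.prems(1) by (intro polynomial_fun_smooth) (auto simp: generated_fun_def)
    ultimately have "submanifold V 1 {x \<in> U. f x = 0}"
      unfolding submanifold_def using v(1)
      by (intro conjI ballI exI[of _ U] exI[of _ "\<lambda>_. f"]) (auto simp: U_def)
    with M show ?thesis
      by (intro exI[of _ "insert {x \<in> U. f x = 0} \<M>"]) (auto simp: U_def)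
  qed
qed

lemma openin_positive_vectors: "finite E \<Longrightarrow> openin (coord_space E) (positive_vectors E)"
  unfolding coord_space_def positive_vectors_def by (auto simp: openin_PiE_gen)

text \<open>On the line from \<open>x\<close> to a point \<open>a\<close> with
  \<open>f a \<noteq> 0\<close> the function is a non-zero polynomial in one variable, with finitely
  many roots, while the line stays in the open set for infinitely many parameters.\<close>

lemma nonzero_dense:
  fixes f :: "('i \<Rightarrow> real) \<Rightarrow> real"
  assumes "finite V" "polynomial_fun V f" "f a \<noteq> 0" "openin (coord_space V) T" "x \<in> T"
  shows "\<exists>y\<in>T. f y \<noteq> 0"
proof -
  obtain d where d: "poly_fun V d f" using assms(2) generated_fun_def by blast
  obtain p where p: "\<And>t. f (\<lambda>i. x i + t *\<^sub>R (a i - x i)) = poly p t"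
    using poly_fun_line[OF d] by blast
  from p[of 1] assms(3) have "p \<noteq> 0" by auto
  then have fin: "finite {t. poly p t = 0}" by (rule poly_roots_finite)
  \<comment> \<open>The line is restricted to \<open>V\<close> because members of the coordinate
    space are \<open>undefined\<close> elsewhere; the value of \<open>f\<close> is not
    affected.\<close>
  define h where "h t = (\<lambda>i\<in>V. x i + t *\<^sub>R (a i - x i))" for t
  have "continuous_map euclideanreal (coord_space V) h"
    unfolding coord_space_def h_def
    by (auto simp: continuous_map_componentwise intro!: continuous_intros)
  then have "open {t. h t \<in> T}"
    using openin_continuous_map_preimage[of euclideanreal "coord_space V" h T] assms(4) by simp
  moreover have "h 0 = x"
    using openin_subset[OF assms(4)] assms(5) by (auto simp: h_def PiE_def extensional_def fun_eq_iff)
  ultimately have "infinite {t. h t \<in> T}"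
    using assms(5) by (metis (mono_tags, lifting) empty_iff finite_imp_not_open mem_Collect_eq)
  then have "\<not> {t. h t \<in> T} \<subseteq> {t. poly p t = 0}" using fin finite_subset by blast
  then have "\<exists>t. h t \<in> T \<and> poly p t \<noteq> 0" by blast
  then obtain t where t: "h t \<in> T" "poly p t \<noteq> 0" by blast
  have "f (h t) = poly p t"
    unfolding p[symmetric] by (rule poly_fun_cong[OF d]) (simp add: h_def)
  with t show ?thesis by (intro bexI[of _ "h t"]) auto
qed

lemma generic_set_nonzero:
  assumes "finite E" "polynomial_fun E f" "f a \<noteq> 0"
  shows "generic_set E {x \<in> positive_vectors E. f x \<noteq> 0}"
  unfolding generic_set_def
proof (intro conjI)
  have "{x \<in> positive_vectors E. f x \<noteq> 0} = positive_vectors E \<inter> {x \<in> E \<rightarrow>\<^sub>E UNIV. f x \<noteq> 0}"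
    by (auto simp: positive_vectors_def)
  then show "openin (coord_space E) {x \<in> positive_vectors E. f x \<noteq> 0}"
    using openin_Int[OF openin_positive_vectors[OF assms(1)] openin_nonzero[OF assms(2)]] by simp
  show "positive_vectors E \<subseteq> coord_space E closure_of {x \<in> positive_vectors E. f x \<noteq> 0}"
  proof
    fix x assume x: "x \<in> positive_vectors E"
    have "\<exists>y. y \<in> {x \<in> positive_vectors E. f x \<noteq> 0} \<and> y \<in> T" if "x \<in> T" "openin (coord_space E) T" for T
      using nonzero_dense[OF assms, of "T \<inter> positive_vectors E" x] x that
        openin_positive_vectors[OF assms(1)] by (auto intro: openin_Int)
    then show "x \<in> coord_space E closure_of {x \<in> positive_vectors E. f x \<noteq> 0}"
      using x by (auto simp: in_closure_of positive_vectors_def)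
  qed
  show "\<exists>\<M>. finite \<M> \<and> (\<forall>M\<in>\<M>. \<exists>k\<ge>1. submanifold E k M) \<and>
      positive_vectors E - \<Union>\<M> \<subseteq> {x \<in> positive_vectors E. f x \<noteq> 0}"
  proof -
    obtain d where "poly_fun E d f" using assms(2) generated_fun_def by blast
    from zero_set_hypersurfaces[OF assms(1) this assms(3)] obtain \<M> where
      "finite \<M>" "\<forall>M\<in>\<M>. submanifold E 1 M" "{x \<in> E \<rightarrow>\<^sub>E UNIV. f x = 0} \<subseteq> \<Union>\<M>" by blast
    then show ?thesis
      by (intro exI[of _ \<M>]) (auto simp: positive_vectors_def)
  qed
qed auto

text \<open>Density survives the intersection because \<open>G\<close> is open: a neighbourhood that
  meets \<open>G\<close> does so in a non-empty open set, which then meets \<open>H\<close>.\<close>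

lemma generic_set_Int:
  assumes "generic_set E G" "generic_set E H"
  shows "generic_set E (G \<inter> H)"
  unfolding generic_set_def
proof (intro conjI)
  show "positive_vectors E \<subseteq> coord_space E closure_of (G \<inter> H)"
  proof
    fix x assume x: "x \<in> positive_vectors E"
    have "\<exists>y. y \<in> G \<inter> H \<and> y \<in> T" if T: "x \<in> T" "openin (coord_space E) T" for T
    proof -
      obtain y where y: "y \<in> G" "y \<in> T"
        using assms(1) x T unfolding generic_set_def in_closure_of subset_iff by metis
      have "openin (coord_space E) (G \<inter> T)" "y \<in> positive_vectors E"
        using assms(1) T(2) y unfolding generic_set_def by auto
      then obtain z where "z \<in> H" "z \<in> G \<inter> T"
        using assms(2) y unfolding generic_set_def in_closure_of subset_iff by (metis IntI)
      then show ?thesis by blast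
    qed
    then show "x \<in> coord_space E closure_of (G \<inter> H)"
      using x by (auto simp: in_closure_of positive_vectors_def)
  qed
  obtain \<M> \<N> where "finite \<M>" "\<forall>M\<in>\<M>. \<exists>k\<ge>1. submanifold E k M" "positive_vectors E - \<Union>\<M> \<subseteq> G"
    "finite \<N>" "\<forall>M\<in>\<N>. \<exists>k\<ge>1. submanifold E k M" "positive_vectors E - \<Union>\<N> \<subseteq> H"
    using assms unfolding generic_set_def by meson
  then show "\<exists>\<M>. finite \<M> \<and> (\<forall>M\<in>\<M>. \<exists>k\<ge>1. submanifold E k M) \<and> positive_vectors E - \<Union>\<M> \<subseteq> G \<inter> H"
    by (intro exI[of _ "\<M> \<union> \<N>"]) auto
qed (use assms in \<open>auto simp: generic_set_def\<close>)

text \<open>The interface to genericity: to avoid finitely many coincidences it suffices to confine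
  each of them to the zero set of some non-zero polynomial in the lengths. The polynomial need not
  be known, and its non-zero value may occur at a point with negative coordinates.\<close>

lemma generic_set_INT:
  assumes "finite E" "finite S" "\<And>s. s \<in> S \<Longrightarrow> \<exists>f a. polynomial_fun E f \<and> f a \<noteq> 0 \<and>
    (\<forall>x \<in> positive_vectors E. B s x \<longrightarrow> f x = 0)"
  shows "\<exists>G. generic_set E G \<and> (\<forall>x\<in>G. \<forall>s\<in>S. \<not> B s x)"
  using assms(2,3)
proof (induction S)
  case empty
  have "generic_set E {x \<in> positive_vectors E. (1::real) \<noteq> 0}"
    using assms(1) by (rule generic_set_nonzero) (auto intro: polynomial_fun_intros)
  then show ?case by blast
next
  case (insert s S)
  obtain G where G: "generic_set E G" "\<forall>x\<in>G. \<forall>s\<in>S. \<not> B s x"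
    using insert.IH insert.prems by blast
  obtain f a where f: "polynomial_fun E f" "f a \<noteq> 0"
    "\<And>x. x \<in> positive_vectors E \<Longrightarrow> B s x \<Longrightarrow> f x = 0"
    using insert.prems[of s] by blast
  have "generic_set E (G \<inter> {x \<in> positive_vectors E. f x \<noteq> 0})"
    using generic_set_Int[OF G(1) generic_set_nonzero[OF assms(1) f(1,2)]] .
  moreover have "\<forall>x \<in> G \<inter> {x \<in> positive_vectors E. f x \<noteq> 0}. \<forall>s\<in>insert s S. \<not> B s x"
    using G(2) f(3) by blast
  ultimately show ?case by blast
qed

section \<open>Algebraic dependence of Laurent polynomials\<close>

text \<open>Gaussian elimination by induction on the equations: \<open>c'\<close> arises by using
  the equation \<open>m\<close> to eliminate the pivot unknown \<open>b\<close>, and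
  \<open>w\<close> recovers the value of \<open>b\<close> from a solution of the smaller
  system.\<close>

lemma homogeneous_system_solvable:
  fixes c :: "'a \<Rightarrow> 'b \<Rightarrow> 'c::field"
  assumes "finite M" "finite A" "card M < card A"
  shows "\<exists>v. (\<exists>a\<in>A. v a \<noteq> 0) \<and> (\<forall>m\<in>M. (\<Sum>a\<in>A. v a * c a m) = 0)"
  using assms
proof (induction M arbitrary: A c rule: finite_induct)
  case empty
  then have "A \<noteq> {}" by auto
  then show ?case by (intro exI[of _ "\<lambda>_. 1"]) auto
next
  case (insert m M)
  show ?case
  proof (cases "\<forall>a\<in>A. c a m = 0")
    case True
    obtain v where "\<exists>a\<in>A. v a \<noteq> 0" "\<forall>m\<in>M. (\<Sum>a\<in>A. v a * c a m) = 0"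
      using insert.IH[of A c] insert.prems insert.hyps by (auto simp: card_insert_if)
    with True show ?thesis by (intro exI[of _ v]) auto
  next
    case False
    then obtain b where b: "b \<in> A" "c b m \<noteq> 0" by blast
    define c' where "c' a k = c a k - c b k * (c a m / c b m)" for a k
    have "card M < card (A - {b})" using insert.prems insert.hyps b by simp
    then obtain v where v: "\<exists>a\<in>A - {b}. v a \<noteq> 0" "\<forall>k\<in>M. (\<Sum>a\<in>A - {b}. v a * c' a k) = 0"
      using insert.IH[of "A - {b}" c'] insert.prems by auto
    define w where "w = v(b := - (\<Sum>a\<in>A - {b}. v a * (c a m / c b m)))"
    have split: "(\<Sum>a\<in>A. w a * c a k) = w b * c b k + (\<Sum>a\<in>A - {b}. v a * c a k)" for k
      using sum.remove[OF insert.prems(1) b(1), of "\<lambda>a. w a * c a k"] by (simp add: w_def)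
    have eq: "(\<Sum>a\<in>A. w a * c a k) = (\<Sum>a\<in>A - {b}. v a * c' a k)" for k
      unfolding split by (simp add: w_def c'_def right_diff_distrib sum_subtractf sum_distrib_left mult_ac)
    have "(\<Sum>a\<in>A. w a * c a m) = 0" unfolding eq using b by (simp add: c'_def)
    moreover have "\<exists>a\<in>A. w a \<noteq> 0" using v(1) by (auto simp: w_def)
    ultimately show ?thesis using v(2) eq by (intro exI[of _ w]) auto
  qed
qed

text \<open>Induction on the variables: with all variables except \<open>e\<close> fixed, the sum is
  a polynomial in \<open>x e\<close> that vanishes at every real number, so each of its
  coefficients, a sum of the same kind over the other variables, vanishes.\<close>

lemma monomials_independent:
  fixes v :: "('i \<Rightarrow> nat) \<Rightarrow> real"
  assumes "finite E" "\<And>x. (\<Sum>a\<in>PiE E (\<lambda>_. {..k}). v a * (\<Prod>e\<in>E. x e ^ a e)) = 0"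
    "a \<in> PiE E (\<lambda>_. {..k})"
  shows "v a = 0"
  using assms
proof (induction E arbitrary: v a rule: finite_induct)
  case empty
  then show ?case by simp
next
  case (insert e E)
  have fin: "finite (PiE E (\<lambda>_. {..k}))" using insert.hyps by (intro finite_PiE) auto
  have "(\<Sum>b\<in>PiE E (\<lambda>_. {..k}). v (b(e := i)) * (\<Prod>e\<in>E. x e ^ b e)) = 0" if "i \<le> k" for i x
  proof -
    define d where "d i = (\<Sum>b\<in>PiE E (\<lambda>_. {..k}). v (b(e := i)) * (\<Prod>e\<in>E. x e ^ b e))" for i
    have "(\<Sum>i\<le>k. d i * s ^ i) = 0" for s :: real
    proof -
      have "0 = (\<Sum>a\<in>PiE (insert e E) (\<lambda>_. {..k}). v a * (\<Prod>j\<in>insert e E. (x(e := s)) j ^ a j))"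
        using insert.prems(1)[of "x(e := s)"] by simp
      also have "\<dots> = (\<Sum>(i, b)\<in>{..k} \<times> PiE E (\<lambda>_. {..k}).
          v (b(e := i)) * (\<Prod>j\<in>insert e E. (x(e := s)) j ^ (b(e := i)) j))"
        unfolding PiE_insert_eq
        by (subst sum.reindex) (use inj_combinator[OF insert.hyps(2)] in \<open>auto simp: case_prod_unfold\<close>)
      also have "\<dots> = (\<Sum>(i, b)\<in>{..k} \<times> PiE E (\<lambda>_. {..k}). v (b(e := i)) * (\<Prod>j\<in>E. x j ^ b j) * s ^ i)"
      proof (intro sum.cong refl, clarify)
        fix i b
        have "(\<Prod>j\<in>E. (x(e := s)) j ^ (b(e := i)) j) = (\<Prod>j\<in>E. x j ^ b j)"
          using insert.hyps by (intro prod.cong) auto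
        then show "v (b(e := i)) * (\<Prod>j\<in>insert e E. (x(e := s)) j ^ (b(e := i)) j) =
            v (b(e := i)) * (\<Prod>j\<in>E. x j ^ b j) * s ^ i"
          using insert.hyps by simp
      qed
      also have "\<dots> = (\<Sum>i\<le>k. d i * s ^ i)"
        unfolding d_def sum_distrib_right sum.cartesian_product by simp
      finally show ?thesis by simp
    qed
    then have "\<forall>i\<le>k. d i = 0" using polyfun_eq_0[of d k] by blast
    with that show ?thesis by (simp add: d_def)
  qed
  \<comment> \<open>Exponent families in \<open>PiE E\<close> must be \<open>undefined\<close> off
    \<open>E\<close>, so passing from \<open>insert e E\<close> to \<open>E\<close> resets the
    exponent of \<open>e\<close>.\<close>
  moreover have "a(e := undefined) \<in> PiE E (\<lambda>_. {..k})" "a e \<le> k"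
    using insert.prems(2) insert.hyps(2) by (auto simp: PiE_iff extensional_def)
  ultimately have "v ((a(e := undefined))(e := a e)) = 0"
    using insert.IH[of "\<lambda>b. v (b(e := a e))" "a(e := undefined)"] by blast
  then show ?case by simp
qed

section \<open>Laurent polynomials and the counting argument\<close>

definition laurent_vars :: "'j set \<Rightarrow> (('j \<Rightarrow> complex) \<Rightarrow> complex) set" where
  "laurent_vars J = {\<lambda>y. y j powi s | j s. j \<in> J \<and> (s = 1 \<or> s = -1)}"

abbreviation "laurent J \<equiv> generated (laurent_vars J)"
abbreviation "laurent_fun J \<equiv> generated_fun (laurent_vars J)"

lemma laurent_power: "laurent J d f \<Longrightarrow> laurent J (n * d) (\<lambda>y. f y ^ n)"
proof (induction n)
  case 0
  then show ?case using generated.const[of _ 0 1] by simp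
next
  case (Suc n)
  then show ?case using generated_mult[of _ d f "n * d"] by simp
qed

lemma laurent_prod:
  assumes "\<And>i. i \<in> I \<Longrightarrow> laurent J d (f i)"
  shows "laurent J (card I * d) (\<lambda>y. \<Prod>i\<in>I. f i y)"
  using assms
proof (induction I rule: infinite_finite_induct)
  case (insert i I)
  then have "laurent J (d + card I * d) (\<lambda>y. f i y * (\<Prod>i\<in>I. f i y))" by (intro generated_mult) auto
  with insert.hyps show ?case by simp
qed (auto intro: generated.const)

text \<open>The generators are the variables and their inverses, so a bound \<open>d\<close> on the
  number of factors confines each exponent to the interval from \<open>-d\<close> to
  \<open>d\<close>. The variables must be non-zero, since otherwise \<open>y j powi 1\<close> and
  \<open>y j powi (-1)\<close> do not cancel.\<close>

lemma laurent_normal_form: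
  assumes "finite J" "laurent J d f"
  shows "\<exists>C. \<forall>y. (\<forall>j\<in>J. y j \<noteq> 0) \<longrightarrow>
    f y = (\<Sum>m\<in>PiE J (\<lambda>_. {- int d..int d}). C m * (\<Prod>j\<in>J. y j powi m j))"
  using assms(2)
proof (induction rule: generated.induct)
  case (const d c)
  let ?z = "\<lambda>j\<in>J. 0::int"
  have "finite (PiE J (\<lambda>_. {- int d..int d}))" using assms(1) by (intro finite_PiE) auto
  moreover have "?z \<in> PiE J (\<lambda>_. {- int d..int d})" by auto
  ultimately have "(\<Sum>m\<in>PiE J (\<lambda>_. {- int d..int d}). (if m = ?z then c else 0) * (\<Prod>j\<in>J. y j powi m j)) =
      c * (\<Prod>j\<in>J. y j powi ?z j)" for y :: "'a \<Rightarrow> complex"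
    by (simp add: if_distribR if_distrib[of "\<lambda>x. x * _"] sum.delta cong: if_cong)
  then show ?case by (intro exI[of _ "\<lambda>m. if m = ?z then c else 0"]) simp
next
  case (add d f g)
  then obtain C D where
    "\<And>y. (\<forall>j\<in>J. y j \<noteq> 0) \<Longrightarrow> f y = (\<Sum>m\<in>PiE J (\<lambda>_. {- int d..int d}). C m * (\<Prod>j\<in>J. y j powi m j))"
    "\<And>y. (\<forall>j\<in>J. y j \<noteq> 0) \<Longrightarrow> g y = (\<Sum>m\<in>PiE J (\<lambda>_. {- int d..int d}). D m * (\<Prod>j\<in>J. y j powi m j))"
    by blast
  then show ?case
    by (intro exI[of _ "\<lambda>m. C m + D m"]) (simp add: distrib_right sum.distrib)
next
  case (times h d f)
  then obtain j s where var: "j \<in> J" "s = 1 \<or> s = -1" and h: "h = (\<lambda>y. y j powi s)"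
    unfolding laurent_vars_def by blast
  let ?M = "\<lambda>d. PiE J (\<lambda>_. {- int d..int d})"
  obtain C where C: "\<And>y. (\<forall>j\<in>J. y j \<noteq> 0) \<Longrightarrow> f y = (\<Sum>m\<in>?M d. C m * (\<Prod>j\<in>J. y j powi m j))"
    using times.IH by blast
  \<comment> \<open>Multiplying by \<open>y j powi s\<close> moves every monomial by
    \<open>sh s\<close>; the new coefficients are the old ones transported along this shift and zero
    outside its image.\<close>
  define sh where "sh r m = m(j := m j + r)" for r :: int and m :: "'a \<Rightarrow> int"
  have sh: "sh (-s) (sh s m) = m" for m by (simp add: sh_def)
  have fin: "finite (?M d)" "finite (?M (Suc d))" using assms(1) by (intro finite_PiE; auto)+
  have mem: "sh s m \<in> ?M (Suc d)" if "m \<in> ?M d" for m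
    using that var unfolding sh_def
    by (fastforce simp: PiE_iff extensional_def)
  define D where "D m = (if m \<in> sh s ` ?M d then C (sh (-s) m) else 0)" for m
  have "y j powi s * f y = (\<Sum>m\<in>?M (Suc d). D m * (\<Prod>j\<in>J. y j powi m j))" if y: "\<forall>j\<in>J. y j \<noteq> 0" for y
  proof -
    have pr: "(\<Prod>i\<in>J. y i powi sh s m i) = y j powi s * (\<Prod>i\<in>J. y i powi m i)" for m
    proof -
      have "(\<Prod>i\<in>J - {j}. y i powi sh s m i) = (\<Prod>i\<in>J - {j}. y i powi m i)"
        by (intro prod.cong) (auto simp: sh_def)
      then show ?thesis
        using y var(1) prod.remove[OF assms(1) var(1), of "\<lambda>i. y i powi sh s m i"]
          prod.remove[OF assms(1) var(1), of "\<lambda>i. y i powi m i"]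
        by (simp add: sh_def power_int_add)
    qed
    have "(\<Sum>m\<in>?M (Suc d). D m * (\<Prod>j\<in>J. y j powi m j)) =
        (\<Sum>m\<in>sh s ` ?M d. D m * (\<Prod>j\<in>J. y j powi m j))"
      using fin mem by (intro sum.mono_neutral_right) (auto simp: D_def)
    also have "\<dots> = (\<Sum>m\<in>?M d. C m * (\<Prod>j\<in>J. y j powi sh s m j))"
      using sh by (subst sum.reindex) (auto simp: D_def intro!: inj_on_inverseI[of _ "sh (-s)"])
    also have "\<dots> = y j powi s * f y"
      unfolding C[OF y] by (simp add: pr sum_distrib_left mult_ac)
    finally show ?thesis by simp
  qed
  then show ?case unfolding h by blast
qed

text \<open>Counting: the products of the \<open>f e\<close> with exponents up to \<open>k\<close> number \<open>(k + 1) ^ card E\<close>, but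
  involve only \<open>O(k ^ card J)\<close> Laurent monomials.\<close>

lemma laurent_dependence:
  fixes f :: "'i \<Rightarrow> ('j \<Rightarrow> complex) \<Rightarrow> complex"
  assumes "finite E" "finite J" "card J < card E" "\<And>e. e \<in> E \<Longrightarrow> laurent J d (f e)"
  shows "\<exists>P a. polynomial_fun E P \<and> P a \<noteq> (0::real) \<and>
    (\<forall>y x. (\<forall>j\<in>J. y j \<noteq> 0) \<and> (\<forall>e\<in>E. of_real (x e) = f e y) \<longrightarrow> P x = 0)"
proof -
  define N where "N = card E"
  \<comment> \<open>The choice \<open>k = K ^ card J\<close> makes the count close: there are at
    most \<open>(K * (k + 1)) ^ card J = k * (k + 1) ^ card J\<close> monomials, fewer than the
    \<open>(k + 1) ^ card E\<close> products.\<close>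
  define K where "K = 2 * (N * d) + 1"
  define k where "k = K ^ card J"
  let ?A = "PiE E (\<lambda>_. {..k})"
  define D where "D = N * (k * d)"
  let ?M = "PiE J (\<lambda>_. {- int D..int D})"
  have finA: "finite ?A" and finM: "finite ?M" using assms by (auto intro!: finite_PiE)
  have "card ?M = (2 * D + 1) ^ card J"
    using assms(2) by (simp add: card_PiE nat_add_distrib nat_mult_distrib)
  also have "\<dots> \<le> (K * (k + 1)) ^ card J"
    by (intro power_mono) (auto simp: K_def D_def algebra_simps)
  also have "\<dots> = k * (k + 1) ^ card J" by (simp only: power_mult_distrib k_def)
  also have "\<dots> < (k + 1) ^ Suc (card J)" by simp
  also have "\<dots> \<le> (k + 1) ^ card E" using assms(3) by (intro power_increasing) auto
  also have "\<dots> = card ?A" using assms(1) by (simp add: card_PiE)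
  finally have card: "card ?M < card ?A" .
  have "\<forall>a\<in>?A. \<exists>C. \<forall>y. (\<forall>j\<in>J. y j \<noteq> 0) \<longrightarrow>
      (\<Prod>e\<in>E. f e y ^ a e) = (\<Sum>m\<in>?M. C m * (\<Prod>j\<in>J. y j powi m j))"
  proof (intro ballI, rule laurent_normal_form[OF assms(2)])
    fix a assume a: "a \<in> ?A"
    have "laurent J (k * d) (\<lambda>y. f e y ^ a e)" if "e \<in> E" for e
    proof (rule generated_mono[OF laurent_power[OF assms(4)[OF that]]])
      show "a e * d \<le> k * d" using that a by (intro mult_right_mono) auto
    qed
    then show "laurent J D (\<lambda>y. \<Prod>e\<in>E. f e y ^ a e)"
      unfolding D_def N_def by (intro laurent_prod)
  qed
  then obtain C where C: "\<And>a y. a \<in> ?A \<Longrightarrow> (\<forall>j\<in>J. y j \<noteq> 0) \<Longrightarrow>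
      (\<Prod>e\<in>E. f e y ^ a e) = (\<Sum>m\<in>?M. C a m * (\<Prod>j\<in>J. y j powi m j))"
    unfolding bchoice_iff by blast
  obtain v a0 where v: "a0 \<in> ?A" "v a0 \<noteq> 0" "\<And>m. m \<in> ?M \<Longrightarrow> (\<Sum>a\<in>?A. v a * C a m) = 0"
    using homogeneous_system_solvable[OF finM finA card, of C] by blast
  \<comment> \<open>The dependence has complex coefficients, but a real polynomial is wanted.
    Multiplying by \<open>cnj (v a0)\<close> before taking real parts turns the coefficient of
    \<open>a0\<close> into its squared modulus, so the real polynomial is non-zero. The relation
    survives because the values \<open>x e\<close> are real.\<close>
  define P :: "('i \<Rightarrow> real) \<Rightarrow> real"
    where "P x = (\<Sum>a\<in>?A. Re (cnj (v a0) * v a) * (\<Prod>e\<in>E. x e ^ a e))" for x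
  have "polynomial_fun E P"
    unfolding P_def by (intro polynomial_fun_intros)
  moreover have "\<exists>x. P x \<noteq> 0"
  proof (rule ccontr)
    assume "\<not> ?thesis"
    then have "(\<Sum>a\<in>?A. Re (cnj (v a0) * v a) * (\<Prod>e\<in>E. x e ^ a e)) = 0" for x
      by (simp add: P_def)
    from monomials_independent[OF assms(1) this v(1)] have "Re (cnj (v a0) * v a0) = 0" .
    then show False using v(2) by (simp add: complex_eq_iff sum_squares_eq_zero_iff)
  qed
  moreover have "P x = 0" if y: "\<forall>j\<in>J. y j \<noteq> 0" and x: "\<forall>e\<in>E. of_real (x e) = f e y" for x y
  proof -
    have "(\<Sum>a\<in>?A. v a * (\<Prod>e\<in>E. f e y ^ a e)) =
        (\<Sum>a\<in>?A. \<Sum>m\<in>?M. v a * C a m * (\<Prod>j\<in>J. y j powi m j))"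
      using C y by (intro sum.cong) (auto simp: sum_distrib_left mult_ac)
    also have "\<dots> = (\<Sum>m\<in>?M. (\<Sum>a\<in>?A. v a * C a m) * (\<Prod>j\<in>J. y j powi m j))"
      by (subst sum.swap) (simp add: sum_distrib_right)
    also have "\<dots> = 0" using v(3) by simp
    finally have z: "(\<Sum>a\<in>?A. v a * (\<Prod>e\<in>E. f e y ^ a e)) = 0" .
    define r where "r a = (\<Prod>e\<in>E. x e ^ a e)" for a
    have "(\<Prod>e\<in>E. f e y ^ a e) = of_real (r a)" for a
      using x by (simp add: r_def)
    with z have "(\<Sum>a\<in>?A. v a * of_real (r a)) = 0" by simp
    then have "Re (\<Sum>a\<in>?A. (cnj (v a0) * v a) * of_real (r a)) = 0"
      by (simp add: mult.assoc flip: sum_distrib_left)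
    then have "(\<Sum>a\<in>?A. Re (cnj (v a0) * v a) * r a) = 0" by simp
    then show ?thesis by (simp only: P_def r_def)
  qed
  ultimately show ?thesis by blast
qed

lemma laurent_varsI: "j \<in> J \<Longrightarrow> s = 1 \<or> s = -1 \<Longrightarrow> (\<lambda>y. y j powi s) \<in> laurent_vars J"
  unfolding laurent_vars_def by blast

lemma laurent_fun_var: "j \<in> J \<Longrightarrow> laurent_fun J (\<lambda>y. y j)"
  using generated_fun_generator[OF laurent_varsI, of j J 1] by simp

lemma laurent_fun_inverse_var: "j \<in> J \<Longrightarrow> laurent_fun J (\<lambda>y. inverse (y j))"
  using generated_fun_generator[OF laurent_varsI, of j J "-1"] by (simp add: power_int_minus)

lemmas laurent_fun_intros = generated_fun_intros laurent_fun_var laurent_fun_inverse_var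

lemma laurent_fun_dependence:
  fixes f :: "'i \<Rightarrow> ('j \<Rightarrow> complex) \<Rightarrow> complex"
  assumes "finite E" "finite J" "card J < card E" "\<And>e. e \<in> E \<Longrightarrow> laurent_fun J (f e)"
  shows "\<exists>P a. polynomial_fun E P \<and> P a \<noteq> (0::real) \<and>
    (\<forall>y x. (\<forall>j\<in>J. y j \<noteq> 0) \<and> (\<forall>e\<in>E. of_real (x e) = f e y) \<longrightarrow> P x = 0)"
proof -
  obtain d where d: "\<And>e. e \<in> E \<Longrightarrow> laurent J (d e) (f e)"
    using assms(4) unfolding generated_fun_def by metis
  have "d e \<le> Max (d ` E)" if "e \<in> E" for e using assms(1) that by simp
  with d have "\<And>e. e \<in> E \<Longrightarrow> laurent J (Max (d ` E)) (f e)" using generated_mono by blast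
  from laurent_dependence[OF assms(1-3) this] show ?thesis .
qed

section \<open>Linkages made of chains\<close>

lemma mem_config_class:
  "y \<in> config_class L x \<longleftrightarrow> (\<exists>w t. cmod w = 1 \<and> y = (\<lambda>v\<in>verts L. w * x v + t))"
  by (simp add: config_class_def congruence_def)

lemma config_class_self: "x \<in> configs L \<Longrightarrow> x \<in> config_class L x"
  unfolding mem_config_class
  by (intro exI[of _ 1] exI[of _ 0]) (auto simp: configs_def PiE_iff extensional_def fun_eq_iff)

lemma verts_edge: "(u, v, l) \<in> L \<Longrightarrow> u \<in> verts L \<and> v \<in> verts L"
  by (auto simp: verts_def)

lemma config_class_configs:
  assumes "y \<in> config_class L x" "x \<in> configs L"
  shows "y \<in> configs L"
proof -
  obtain w t where w: "cmod w = 1" "y = (\<lambda>v\<in>verts L. w * x v + t)"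
    using assms(1) mem_config_class by blast
  have "dist (y u) (y v) = dist (x u) (x v)" if "(u, v, l) \<in> L" for u v l
    using verts_edge[OF that] w(1)
    by (simp add: w(2) dist_norm norm_mult flip: right_diff_distrib)
  then show ?thesis using assms(2) w(2) by (auto simp: configs_def)
qed

lemma config_class_eq:
  assumes "y \<in> config_class L x"
  shows "config_class L y = config_class L x"
proof -
  obtain w t where w: "cmod w = 1" "y = (\<lambda>v\<in>verts L. w * x v + t)"
    using assms mem_config_class by blast
  then have "w \<noteq> 0" by auto
  show ?thesis
  proof (intro set_eqI iffI)
    fix z assume "z \<in> config_class L y"
    then obtain w' t' where "cmod w' = 1" "z = (\<lambda>v\<in>verts L. w' * y v + t')"
      using mem_config_class by blast
    then show "z \<in> config_class L x"
      unfolding mem_config_class using w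
      by (intro exI[of _ "w' * w"] exI[of _ "w' * t + t'"])
         (auto simp: norm_mult algebra_simps fun_eq_iff)
  next
    fix z assume "z \<in> config_class L x"
    then obtain w' t' where "cmod w' = 1" "z = (\<lambda>v\<in>verts L. w' * x v + t')"
      using mem_config_class by blast
    then show "z \<in> config_class L y"
      unfolding mem_config_class using w \<open>w \<noteq> 0\<close>
      by (intro exI[of _ "w' / w"] exI[of _ "t' - w' / w * t"])
         (auto simp: norm_divide field_simps fun_eq_iff)
  qed
qed

lemma reduced_configs_iff: "\<xi> \<in> reduced_configs L \<longleftrightarrow> (\<exists>x\<in>configs L. \<xi> = config_class L x)"
  by (auto simp: reduced_configs_def quotient_def config_class_def)

lemma mem_reduced_config:
  assumes "\<xi> \<in> reduced_configs L" "x \<in> \<xi>"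
  shows "x \<in> configs L" "\<xi> = config_class L x"
  using assms config_class_configs config_class_eq unfolding reduced_configs_iff by blast+

text \<open>\<open>reduced_submanifold\<close> speaks about the preimage of a set of classes; for
  the full reduced space this preimage is \<open>configs L\<close>.\<close>

lemma Union_reduced_configs: "\<Union>(reduced_configs L) = configs L"
proof
  show "\<Union>(reduced_configs L) \<subseteq> configs L" using mem_reduced_config(1) by blast
  show "configs L \<subseteq> \<Union>(reduced_configs L)"
  proof
    fix x assume "x \<in> configs L"
    then have "x \<in> config_class L x" "config_class L x \<in> reduced_configs L"
      using config_class_self reduced_configs_iff by blast+
    then show "x \<in> \<Union>(reduced_configs L)" by blast
  qed
qed

section \<open>Edges of a three-chain linkage and their vectors\<close>

lemma UNIV_chain: "(UNIV :: chain set) = {ChA, ChB, ChZ}"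
  using chain.exhaust by auto

lemma all_chain: "(\<forall>\<kappa>. P \<kappa>) \<longleftrightarrow> P ChA \<and> P ChB \<and> P ChZ"
  by (metis chain.exhaust)

lemma edge_indices_Sigma: "edge_indices n = Sigma UNIV (\<lambda>\<kappa>. {..<n \<kappa>})"
  by (auto simp: edge_indices_def)

lemma finite_edge_indices [simp]: "finite (edge_indices n)"
  unfolding edge_indices_Sigma by (intro finite_SigmaI) (auto simp: UNIV_chain)

lemma sum_edge_indices:
  "(\<Sum>e\<in>edge_indices n. f e) =
    (\<Sum>i<n ChA. f (ChA, i)) + (\<Sum>i<n ChB. f (ChB, i)) + (\<Sum>i<n ChZ. f (ChZ, i))"
  unfolding edge_indices_Sigma
  using sum.Sigma[of UNIV "\<lambda>\<kappa>. {..<n \<kappa>}" "\<lambda>\<kappa> i. f (\<kappa>, i)"] by (simp add: UNIV_chain add_ac)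

lemma card_edge_indices: "card (edge_indices n) = n ChA + n ChB + n ChZ"
  using sum_edge_indices[of "\<lambda>_. 1::nat" n] by simp

text \<open>Every chain is oriented from I to T, also B. So the edge vectors of each of the three
  chains have the same sum \<open>x VT - x VI\<close>, and this is the only relation between the
  chains.\<close>

definition edge_vec :: "(chain \<Rightarrow> nat) \<Rightarrow> (vertex \<Rightarrow> complex) \<Rightarrow> chain \<times> nat \<Rightarrow> complex" where
  "edge_vec n x e = x (chain_vertex n (fst e) (Suc (snd e))) - x (chain_vertex n (fst e) (snd e))"

lemma chain_vertex_0 [simp]: "chain_vertex n \<kappa> 0 = VI"
  by (simp add: chain_vertex_def)

lemma chain_vertex_end [simp]: "n \<kappa> \<ge> 1 \<Longrightarrow> chain_vertex n \<kappa> (n \<kappa>) = VT"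
  by (simp add: chain_vertex_def)

lemma verts_open_chain:
  assumes "n \<kappa> \<ge> 1"
  shows "verts (open_chain n len \<kappa>) = chain_vertex n \<kappa> ` {..n \<kappa>}"
proof
  show "verts (open_chain n len \<kappa>) \<subseteq> chain_vertex n \<kappa> ` {..n \<kappa>}"
    by (auto simp: verts_def open_chain_def intro: imageI)
  have "chain_vertex n \<kappa> i \<in> verts (open_chain n len \<kappa>)" if "i \<le> n \<kappa>" for i
  proof (cases "i < n \<kappa>")
    case True
    then show ?thesis unfolding verts_def open_chain_def by fastforce
  next
    case False
    with that assms have "i = Suc (n \<kappa> - 1)" "n \<kappa> - 1 < n \<kappa>" by auto
    then show ?thesis unfolding verts_def open_chain_def by fastforce
  qed
  then show "chain_vertex n \<kappa> ` {..n \<kappa>} \<subseteq> verts (open_chain n len \<kappa>)" by auto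
qed

lemma verts_Un: "verts (L \<union> L') = verts L \<union> verts L'"
  by (auto simp: verts_def)

lemma sum_edge_vec_upto: "(\<Sum>i<j. edge_vec n x (\<kappa>, i)) = x (chain_vertex n \<kappa> j) - x VI"
  using sum_lessThan_telescope[of "\<lambda>i. x (chain_vertex n \<kappa> i)" j] by (simp add: edge_vec_def)

lemma sum_edge_vec: "n \<kappa> \<ge> 1 \<Longrightarrow> (\<Sum>i<n \<kappa>. edge_vec n x (\<kappa>, i)) = x VT - x VI"
  by (simp add: sum_edge_vec_upto)

text \<open>In the set \<open>three_chain n len\<close> two chains consisting of one edge of equal
  length would be identified. Indexing by \<open>edge_indices n\<close> counts their equations
  separately, as the codimension \<open>p + q + r\<close> requires.\<close>

lemma configs_three_chain_iff:
  "x \<in> configs (three_chain n len) \<longleftrightarrow> x \<in> verts (three_chain n len) \<rightarrow>\<^sub>E UNIV \<and>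
    (\<forall>e\<in>edge_indices n. cmod (edge_vec n x e) = len e)"
proof -
  have "(\<forall>(u, v, l)\<in>three_chain n len. dist (x u) (x v) = l) \<longleftrightarrow>
      (\<forall>\<kappa>. \<forall>i<n \<kappa>. cmod (edge_vec n x (\<kappa>, i)) = len (\<kappa>, i))"
    unfolding three_chain_def open_chain_def edge_vec_def
    by (subst all_chain) (auto simp: ball_Un dist_norm norm_minus_commute)
  then show ?thesis by (auto simp: configs_def edge_indices_def)
qed

lemma configs_two_chain_edge:
  assumes "x \<in> configs (two_chain_cycle n len \<kappa> \<kappa>')" "\<mu> = \<kappa> \<or> \<mu> = \<kappa>'" "i < n \<mu>"
  shows "cmod (edge_vec n x (\<mu>, i)) = len (\<mu>, i)"
proof -
  have "(chain_vertex n \<mu> i, chain_vertex n \<mu> (Suc i), len (\<mu>, i)) \<in> two_chain_cycle n len \<kappa> \<kappa>'"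
    using assms(2,3) by (auto simp: two_chain_cycle_def open_chain_def)
  then have "dist (x (chain_vertex n \<mu> i)) (x (chain_vertex n \<mu> (Suc i))) = len (\<mu>, i)"
    using assms(1) by (auto simp: configs_def)
  then show ?thesis by (simp add: edge_vec_def dist_norm norm_minus_commute)
qed

section \<open>Straight chains and signed sums of lengths\<close>

definition straight :: "(chain \<Rightarrow> nat) \<Rightarrow> (vertex \<Rightarrow> complex) \<Rightarrow> chain \<Rightarrow> bool" where
  "straight n x \<kappa> \<longleftrightarrow>
    (\<exists>d. cmod d = 1 \<and> (\<forall>i<n \<kappa>. \<exists>s. edge_vec n x (\<kappa>, i) = of_real s * d))"

lemma collinear_straight:
  assumes "collinear S" "n \<kappa> \<ge> 1" "\<And>i. i \<le> n \<kappa> \<Longrightarrow> x (chain_vertex n \<kappa> i) \<in> S"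
  shows "straight n x \<kappa>"
proof -
  obtain u where u: "\<And>a b. a \<in> S \<Longrightarrow> b \<in> S \<Longrightarrow> \<exists>c. a - b = c *\<^sub>R u"
    using assms(1) unfolding collinear_def by blast
  \<comment> \<open>The direction \<open>u\<close> supplied by collinearity may be zero, namely when
    all points coincide; then any unit vector serves.\<close>
  define d where "d = (if u = 0 then 1 else sgn u)"
  have "\<exists>s. edge_vec n x (\<kappa>, i) = of_real s * d" if i: "i < n \<kappa>" for i
  proof -
    obtain c where "edge_vec n x (\<kappa>, i) = c *\<^sub>R u"
      using u assms(3) i unfolding edge_vec_def by (metis Suc_leI fst_conv less_imp_le snd_conv)
    then show ?thesis
      by (intro exI[of _ "c * cmod u"]) (auto simp: d_def sgn_eq scaleR_conv_of_real)
  qed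
  moreover have "cmod d = 1" by (simp add: d_def norm_sgn)
  ultimately show ?thesis unfolding straight_def by blast
qed

lemma straight_aligned:
  assumes "straight n x \<kappa>" "n \<kappa> \<ge> 1"
  shows "aligned (open_chain n len \<kappa>) x"
proof -
  obtain d s where d: "cmod d = 1" "\<And>i. i < n \<kappa> \<Longrightarrow> edge_vec n x (\<kappa>, i) = of_real (s i) * d"
    using assms(1) unfolding straight_def by metis
  have pos: "x (chain_vertex n \<kappa> j) = x VI + (\<Sum>i<j. s i) *\<^sub>R d" if "j \<le> n \<kappa>" for j
  proof -
    have "(\<Sum>i<j. edge_vec n x (\<kappa>, i)) = (\<Sum>i<j. of_real (s i) * d)"
      using that d(2) by (intro sum.cong) auto
    then have "x (chain_vertex n \<kappa> j) - x VI = of_real (\<Sum>i<j. s i) * d"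
      by (simp add: sum_edge_vec_upto sum_distrib_right)
    then show ?thesis by (simp only: scaleR_conv_of_real) (simp add: algebra_simps)
  qed
  have "\<exists>c. a - b = c *\<^sub>R d" if ab: "a \<in> x ` verts (open_chain n len \<kappa>)" "b \<in> x ` verts (open_chain n len \<kappa>)" for a b
  proof -
    obtain i j where "i \<le> n \<kappa>" "j \<le> n \<kappa>" "a = x (chain_vertex n \<kappa> i)" "b = x (chain_vertex n \<kappa> j)"
      using ab unfolding verts_open_chain[of n \<kappa>, OF assms(2)] by auto
    then show ?thesis
      by (intro exI[of _ "(\<Sum>i<i. s i) - (\<Sum>i<j. s i)"]) (simp add: pos algebra_simps)
  qed
  then show ?thesis unfolding aligned_def collinear_def by blast
qed

lemma aligned_iff_straight: "n \<kappa> \<ge> 1 \<Longrightarrow> aligned (open_chain n len \<kappa>) x \<longleftrightarrow> straight n x \<kappa>"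
  using straight_aligned[of n x \<kappa> len] collinear_straight[of "x ` verts (open_chain n len \<kappa>)" n \<kappa> x]
  unfolding aligned_def by (auto simp: verts_open_chain)

text \<open>Since \<open>d\<close> in \<open>straight\<close> is a unit vector, the scalar factors
  are the lengths up to sign. A degenerate position thus puts |IT| among finitely many values that
  are absolute values of linear forms in the lengths, which is what genericity can control.\<close>

lemma straight_signed_sum:
  assumes "straight n x \<kappa>" "n \<kappa> \<ge> 1" "\<And>i. i < n \<kappa> \<Longrightarrow> cmod (edge_vec n x (\<kappa>, i)) = len (\<kappa>, i)"
  obtains \<epsilon> :: "nat \<Rightarrow> real" where "\<And>i. \<epsilon> i \<in> {-1, 1}"
    "cmod (x VT - x VI) = \<bar>\<Sum>i<n \<kappa>. \<epsilon> i * len (\<kappa>, i)\<bar>"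
proof -
  obtain d s where d: "cmod d = 1" "\<And>i. i < n \<kappa> \<Longrightarrow> edge_vec n x (\<kappa>, i) = of_real (s i) * d"
    using assms(1) unfolding straight_def by metis
  define \<epsilon> where "\<epsilon> i = (if s i \<ge> 0 then 1 else (-1::real))" for i
  have "s i = \<epsilon> i * len (\<kappa>, i)" if "i < n \<kappa>" for i
    using d(1) d(2)[OF that] assms(3)[OF that] by (auto simp: \<epsilon>_def norm_mult)
  then have "(\<Sum>i<n \<kappa>. edge_vec n x (\<kappa>, i)) = of_real (\<Sum>i<n \<kappa>. \<epsilon> i * len (\<kappa>, i)) * d"
    using d(2) by (simp add: sum_distrib_right)
  then have "cmod (x VT - x VI) = \<bar>\<Sum>i<n \<kappa>. \<epsilon> i * len (\<kappa>, i)\<bar>"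
    unfolding sum_edge_vec[of n \<kappa>, OF assms(2)] using d(1) by (simp add: norm_mult del: of_real_sum)
  then show ?thesis using that[of \<epsilon>] by (simp add: \<epsilon>_def)
qed

section \<open>Generic edge lengths\<close>

text \<open>The coefficient 0 lets the first condition apply to a single chain or to a pair of
  chains. The zero family \<open>\<epsilon>\<close> in the second condition says that I and T are
  distinct in every cyclic polygon AB.\<close>

definition generic_lengths :: "(chain \<Rightarrow> nat) \<Rightarrow> (chain \<times> nat \<Rightarrow> real) \<Rightarrow> bool" where
  "generic_lengths n len \<longleftrightarrow> len \<in> positive_vectors (edge_indices n) \<and>
    (\<forall>\<epsilon> \<in> edge_indices n \<rightarrow>\<^sub>E {-1, 0, 1}. (\<exists>e\<in>edge_indices n. \<epsilon> e \<noteq> 0) \<longrightarrow>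
       (\<Sum>e\<in>edge_indices n. \<epsilon> e * len e) \<noteq> 0) \<and>
    (\<forall>g \<in> configs (two_chain_cycle n len ChA ChB). cyclic (two_chain_cycle n len ChA ChB) g \<longrightarrow>
       (\<forall>\<epsilon> \<in> {..<n ChZ} \<rightarrow>\<^sub>E {-1, 0, 1}.
          dist (g VI) (g VT) \<noteq> \<bar>\<Sum>j<n ChZ. \<epsilon> j * len (ChZ, j)\<bar>))"

text \<open>For a square root of modulus one, \<open>inverse\<close> is \<open>cnj\<close>, so
  \<open>\<omega> - inverse \<omega>\<close> is \<open>2 * \<i>\<close> times the imaginary part:
  the chord is twice the sine of the half angle, written as a Laurent polynomial. Of the two roots
  the one with non-negative imaginary part removes the absolute value.\<close>

lemma chord_half_angle:
  assumes "cmod s = 1"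
  shows "\<exists>\<omega>. \<omega> \<noteq> 0 \<and> \<omega>\<^sup>2 = s \<and> of_real (cmod (s - 1)) = - \<i> * (\<omega> - inverse \<omega>)"
proof -
  define z where "z = csqrt s"
  have z: "z\<^sup>2 = s" by (simp add: z_def)
  have nz: "cmod z = 1" using assms by (simp add: z_def)
  have inv: "inverse w = cnj w" if "cmod w = 1" for w
    using that by (simp add: inverse_complex_def complex_norm_square[symmetric] cmod_def complex_eq_iff)
  have "s - 1 = z * (z - cnj z)"
    using nz z complex_norm_square[of z] by (simp add: algebra_simps power2_eq_square)
  then have "cmod (s - 1) = cmod (z - cnj z)" using nz by (simp add: norm_mult)
  also have "\<dots> = 2 * \<bar>Im z\<bar>" by (simp add: complex_diff_cnj norm_mult)
  finally have c: "cmod (s - 1) = 2 * \<bar>Im z\<bar>" .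
  define \<omega> where "\<omega> = (if Im z \<ge> 0 then z else - z)"
  have "- \<i> * (\<omega> - inverse \<omega>) = of_real (2 * \<bar>Im z\<bar>)"
    using nz inv[of \<omega>] by (auto simp: \<omega>_def complex_eq_iff)
  moreover have "\<omega> \<noteq> 0" "\<omega>\<^sup>2 = s" using nz z by (auto simp: \<omega>_def)
  ultimately show ?thesis using c by auto
qed

text \<open>The squares of the half-angle factors are the ratios of consecutive radius vectors, so
  their product telescopes. Each root is chosen separately by the sign of its sine, hence only the
  square of the product is determined.\<close>

lemma cyclic_chain_half_angles:
  fixes P :: "nat \<Rightarrow> complex"
  assumes "\<rho> > 0" "\<And>i. i \<le> N \<Longrightarrow> dist m (P i) = \<rho>"
  obtains \<omega> where "\<And>i. i < N \<Longrightarrow> \<omega> i \<noteq> 0"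
    "\<And>i. i < N \<Longrightarrow> of_real (cmod (P (Suc i) - P i)) = - \<i> * of_real \<rho> * (\<omega> i - inverse (\<omega> i))"
    "(\<Prod>i<N. \<omega> i)\<^sup>2 = (P N - m) / (P 0 - m)"
proof -
  define \<zeta> where "\<zeta> i = P i - m" for i
  have \<zeta>: "cmod (\<zeta> i) = \<rho>" if "i \<le> N" for i
    using assms(2)[OF that] by (simp add: \<zeta>_def dist_norm norm_minus_commute)
  then have nz: "\<zeta> i \<noteq> 0" if "i \<le> N" for i using assms(1) that by fastforce
  have "\<exists>w. i < N \<longrightarrow> w \<noteq> 0 \<and> w\<^sup>2 = \<zeta> (Suc i) / \<zeta> i \<and>
      of_real (cmod (\<zeta> (Suc i) / \<zeta> i - 1)) = - \<i> * (w - inverse w)" for i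
    using chord_half_angle[of "\<zeta> (Suc i) / \<zeta> i"] \<zeta>[of i] \<zeta>[of "Suc i"] assms(1)
    by (auto simp: norm_divide)
  then obtain \<omega> where w: "\<And>i. i < N \<Longrightarrow> \<omega> i \<noteq> 0" "\<And>i. i < N \<Longrightarrow> (\<omega> i)\<^sup>2 = \<zeta> (Suc i) / \<zeta> i"
    "\<And>i. i < N \<Longrightarrow> of_real (cmod (\<zeta> (Suc i) / \<zeta> i - 1)) = - \<i> * (\<omega> i - inverse (\<omega> i))"
    by metis
  have "of_real (cmod (P (Suc i) - P i)) = - \<i> * of_real \<rho> * (\<omega> i - inverse (\<omega> i))" if i: "i < N" for i
  proof -
    have "P (Suc i) - P i = \<zeta> i * (\<zeta> (Suc i) / \<zeta> i - 1)"
      using nz[of i] i by (simp add: \<zeta>_def field_simps)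
    then have "cmod (P (Suc i) - P i) = \<rho> * cmod (\<zeta> (Suc i) / \<zeta> i - 1)"
      using \<zeta>[of i] i by (metis less_imp_le norm_mult)
    then show ?thesis using w(3)[OF i] by simp
  qed
  moreover have "(\<Prod>i<k. \<omega> i)\<^sup>2 = \<zeta> k / \<zeta> 0" if "k \<le> N" for k
    using that
  proof (induction k)
    case 0
    then show ?case using nz[of 0] by simp
  next
    case (Suc k)
    then show ?case using w(2)[of k] nz[of k] by (simp add: power_mult_distrib)
  qed
  ultimately show ?thesis using that[of \<omega>] w(1) by (auto simp: \<zeta>_def)
qed

text \<open>Only the algebraic relations are kept: \<open>\<rho>\<close> may be any non-zero complex
  number and \<open>\<omega> e\<close> need not have modulus one. The chain Z is left out because
  its vertices need not lie on the circle.\<close>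

definition half_angles ::
  "(chain \<Rightarrow> nat) \<Rightarrow> (chain \<times> nat \<Rightarrow> real) \<Rightarrow> complex \<Rightarrow> (chain \<times> nat \<Rightarrow> complex) \<Rightarrow> bool" where
  "half_angles n len \<rho> \<omega> \<longleftrightarrow> \<rho> \<noteq> 0 \<and> (\<forall>e\<in>edge_indices n. fst e \<noteq> ChZ \<longrightarrow>
     \<omega> e \<noteq> 0 \<and> of_real (len e) = - \<i> * \<rho> * (\<omega> e - inverse (\<omega> e)))"

text \<open>The products over A and over B are square roots of the same ratio of radius vectors at T
  and I, whence the sign \<open>s\<close>; the chord IT has a half angle of its own, equal to the
  product over A up to the sign \<open>s'\<close>.\<close>

lemma cyclic_half_angles:
  assumes pos: "\<And>\<kappa>. n \<kappa> \<ge> 1"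
    and g: "g \<in> configs (two_chain_cycle n len ChA ChB)" "cyclic (two_chain_cycle n len ChA ChB) g"
  obtains \<rho> \<omega> s s' where "half_angles n len \<rho> \<omega>" "s \<in> {-1, 1}" "s' \<in> {-1, 1}"
    "(\<Prod>i<n ChA. \<omega> (ChA, i)) = s * (\<Prod>i<n ChB. \<omega> (ChB, i))"
    "of_real (dist (g VI) (g VT)) =
       s' * (- \<i>) * \<rho> * ((\<Prod>i<n ChA. \<omega> (ChA, i)) - inverse (\<Prod>i<n ChA. \<omega> (ChA, i)))"
proof -
  obtain m \<rho> where m: "\<rho> > 0" "g ` verts (two_chain_cycle n len ChA ChB) \<subseteq> sphere m \<rho>"
    using g(2) unfolding cyclic_def circumscribed_def by blast
  have on: "dist m (g (chain_vertex n \<kappa> i)) = \<rho>" if "\<kappa> = ChA \<or> \<kappa> = ChB" "i \<le> n \<kappa>" for \<kappa> i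
    using m(2) that verts_open_chain[of n \<kappa> len, OF pos]
    by (auto simp: two_chain_cycle_def verts_Un image_subset_iff)
  obtain a where a: "\<And>i. i < n ChA \<Longrightarrow> a i \<noteq> 0"
    "\<And>i. i < n ChA \<Longrightarrow> of_real (cmod (edge_vec n g (ChA, i))) = - \<i> * of_real \<rho> * (a i - inverse (a i))"
    "(\<Prod>i<n ChA. a i)\<^sup>2 = (g VT - m) / (g VI - m)"
    using cyclic_chain_half_angles[of \<rho> "n ChA" m "\<lambda>i. g (chain_vertex n ChA i)"] m(1) on pos
    unfolding edge_vec_def by auto
  obtain b where b: "\<And>i. i < n ChB \<Longrightarrow> b i \<noteq> 0"
    "\<And>i. i < n ChB \<Longrightarrow> of_real (cmod (edge_vec n g (ChB, i))) = - \<i> * of_real \<rho> * (b i - inverse (b i))"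
    "(\<Prod>i<n ChB. b i)\<^sup>2 = (g VT - m) / (g VI - m)"
    using cyclic_chain_half_angles[of \<rho> "n ChB" m "\<lambda>i. g (chain_vertex n ChB i)"] m(1) on pos
    unfolding edge_vec_def by auto
  define \<omega> where "\<omega> e = (if fst e = ChA then a (snd e) else b (snd e))" for e
  define A where "A = (\<Prod>i<n ChA. a i)"
  define B where "B = (\<Prod>i<n ChB. b i)"
  have prods: "(\<Prod>i<n ChA. \<omega> (ChA, i)) = A" "(\<Prod>i<n ChB. \<omega> (ChB, i)) = B"
    by (simp_all add: \<omega>_def A_def B_def)
  have "half_angles n len (of_real \<rho>) \<omega>"
    unfolding half_angles_def
  proof (intro conjI ballI impI)
    fix e assume e: "e \<in> edge_indices n" "fst e \<noteq> ChZ"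
    then obtain \<kappa> i where \<kappa>: "e = (\<kappa>, i)" "i < n \<kappa>" "\<kappa> = ChA \<or> \<kappa> = ChB"
      by (cases e; cases "fst e") (auto simp: edge_indices_def)
    with a b configs_two_chain_edge[OF g(1)]
    show "\<omega> e \<noteq> 0" "of_real (len e) = - \<i> * of_real \<rho> * (\<omega> e - inverse (\<omega> e))"
      by (auto simp: \<omega>_def)
  qed (use m(1) in auto)
  moreover have "A\<^sup>2 = B\<^sup>2" using a(3) b(3) by (simp add: A_def B_def)
  then have "A = 1 * B \<or> A = -1 * B" by (simp add: power2_eq_iff)
  then obtain s where "s \<in> {-1, 1}" "A = s * B" by blast
  moreover have "\<exists>s'\<in>{-1, 1}. of_real (dist (g VI) (g VT)) = s' * (- \<i>) * of_real \<rho> * (A - inverse A)"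
  proof -
    have I: "cmod (g VI - m) = \<rho>" and T: "cmod (g VT - m) = \<rho>"
      using on[of ChA 0] on[of ChA "n ChA"] pos[of ChA]
      by (simp_all add: dist_norm norm_minus_commute)
    then have nz: "g VI - m \<noteq> 0" using m(1) by auto
    have A2: "A\<^sup>2 = (g VT - m) / (g VI - m)" using a(3) by (simp add: A_def)
    have "cmod (A\<^sup>2) = 1" unfolding A2 using I T m(1) by (simp add: norm_divide)
    from chord_half_angle[OF this] obtain w where w: "w\<^sup>2 = A\<^sup>2"
      "of_real (cmod (A\<^sup>2 - 1)) = - \<i> * (w - inverse w)" by blast
    have "g VT - g VI = (g VI - m) * (A\<^sup>2 - 1)" unfolding A2 using nz by (simp add: field_simps)
    then have "dist (g VI) (g VT) = \<rho> * cmod (A\<^sup>2 - 1)"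
      using I by (metis dist_norm norm_minus_commute norm_mult)
    then have "of_real (dist (g VI) (g VT)) = - \<i> * of_real \<rho> * (w - inverse w)"
      using w(2) by simp
    moreover have "w = A \<or> w = - A" using w(1) by (simp add: power2_eq_iff)
    ultimately show ?thesis by auto
  qed
  then obtain s' where "s' \<in> {-1, 1}" "of_real (dist (g VI) (g VT)) = s' * (- \<i>) * of_real \<rho> * (A - inverse A)"
    by blast
  ultimately show ?thesis using that[of "of_real \<rho>" \<omega> s s'] by (simp add: prods)
qed

lemma prod_inverse_ident:
  fixes w :: "nat \<Rightarrow> complex"
  shows "inverse (\<Prod>i\<in>I. w i) = (\<Prod>i\<in>I. inverse (w i))"
  by (simp add: prod_inversef[unfolded comp_def])

lemma prod_lessThan_split: "(m::nat) \<ge> 1 \<Longrightarrow> (\<Prod>i<m. f i) = f 0 * (\<Prod>i\<in>{1..<m}. f i)"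
  by (simp add: prod.atLeast_Suc_lessThan lessThan_atLeast0)

text \<open>A coincidence that determines the length of one edge \<open>e\<close> and one half angle (whose place
  is taken by the radius) in terms of the other parameters leaves fewer parameters than edges.\<close>

definition parameters ::
  "(chain \<times> nat \<Rightarrow> real) \<Rightarrow> complex \<Rightarrow> (chain \<times> nat \<Rightarrow> complex) \<Rightarrow> chain \<times> nat \<Rightarrow> complex" where
  "parameters len \<rho> \<omega> e =
    (if e = (ChB, 0) then \<rho> else if fst e = ChZ then of_real (len e) else \<omega> e)"

text \<open>The parameters are indexed by the edges other than \<open>e\<close>, one fewer than the
  lengths, and each length becomes a Laurent polynomial in them. The eliminated half angle enters
  the length of \<open>(ChB, 0)\<close> together with its inverse; \<open>X'\<close> is given
  separately because the inverse of a Laurent polynomial need not be one.\<close>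

lemma coincidence_dependent:
  assumes pos: "\<And>\<kappa>. n \<kappa> \<ge> 1" and e: "e \<in> edge_indices n" "e \<noteq> (ChB, 0)"
    and F: "laurent_fun (edge_indices n - {e}) F"
    and X: "laurent_fun (edge_indices n - {e}) X" "laurent_fun (edge_indices n - {e}) X'"
  shows "\<exists>P a. polynomial_fun (edge_indices n) P \<and> P a \<noteq> (0::real) \<and>
    (\<forall>len \<in> positive_vectors (edge_indices n). \<forall>\<rho> \<omega>. half_angles n len \<rho> \<omega> \<and>
      of_real (len e) = F (parameters len \<rho> \<omega>) \<and> \<omega> (ChB, 0) = X (parameters len \<rho> \<omega>) \<and>
      inverse (\<omega> (ChB, 0)) = X' (parameters len \<rho> \<omega>) \<longrightarrow> P len = 0)"
proof -
  let ?E = "edge_indices n"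
  define J where "J = ?E - {e}"
  have B0: "(ChB, 0) \<in> J" using pos[of ChB] e(2) by (simp add: J_def edge_indices_def)
  define f where "f e' y = (if e' = e then F y else if fst e' = ChZ then y e'
    else if e' = (ChB, 0) then - \<i> * y (ChB, 0) * (X y - X' y)
    else - \<i> * y (ChB, 0) * (y e' - inverse (y e')))" for e' and y :: "chain \<times> nat \<Rightarrow> complex"
  have "laurent_fun J (f e')" if "e' \<in> ?E" for e'
  proof -
    have "e' = e \<or> e' \<in> J" using that by (auto simp: J_def)
    then show ?thesis
      unfolding f_def using B0 F[folded J_def] X[folded J_def]
      by (cases "e' = e"; cases "fst e' = ChZ"; cases "e' = (ChB, 0)"; simp)
         (auto intro!: laurent_fun_intros)
  qed
  moreover have "card J < card ?E"
    unfolding J_def by (rule card_Diff1_less[OF finite_edge_indices e(1)])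
  moreover have "finite J" by (simp add: J_def)
  ultimately have "\<exists>P a. polynomial_fun ?E P \<and> P a \<noteq> (0::real) \<and>
      (\<forall>y x. (\<forall>j\<in>J. y j \<noteq> 0) \<and> (\<forall>e\<in>?E. of_real (x e) = f e y) \<longrightarrow> P x = 0)"
    by (intro laurent_fun_dependence) simp_all
  then obtain P a where P: "polynomial_fun ?E P" "P a \<noteq> (0::real)"
    "\<And>y x. (\<forall>j\<in>J. y j \<noteq> 0) \<Longrightarrow> (\<forall>e\<in>?E. of_real (x e) = f e y) \<Longrightarrow> P x = 0"
    by blast
  have "P len = 0"
    if "len \<in> positive_vectors ?E" and h: "half_angles n len \<rho> \<omega>"
      and "of_real (len e) = F (parameters len \<rho> \<omega>)" "\<omega> (ChB, 0) = X (parameters len \<rho> \<omega>)"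
        "inverse (\<omega> (ChB, 0)) = X' (parameters len \<rho> \<omega>)" for len \<rho> \<omega>
  proof (rule P(3))
    show "\<forall>j\<in>J. parameters len \<rho> \<omega> j \<noteq> 0"
      using h that(1) by (auto simp: parameters_def half_angles_def J_def positive_vectors_def PiE_iff)
    show "\<forall>e\<in>?E. of_real (len e) = f e (parameters len \<rho> \<omega>)"
    proof
      fix e' assume e': "e' \<in> ?E"
      show "of_real (len e') = f e' (parameters len \<rho> \<omega>)"
      proof (cases "e' = e \<or> e' = (ChB, 0)")
        case True
        have "parameters len \<rho> \<omega> (ChB, 0) = \<rho>" by (simp add: parameters_def)
        with True that(3) e(2) e' h show ?thesis
          by (auto simp: f_def half_angles_def simp flip: that(4,5))
      next
        case False
        then show ?thesis using h e' by (cases "fst e' = ChZ") (auto simp: f_def parameters_def half_angles_def)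
      qed
    qed
  qed
  with P(1,2) show ?thesis by blast
qed

text \<open>The algebraic trace of the coincidence that |IT| is a signed sum of lengths of Z. The
  signs \<open>s\<close> and \<open>s'\<close> are fixed so that each combination gets its own
  polynomial.\<close>

definition resonant ::
  "(chain \<Rightarrow> nat) \<Rightarrow> (nat \<Rightarrow> real) \<Rightarrow> complex \<Rightarrow> complex \<Rightarrow> (chain \<times> nat \<Rightarrow> real) \<Rightarrow> bool" where
  "resonant n \<epsilon> s s' len \<longleftrightarrow> (\<exists>\<rho> \<omega>. half_angles n len \<rho> \<omega> \<and>
    (\<Prod>i<n ChA. \<omega> (ChA, i)) = s * (\<Prod>i<n ChB. \<omega> (ChB, i)) \<and>
    of_real (\<Sum>j<n ChZ. \<epsilon> j * len (ChZ, j)) =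
      s' * (- \<i>) * \<rho> * ((\<Prod>i<n ChA. \<omega> (ChA, i)) - inverse (\<Prod>i<n ChA. \<omega> (ChA, i))))"

text \<open>With signs \<open>s\<close> and \<open>s'\<close> this is the trace of
  \<open>I = T\<close>. Such a coincidence does not determine a length of Z, but A and B each close
  up on the circle, which gives two relations and eliminates one half angle in each chain.\<close>

definition closed_cyclic ::
  "(chain \<Rightarrow> nat) \<Rightarrow> complex \<Rightarrow> complex \<Rightarrow> (chain \<times> nat \<Rightarrow> real) \<Rightarrow> bool" where
  "closed_cyclic n s s' len \<longleftrightarrow> (\<exists>\<rho> \<omega>. half_angles n len \<rho> \<omega> \<and>
    (\<Prod>i<n ChA. \<omega> (ChA, i)) = s \<and> (\<Prod>i<n ChB. \<omega> (ChB, i)) = s')"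

lemma half_angle_nonzero: "half_angles n len \<rho> \<omega> \<Longrightarrow> i < n \<kappa> \<Longrightarrow> \<kappa> \<noteq> ChZ \<Longrightarrow> \<omega> (\<kappa>, i) \<noteq> 0"
  by (auto simp: half_angles_def edge_indices_def)

lemma half_angle_0:
  assumes "half_angles n len \<rho> \<omega>" "n \<kappa> \<ge> 1" "\<kappa> \<noteq> ChZ" "(\<Prod>i<n \<kappa>. \<omega> (\<kappa>, i)) = s"
  shows "\<omega> (\<kappa>, 0) = s * (\<Prod>i\<in>{1..<n \<kappa>}. inverse (\<omega> (\<kappa>, i)))"
    and "inverse (\<omega> (\<kappa>, 0)) = inverse s * (\<Prod>i\<in>{1..<n \<kappa>}. \<omega> (\<kappa>, i))"
proof -
  have nz: "(\<Prod>i\<in>{1..<n \<kappa>}. \<omega> (\<kappa>, i)) \<noteq> 0"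
    using half_angle_nonzero[OF assms(1)] assms(3) by auto
  show *: "\<omega> (\<kappa>, 0) = s * (\<Prod>i\<in>{1..<n \<kappa>}. inverse (\<omega> (\<kappa>, i)))"
    unfolding assms(4)[symmetric] prod_lessThan_split[of "n \<kappa>", OF assms(2)] prod_inverse_ident[symmetric]
    using nz by simp
  show "inverse (\<omega> (\<kappa>, 0)) = inverse s * (\<Prod>i\<in>{1..<n \<kappa>}. \<omega> (\<kappa>, i))"
    unfolding * inverse_mult_distrib prod_inverse_ident by simp
qed

lemma parameters_simps:
  "parameters len \<rho> \<omega> (ChA, i) = \<omega> (ChA, i)" "parameters len \<rho> \<omega> (ChB, 0) = \<rho>"
  "parameters len \<rho> \<omega> (ChZ, i) = of_real (len (ChZ, i))"
  by (simp_all add: parameters_def)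

lemma prod_parameters:
  assumes "\<kappa> \<noteq> ChZ"
  shows "(\<Prod>i\<in>{1..<n \<kappa>}. f (parameters len \<rho> \<omega> (\<kappa>, i))) = (\<Prod>i\<in>{1..<n \<kappa>}. f (\<omega> (\<kappa>, i)))"
  using assms by (auto intro!: prod.cong simp: parameters_def)

text \<open>The resonance is solved for the length of the edge \<open>j\<close> of Z, which is
  possible since \<open>\<epsilon> j\<close> is its own inverse; the equality of the products up to
  sign is solved for the first half angle of B.\<close>

lemma resonant_dependent:
  assumes pos: "\<And>\<kappa>. n \<kappa> \<ge> 1" and j: "j < n ChZ" "\<epsilon> j \<in> {-1, 1}" and s: "s \<in> {-1, 1}"
  shows "\<exists>P a. polynomial_fun (edge_indices n) P \<and> P a \<noteq> (0::real) \<and>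
    (\<forall>len \<in> positive_vectors (edge_indices n). resonant n \<epsilon> s s' len \<longrightarrow> P len = 0)"
proof -
  define F where "F y = of_real (\<epsilon> j) *
     (s' * (- \<i>) * y (ChB, 0) * ((\<Prod>i<n ChA. y (ChA, i)) - (\<Prod>i<n ChA. inverse (y (ChA, i)))) -
       (\<Sum>i\<in>{..<n ChZ} - {j}. of_real (\<epsilon> i) * y (ChZ, i)))" for y :: "chain \<times> nat \<Rightarrow> complex"
  define X where "X y = s * (\<Prod>i<n ChA. y (ChA, i)) * (\<Prod>i\<in>{1..<n ChB}. inverse (y (ChB, i)))"
    for y :: "chain \<times> nat \<Rightarrow> complex"
  define X' where "X' y = s * (\<Prod>i<n ChA. inverse (y (ChA, i))) * (\<Prod>i\<in>{1..<n ChB}. y (ChB, i))"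
    for y :: "chain \<times> nat \<Rightarrow> complex"
  let ?J = "edge_indices n - {(ChZ, j)}"
  have Zj: "(ChZ, j) \<in> edge_indices n" and B0: "(ChB, 0) \<in> ?J"
    using j pos[of ChB] by (auto simp: edge_indices_def)
  have L: "laurent_fun ?J F" "laurent_fun ?J X" "laurent_fun ?J X'"
    unfolding F_def X_def X'_def by (intro laurent_fun_intros B0; simp add: edge_indices_def)+
  have "of_real (len (ChZ, j)) = F (parameters len \<rho> \<omega>) \<and> \<omega> (ChB, 0) = X (parameters len \<rho> \<omega>) \<and>
      inverse (\<omega> (ChB, 0)) = X' (parameters len \<rho> \<omega>)"
    if h: "half_angles n len \<rho> \<omega>"
      and AB: "(\<Prod>i<n ChA. \<omega> (ChA, i)) = s * (\<Prod>i<n ChB. \<omega> (ChB, i))"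
      and Z: "of_real (\<Sum>j<n ChZ. \<epsilon> j * len (ChZ, j)) =
        s' * (- \<i>) * \<rho> * ((\<Prod>i<n ChA. \<omega> (ChA, i)) - inverse (\<Prod>i<n ChA. \<omega> (ChA, i)))" for len \<rho> \<omega>
  proof (intro conjI)
    have ss: "s * s = 1" "inverse s = s" using s by auto
    then have "(\<Prod>i<n ChB. \<omega> (ChB, i)) = s * (\<Prod>i<n ChA. \<omega> (ChA, i))"
      unfolding AB by (simp add: mult.assoc[symmetric])
    note B = half_angle_0[of n, OF h pos _ this]
    show "\<omega> (ChB, 0) = X (parameters len \<rho> \<omega>)"
      unfolding X_def parameters_simps by (subst prod_parameters) (use B(1) in simp_all)
    show "inverse (\<omega> (ChB, 0)) = X' (parameters len \<rho> \<omega>)"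
      unfolding X'_def parameters_simps
      by (subst prod_parameters[where f = "\<lambda>x. x"]) (use B(2) in \<open>simp_all add: ss(2) prod_inverse_ident\<close>)
    have "(\<Sum>j<n ChZ. \<epsilon> j * len (ChZ, j)) = \<epsilon> j * len (ChZ, j) + (\<Sum>i\<in>{..<n ChZ} - {j}. \<epsilon> i * len (ChZ, i))"
      using j(1) by (subst sum.remove[of _ j]) auto
    moreover have "\<epsilon> j * \<epsilon> j = 1" using j(2) by auto
    ultimately have "len (ChZ, j) = \<epsilon> j * ((\<Sum>j<n ChZ. \<epsilon> j * len (ChZ, j)) - (\<Sum>i\<in>{..<n ChZ} - {j}. \<epsilon> i * len (ChZ, i)))"
      by (simp add: mult.assoc[symmetric])
    then have "of_real (len (ChZ, j)) = of_real (\<epsilon> j) * (of_real (\<Sum>j<n ChZ. \<epsilon> j * len (ChZ, j)) -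
        (\<Sum>i\<in>{..<n ChZ} - {j}. of_real (\<epsilon> i) * of_real (len (ChZ, i)) :: complex))"
      by (metis (mono_tags, lifting) of_real_diff of_real_mult of_real_sum sum.cong)
    then show "of_real (len (ChZ, j)) = F (parameters len \<rho> \<omega>)"
      unfolding Z by (simp add: F_def parameters_simps prod_inverse_ident)
  qed
  then show ?thesis
    using coincidence_dependent[of n "(ChZ, j)", OF pos Zj _ L] unfolding resonant_def by blast
qed

text \<open>Both closing conditions are solved for the first half angle of their chain. That of B is
  the eliminated half angle, while that of A is used to express the length of
  \<open>(ChA, 0)\<close>.\<close>

lemma closed_cyclic_dependent:
  assumes pos: "\<And>\<kappa>. n \<kappa> \<ge> 1" and s: "s \<in> {-1, 1}" "s' \<in> {-1, 1}"
  shows "\<exists>P a. polynomial_fun (edge_indices n) P \<and> P a \<noteq> (0::real) \<and>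
    (\<forall>len \<in> positive_vectors (edge_indices n). closed_cyclic n s s' len \<longrightarrow> P len = 0)"
proof -
  define X where "X \<kappa> \<sigma> y = \<sigma> * (\<Prod>i\<in>{1..<n \<kappa>}. inverse (y (\<kappa>, i)))"
    for \<kappa> \<sigma> and y :: "chain \<times> nat \<Rightarrow> complex"
  define X' where "X' \<kappa> \<sigma> y = \<sigma> * (\<Prod>i\<in>{1..<n \<kappa>}. y (\<kappa>, i))"
    for \<kappa> \<sigma> and y :: "chain \<times> nat \<Rightarrow> complex"
  let ?J = "edge_indices n - {(ChA, 0)}"
  let ?F = "\<lambda>y. - \<i> * y (ChB, 0) * (X ChA s y - X' ChA s y)"
  have A0: "(ChA, 0) \<in> edge_indices n" and B0: "(ChB, 0) \<in> ?J"
    using pos[of ChA] pos[of ChB] by (simp_all add: edge_indices_def)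
  have mem: "i \<in> {1..<n \<kappa>} \<Longrightarrow> (\<kappa>, i) \<in> ?J" for \<kappa> i by (auto simp: edge_indices_def)
  have L: "laurent_fun ?J ?F" "laurent_fun ?J (X ChB s')" "laurent_fun ?J (X' ChB s')"
    unfolding X_def X'_def by (intro laurent_fun_intros B0 mem; assumption)+
  have X: "\<omega> (\<kappa>, 0) = X \<kappa> \<sigma> (parameters len \<rho> \<omega>)" "inverse (\<omega> (\<kappa>, 0)) = X' \<kappa> \<sigma> (parameters len \<rho> \<omega>)"
    if "half_angles n len \<rho> \<omega>" "\<kappa> \<noteq> ChZ" "\<sigma> \<in> {-1, 1}" "(\<Prod>i<n \<kappa>. \<omega> (\<kappa>, i)) = \<sigma>" for len \<rho> \<omega> \<kappa> \<sigma>
  proof -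
    note \<omega> = half_angle_0[of n, OF that(1) pos that(2,4)]
    have "inverse \<sigma> = \<sigma>" using that(3) by auto
    then show "\<omega> (\<kappa>, 0) = X \<kappa> \<sigma> (parameters len \<rho> \<omega>)" "inverse (\<omega> (\<kappa>, 0)) = X' \<kappa> \<sigma> (parameters len \<rho> \<omega>)"
      unfolding X_def X'_def prod_parameters[OF that(2)] prod_parameters[OF that(2), of "\<lambda>x. x"]
      using \<omega> by simp_all
  qed
  have "of_real (len (ChA, 0)) = ?F (parameters len \<rho> \<omega>) \<and> \<omega> (ChB, 0) = X ChB s' (parameters len \<rho> \<omega>) \<and>
      inverse (\<omega> (ChB, 0)) = X' ChB s' (parameters len \<rho> \<omega>)"
    if h: "half_angles n len \<rho> \<omega>" "(\<Prod>i<n ChA. \<omega> (ChA, i)) = s" "(\<Prod>i<n ChB. \<omega> (ChB, i)) = s'" for len \<rho> \<omega>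
    using X[OF h(1) _ s(1) h(2), symmetric] X[OF h(1) _ s(2) h(3)] h(1) A0
    by (simp add: half_angles_def parameters_simps)
  then show ?thesis
    using coincidence_dependent[of n "(ChA, 0)", OF pos A0 _ L] unfolding closed_cyclic_def by blast
qed

lemma ex_generic_lengths:
  assumes pos: "\<And>\<kappa>. n \<kappa> \<ge> 1"
  shows "\<exists>G. generic_set (edge_indices n) G \<and> (\<forall>len\<in>G. generic_lengths n len)"
proof -
  let ?E = "edge_indices n"
  have fin: "finite ({-1, 0, 1} :: real set)" by simp
  define S1 where "S1 = {\<epsilon> \<in> ?E \<rightarrow>\<^sub>E {-1, 0, 1::real}. \<exists>e\<in>?E. \<epsilon> e \<noteq> 0}"
  have "finite S1" unfolding S1_def by (rule finite_subset[OF Collect_restrict finite_PiE[OF finite_edge_indices fin]])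
  have "\<exists>G. generic_set ?E G \<and> (\<forall>len\<in>G. \<forall>\<epsilon>\<in>S1. \<not> (\<Sum>e\<in>?E. \<epsilon> e * len e) = 0)"
  proof (rule generic_set_INT[OF finite_edge_indices \<open>finite S1\<close>])
    fix \<epsilon> assume "\<epsilon> \<in> S1"
    then obtain e where e: "e \<in> ?E" "\<epsilon> e \<noteq> 0" by (auto simp: S1_def)
    \<comment> \<open>The witness for a non-zero linear form is its own coefficient vector.\<close>
    then have "(\<Sum>e\<in>?E. \<epsilon> e * \<epsilon> e) \<noteq> 0"
      using sum_nonneg_eq_0_iff[of ?E "\<lambda>e. \<epsilon> e * \<epsilon> e"] by auto
    moreover have "polynomial_fun ?E (\<lambda>x. \<Sum>e\<in>?E. \<epsilon> e * x e)"
      by (intro polynomial_fun_intros)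
    ultimately show "\<exists>f a. polynomial_fun ?E f \<and> f a \<noteq> 0 \<and>
        (\<forall>x\<in>positive_vectors ?E. (\<Sum>e\<in>?E. \<epsilon> e * x e) = 0 \<longrightarrow> f x = 0)"
      by (intro exI[of _ "\<lambda>x. \<Sum>e\<in>?E. \<epsilon> e * x e"] exI[of _ \<epsilon>]) auto
  qed
  then obtain G1 where G1: "generic_set ?E G1" "\<And>len \<epsilon>. len \<in> G1 \<Longrightarrow> \<epsilon> \<in> S1 \<Longrightarrow> (\<Sum>e\<in>?E. \<epsilon> e * len e) \<noteq> 0"
    by blast
  define S2 where "S2 = {\<epsilon> \<in> {..<n ChZ} \<rightarrow>\<^sub>E {-1, 0, 1::real}. \<exists>j<n ChZ. \<epsilon> j \<noteq> 0} \<times> {-1, 1::complex} \<times> {-1, 1::complex}"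
  define B2 where "B2 = (\<lambda>(\<epsilon>, s, s'). resonant n \<epsilon> s s')"
  have "finite {\<epsilon> \<in> {..<n ChZ} \<rightarrow>\<^sub>E {-1, 0, 1::real}. \<exists>j<n ChZ. \<epsilon> j \<noteq> 0}"
    by (rule finite_subset[OF Collect_restrict finite_PiE[OF finite_lessThan fin]])
  then have "finite S2" unfolding S2_def by auto
  have "\<exists>G. generic_set ?E G \<and> (\<forall>len\<in>G. \<forall>t\<in>S2. \<not> B2 t len)"
  proof (rule generic_set_INT[OF finite_edge_indices \<open>finite S2\<close>])
    fix t assume "t \<in> S2"
    then obtain \<epsilon> s s' j where t: "t = (\<epsilon>, s, s')" "s \<in> {-1, 1}" "s' \<in> {-1, 1}" "j < n ChZ" "\<epsilon> j \<in> {-1, 1}"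
      unfolding S2_def by (cases t) (force simp: PiE_iff)
    show "\<exists>f a. polynomial_fun ?E f \<and> f a \<noteq> 0 \<and> (\<forall>x\<in>positive_vectors ?E. B2 t x \<longrightarrow> f x = 0)"
      unfolding t(1) B2_def prod.case
      by (rule resonant_dependent) (use pos t in auto)
  qed
  then obtain G2 where G2: "generic_set ?E G2" "\<And>len t. len \<in> G2 \<Longrightarrow> t \<in> S2 \<Longrightarrow> \<not> B2 t len"
    by blast
  define S3 where "S3 = {-1, 1::complex} \<times> {-1, 1::complex}"
  define B3 where "B3 = (\<lambda>(s, s'). closed_cyclic n s s')"
  have "\<exists>G. generic_set ?E G \<and> (\<forall>len\<in>G. \<forall>t\<in>S3. \<not> B3 t len)"
  proof (rule generic_set_INT[OF finite_edge_indices])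
    show "finite S3" unfolding S3_def by auto
    fix t assume "t \<in> S3"
    then obtain s s' where t: "t = (s, s')" "s \<in> {-1, 1}" "s' \<in> {-1, 1}"
      unfolding S3_def by blast
    show "\<exists>f a. polynomial_fun ?E f \<and> f a \<noteq> 0 \<and> (\<forall>x\<in>positive_vectors ?E. B3 t x \<longrightarrow> f x = 0)"
      unfolding t(1) B3_def prod.case
      by (rule closed_cyclic_dependent) (use pos t in auto)
  qed
  then obtain G3 where G3: "generic_set ?E G3" "\<And>len t. len \<in> G3 \<Longrightarrow> t \<in> S3 \<Longrightarrow> \<not> B3 t len"
    by blast
  define G where "G = G1 \<inter> (G2 \<inter> G3)"
  have G: "generic_set ?E G" unfolding G_def by (intro generic_set_Int G1 G2 G3)
  moreover have "generic_lengths n len" if len: "len \<in> G" for len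
    unfolding generic_lengths_def
  proof (intro conjI ballI impI)
    show "len \<in> positive_vectors ?E" using G len unfolding generic_set_def by blast
    show "(\<Sum>e\<in>?E. \<epsilon> e * len e) \<noteq> 0" if "\<epsilon> \<in> ?E \<rightarrow>\<^sub>E {-1, 0, 1}" "\<exists>e\<in>?E. \<epsilon> e \<noteq> 0" for \<epsilon>
      using that len by (intro G1) (auto simp: G_def S1_def)
    fix g \<epsilon>
    assume g: "g \<in> configs (two_chain_cycle n len ChA ChB)" "cyclic (two_chain_cycle n len ChA ChB) g"
      and eps: "\<epsilon> \<in> {..<n ChZ} \<rightarrow>\<^sub>E {-1, 0, 1::real}"
    show "dist (g VI) (g VT) \<noteq> \<bar>\<Sum>j<n ChZ. \<epsilon> j * len (ChZ, j)\<bar>"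
    proof
      assume eq: "dist (g VI) (g VT) = \<bar>\<Sum>j<n ChZ. \<epsilon> j * len (ChZ, j)\<bar>"
      define z where "z = (\<Sum>j<n ChZ. \<epsilon> j * len (ChZ, j))"
      obtain \<rho> \<omega> s s' where h: "half_angles n len \<rho> \<omega>" "s \<in> {-1, 1}" "s' \<in> {-1, 1}"
        "(\<Prod>i<n ChA. \<omega> (ChA, i)) = s * (\<Prod>i<n ChB. \<omega> (ChB, i))"
        "of_real (dist (g VI) (g VT)) =
           s' * (- \<i>) * \<rho> * ((\<Prod>i<n ChA. \<omega> (ChA, i)) - inverse (\<Prod>i<n ChA. \<omega> (ChA, i)))"
        by (rule cyclic_half_angles[of n, OF pos g])
      show False
      proof (cases "\<exists>j<n ChZ. \<epsilon> j \<noteq> 0")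
        case True
        \<comment> \<open>The sign removes the absolute value around the signed sum and is absorbed
          into \<open>s'\<close>.\<close>
        define \<delta> :: complex where "\<delta> = (if z \<ge> 0 then 1 else -1)"
        have "of_real z = \<delta> * of_real (dist (g VI) (g VT))" by (simp add: eq z_def[symmetric] \<delta>_def)
        also have "\<dots> = (\<delta> * s') * (- \<i>) * \<rho> * ((\<Prod>i<n ChA. \<omega> (ChA, i)) - inverse (\<Prod>i<n ChA. \<omega> (ChA, i)))"
          unfolding h(5) by (simp only: mult.assoc)
        finally have "B2 (\<epsilon>, s, \<delta> * s') len"
          using h(1,4) unfolding B2_def z_def prod.case resonant_def by (intro exI conjI) assumption+
        moreover have "\<delta> * s' \<in> {-1, 1}" using h(3) by (auto simp: \<delta>_def)
        then have "(\<epsilon>, s, \<delta> * s') \<in> S2" using h(2) True eps unfolding S2_def by blast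
        ultimately show False using G2(2) len by (auto simp: G_def)
      next
        case False
        \<comment> \<open>Without a non-zero coefficient the coincidence reads |IT| = 0. Then
          \<open>A\<close> equals its inverse, so the products over A and B are both 1 or
          -1.\<close>
        define A where "A = (\<Prod>i<n ChA. \<omega> (ChA, i))"
        have "z = 0" using False by (simp add: z_def)
        then have "A - inverse A = 0"
          using h(3,5) h(1) by (auto simp: eq z_def[symmetric] A_def half_angles_def)
        moreover have "A \<noteq> 0" using h(1) by (auto simp: A_def half_angles_def edge_indices_def)
        ultimately have "A * A = 1" by (metis eq_iff_diff_eq_0 right_inverse)
        then have "A = 1 \<or> A = -1" by (simp add: square_eq_1_iff)
        moreover have "(\<Prod>i<n ChB. \<omega> (ChB, i)) = s * A" using h(2,4) by (auto simp: A_def)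
        ultimately have "B3 (A, s * A) len" "(A, s * A) \<in> S3"
          using h(1,2) by (auto simp: B3_def closed_cyclic_def S3_def A_def)
        then show False using G3(2) len by (auto simp: G_def)
      qed
    qed
  qed
  ultimately show ?thesis by blast
qed

section \<open>Equilibrium stresses and regularity\<close>

lemma chain_vertex_eq_iff:
  "i \<le> n \<kappa> \<Longrightarrow> j \<le> n \<kappa> \<Longrightarrow> n \<kappa> \<ge> 1 \<Longrightarrow> chain_vertex n \<kappa> i = chain_vertex n \<kappa> j \<longleftrightarrow> i = j"
  by (auto simp: chain_vertex_def)

lemma sum_edge_indices_chain: "(\<Sum>e\<in>edge_indices n. f e) = (\<Sum>\<kappa>\<in>UNIV. \<Sum>i<n \<kappa>. f (\<kappa>, i))"
  by (simp add: sum_edge_indices UNIV_chain add_ac)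

lemma generic_lengths_pos: "generic_lengths n len \<Longrightarrow> i < n \<kappa> \<Longrightarrow> len (\<kappa>, i) > 0"
  by (auto simp: generic_lengths_def positive_vectors_def edge_indices_def PiE_iff)

lemma generic_signed_sum_nonzero:
  assumes "generic_lengths n len" "\<And>e. e \<in> edge_indices n \<Longrightarrow> \<epsilon> e \<in> {-1, 0, 1}"
    "e \<in> edge_indices n" "\<epsilon> e \<noteq> 0"
  shows "(\<Sum>e\<in>edge_indices n. \<epsilon> e * len e) \<noteq> 0"
proof -
  have "(\<Sum>e\<in>edge_indices n. restrict \<epsilon> (edge_indices n) e * len e) \<noteq> 0"
  proof -
    have "restrict \<epsilon> (edge_indices n) \<in> edge_indices n \<rightarrow>\<^sub>E {-1, 0, 1}" using assms(2) by auto
    moreover have "\<exists>e\<in>edge_indices n. restrict \<epsilon> (edge_indices n) e \<noteq> 0" using assms(3,4) by auto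
    ultimately show ?thesis using assms(1) unfolding generic_lengths_def by blast
  qed
  then show ?thesis by simp
qed

section \<open>Degenerate positions excluded by generic lengths\<close>

context
  fixes n :: "chain \<Rightarrow> nat" and len :: "chain \<times> nat \<Rightarrow> real"
  assumes pos: "n \<kappa> \<ge> 1" and gen: "generic_lengths n len"
begin

text \<open>Two straight chains express the same distance |IT| as absolute values of signed sums. Up
  to one relative sign these sums cancel, which is a forbidden relation with coefficient 0 on the
  third chain.\<close>

lemma not_two_straight:
  assumes "\<kappa> \<noteq> \<kappa>'" "straight n x \<kappa>" "straight n x \<kappa>'"
    and "\<And>i. i < n \<kappa> \<Longrightarrow> cmod (edge_vec n x (\<kappa>, i)) = len (\<kappa>, i)"
    and "\<And>i. i < n \<kappa>' \<Longrightarrow> cmod (edge_vec n x (\<kappa>', i)) = len (\<kappa>', i)"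
  shows False
proof -
  obtain \<epsilon> where e: "\<And>i. \<epsilon> i \<in> {-1, 1}" "cmod (x VT - x VI) = \<bar>\<Sum>i<n \<kappa>. \<epsilon> i * len (\<kappa>, i)\<bar>"
    using straight_signed_sum[of n x \<kappa> len] assms pos by blast
  obtain \<epsilon>' where e': "\<And>i. \<epsilon>' i \<in> {-1, 1}" "cmod (x VT - x VI) = \<bar>\<Sum>i<n \<kappa>'. \<epsilon>' i * len (\<kappa>', i)\<bar>"
    using straight_signed_sum[of n x \<kappa>' len] assms pos by blast
  define a b where "a = (\<Sum>i<n \<kappa>. \<epsilon> i * len (\<kappa>, i))" and "b = (\<Sum>i<n \<kappa>'. \<epsilon>' i * len (\<kappa>', i))"
  have "a + (-1) * b = 0 \<or> a + 1 * b = 0"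
    using e(2) e'(2) unfolding a_def[symmetric] b_def[symmetric] by linarith
  then obtain \<sigma> where s: "\<sigma> \<in> {-1, 1}" "a + \<sigma> * b = 0" by blast
  define \<delta> where "\<delta> e = (if fst e = \<kappa> then \<epsilon> (snd e) else if fst e = \<kappa>' then \<sigma> * \<epsilon>' (snd e) else 0)" for e
  have "(\<Sum>e\<in>edge_indices n. \<delta> e * len e) =
      (\<Sum>\<mu>\<in>UNIV. if \<mu> = \<kappa> then a else if \<mu> = \<kappa>' then \<sigma> * b else 0)"
    unfolding sum_edge_indices_chain a_def b_def
    by (intro sum.cong) (auto simp: \<delta>_def sum_distrib_left mult.assoc)
  also have "\<dots> = 0"
    using s(2) assms(1) by (cases \<kappa>; cases \<kappa>'; simp add: UNIV_chain)
  finally have "(\<Sum>e\<in>edge_indices n. \<delta> e * len e) = 0" .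
  moreover have "\<delta> e \<in> {-1, 0, 1}" for e
    using e(1)[of "snd e"] e'(1)[of "snd e"] s(1) by (auto simp: \<delta>_def)
  moreover have "(\<kappa>, 0) \<in> edge_indices n" using pos[of \<kappa>] by (simp add: edge_indices_def)
  moreover have "\<delta> (\<kappa>, 0) \<noteq> 0" using e(1)[of 0] by (auto simp: \<delta>_def)
  ultimately show False using generic_signed_sum_nonzero[OF gen, of \<delta>] by blast
qed

lemma straight_ends_distinct:
  assumes "straight n x \<kappa>" "\<And>i. i < n \<kappa> \<Longrightarrow> cmod (edge_vec n x (\<kappa>, i)) = len (\<kappa>, i)"
  shows "x VI \<noteq> x VT"
proof
  assume eq: "x VI = x VT"
  obtain \<epsilon> where e: "\<And>i. \<epsilon> i \<in> {-1, 1}" "cmod (x VT - x VI) = \<bar>\<Sum>i<n \<kappa>. \<epsilon> i * len (\<kappa>, i)\<bar>"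
    using straight_signed_sum[of n x \<kappa> len] assms pos by blast
  define \<delta> where "\<delta> e = (if fst e = \<kappa> then \<epsilon> (snd e) else 0)" for e
  have "(\<Sum>e\<in>edge_indices n. \<delta> e * len e) = (\<Sum>\<mu>\<in>UNIV. if \<mu> = \<kappa> then \<Sum>i<n \<kappa>. \<epsilon> i * len (\<kappa>, i) else 0)"
    unfolding sum_edge_indices_chain by (intro sum.cong) (auto simp: \<delta>_def)
  also have "\<dots> = 0" using e(2) eq by (simp add: UNIV_chain)
  finally have "(\<Sum>e\<in>edge_indices n. \<delta> e * len e) = 0" .
  moreover have "\<delta> e \<in> {-1, 0, 1}" for e
    using e(1)[of "snd e"] by (auto simp: \<delta>_def)
  moreover have "(\<kappa>, 0) \<in> edge_indices n" using pos[of \<kappa>] by (simp add: edge_indices_def)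
  moreover have "\<delta> (\<kappa>, 0) \<noteq> 0" using e(1)[of 0] by (auto simp: \<delta>_def)
  ultimately show False using generic_signed_sum_nonzero[OF gen, of \<delta>] by blast
qed

text \<open>Only the distance of I and T in \<open>x\<close> is compared with that in
  \<open>g\<close>, so the lemma serves both configurations of the whole linkage and those of Z with
  a bar.\<close>

lemma cyclic_not_straight:
  assumes g: "g \<in> configs (two_chain_cycle n len ChA ChB)" "cyclic (two_chain_cycle n len ChA ChB) g"
    and "cmod (x VT - x VI) = dist (g VI) (g VT)"
    and "\<And>i. i < n ChZ \<Longrightarrow> cmod (edge_vec n x (ChZ, i)) = len (ChZ, i)"
  shows "\<not> straight n x ChZ"
proof
  assume "straight n x ChZ"
  then obtain \<epsilon> where e: "\<And>i. \<epsilon> i \<in> {-1, 1}" "cmod (x VT - x VI) = \<bar>\<Sum>i<n ChZ. \<epsilon> i * len (ChZ, i)\<bar>"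
    using straight_signed_sum[of n x ChZ len] assms pos by blast
  have "restrict \<epsilon> {..<n ChZ} \<in> {..<n ChZ} \<rightarrow>\<^sub>E {-1, 0, 1}" using e(1) by auto
  then have "dist (g VI) (g VT) \<noteq> \<bar>\<Sum>j<n ChZ. restrict \<epsilon> {..<n ChZ} j * len (ChZ, j)\<bar>"
    using gen g unfolding generic_lengths_def by blast
  then show False using e(2) assms(3) by simp
qed

lemma cyclic_ends_distinct:
  assumes g: "g \<in> configs (two_chain_cycle n len ChA ChB)" "cyclic (two_chain_cycle n len ChA ChB) g"
  shows "g VI \<noteq> g VT"
proof -
  have "(\<lambda>j\<in>{..<n ChZ}. 0) \<in> {..<n ChZ} \<rightarrow>\<^sub>E {-1, 0, 1::real}" by auto
  then have "dist (g VI) (g VT) \<noteq> \<bar>\<Sum>j<n ChZ. (\<lambda>j\<in>{..<n ChZ}. 0) j * len (ChZ, j)\<bar>"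
    using gen g unfolding generic_lengths_def by blast
  then show ?thesis by auto
qed

lemma not_aligned_cycle:
  assumes "\<kappa> \<noteq> \<kappa>'" "x \<in> configs (two_chain_cycle n len \<kappa> \<kappa>')"
  shows "\<not> aligned (two_chain_cycle n len \<kappa> \<kappa>') x"
proof
  assume al: "aligned (two_chain_cycle n len \<kappa> \<kappa>') x"
  have v: "chain_vertex n \<mu> i \<in> verts (two_chain_cycle n len \<kappa> \<kappa>')" if "\<mu> = \<kappa> \<or> \<mu> = \<kappa>'" "i \<le> n \<mu>" for \<mu> i
    using that pos by (auto simp: two_chain_cycle_def verts_Un verts_open_chain)
  have "straight n x \<mu>" if "\<mu> = \<kappa> \<or> \<mu> = \<kappa>'" for \<mu>
    using al[unfolded aligned_def] v that pos by (intro collinear_straight) auto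
  then show False
    using not_two_straight[OF assms(1), of x] configs_two_chain_edge[OF assms(2)] by blast
qed

end

text \<open>Half the gradient of the squared length of \<open>e\<close> with respect to the position
  of \<open>w\<close>, or the force that a unit stress on \<open>e\<close> exerts at
  \<open>w\<close> up to sign. Linear dependence of the length equations therefore means an
  equilibrium of such forces.\<close>

definition stress :: "(chain \<Rightarrow> nat) \<Rightarrow> (vertex \<Rightarrow> complex) \<Rightarrow> vertex \<Rightarrow> chain \<times> nat \<Rightarrow> complex" where
  "stress n x w e = (if w = chain_vertex n (fst e) (Suc (snd e)) then edge_vec n x e
     else if w = chain_vertex n (fst e) (snd e) then - edge_vec n x e else 0)"

lemma partial_sqdist:
  assumes "u \<noteq> v"
  shows "partial w b (\<lambda>x. (cmod (x v - x u))\<^sup>2 - l) x =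
    2 * ((if w = v then x v - x u else if w = u then - (x v - x u) else 0) \<bullet> b)"
proof (rule partialI)
  have e: "(cmod (z + t *\<^sub>R c))\<^sup>2 = (cmod z)\<^sup>2 + 2 * t * (z \<bullet> c) + t\<^sup>2 * (c \<bullet> c)" for z c :: complex and t
    unfolding power2_norm_eq_inner
    by (simp add: inner_add_left inner_add_right inner_commute[of c z] algebra_simps power2_eq_square[of t])
  define c where "c = (if w = v then b else if w = u then - b else 0)"
  have "((x(w := x w + t *\<^sub>R b)) v - (x(w := x w + t *\<^sub>R b)) u) = (x v - x u) + t *\<^sub>R c" for t
    using assms by (auto simp: c_def)
  then have eq: "(\<lambda>t. (cmod ((x(w := x w + t *\<^sub>R b)) v - (x(w := x w + t *\<^sub>R b)) u))\<^sup>2 - l) =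
      (\<lambda>t. (cmod (x v - x u))\<^sup>2 + 2 * t * ((x v - x u) \<bullet> c) + t\<^sup>2 * (c \<bullet> c) - l)"
    by (simp only: e)
  show "((\<lambda>t. (cmod ((x(w := x w + t *\<^sub>R b)) v - (x(w := x w + t *\<^sub>R b)) u))\<^sup>2 - l) has_real_derivative
      2 * ((if w = v then x v - x u else if w = u then - (x v - x u) else 0) \<bullet> b)) (at 0)"
    unfolding eq by (rule derivative_eq_intros refl | simp)+ (auto simp: c_def inner_diff_left)
qed

lemma polynomial_fun_sqdist:
  assumes "u \<in> V" "v \<in> V"
  shows "polynomial_fun V (\<lambda>x. (cmod (x v - x u))\<^sup>2 - l)"
proof -
  have "polynomial_fun V (\<lambda>x. (Re (x v) - Re (x u))\<^sup>2 + (Im (x v) - Im (x u))\<^sup>2 - l)"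
    using assms by (intro polynomial_fun_intros)
  then show ?thesis by (simp add: cmod_power2)
qed

lemma partial_edge_length:
  assumes "i < n \<kappa>"
  shows "partial w b (\<lambda>x. (cmod (edge_vec n x (\<kappa>, i)))\<^sup>2 - l) x = 2 * (stress n x w (\<kappa>, i) \<bullet> b)"
proof -
  have "chain_vertex n \<kappa> i \<noteq> chain_vertex n \<kappa> (Suc i)"
    using assms chain_vertex_eq_iff[of i n \<kappa> "Suc i"] by simp
  then show ?thesis by (simp add: edge_vec_def stress_def partial_sqdist)
qed

lemma sum_stress:
  assumes "n \<kappa> \<ge> 1"
  shows "(\<Sum>i<n \<kappa>. c i *\<^sub>R stress n x w (\<kappa>, i)) =
    (\<Sum>i<n \<kappa>. if w = chain_vertex n \<kappa> (Suc i) then c i *\<^sub>R edge_vec n x (\<kappa>, i) else 0) -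
    (\<Sum>i<n \<kappa>. if w = chain_vertex n \<kappa> i then c i *\<^sub>R edge_vec n x (\<kappa>, i) else 0)"
proof -
  have "chain_vertex n \<kappa> i \<noteq> chain_vertex n \<kappa> (Suc i)" if "i < n \<kappa>" for i
    using that chain_vertex_eq_iff[of i n \<kappa> "Suc i"] assms by simp
  then show ?thesis
    unfolding sum_subtractf[symmetric] by (intro sum.cong) (auto simp: stress_def)
qed

lemma sum_stress_initial:
  assumes "n \<kappa> \<ge> 1"
  shows "(\<Sum>i<n \<kappa>. c i *\<^sub>R stress n x VI (\<kappa>, i)) = - (c 0 *\<^sub>R edge_vec n x (\<kappa>, 0))"
proof -
  have "VI = chain_vertex n \<kappa> i \<longleftrightarrow> i = 0" for i by (auto simp: chain_vertex_def)
  then show ?thesis unfolding sum_stress[of n \<kappa>, OF assms] using assms by (simp add: sum.delta)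
qed

lemma sum_stress_inner:
  assumes "n \<kappa> \<ge> 1" "Suc j < n \<mu>"
  shows "(\<Sum>i<n \<kappa>. c i *\<^sub>R stress n x (chain_vertex n \<mu> (Suc j)) (\<kappa>, i)) =
    (if \<kappa> = \<mu> then c j *\<^sub>R edge_vec n x (\<mu>, j) - c (Suc j) *\<^sub>R edge_vec n x (\<mu>, Suc j) else 0)"
proof -
  have "chain_vertex n \<mu> (Suc j) = chain_vertex n \<kappa> i \<longleftrightarrow> \<kappa> = \<mu> \<and> i = Suc j" if "i \<le> n \<kappa>" for i
    using assms that by (auto simp: chain_vertex_def)
  then have "(\<Sum>i<n \<kappa>. if chain_vertex n \<mu> (Suc j) = chain_vertex n \<kappa> (Suc i) then c i *\<^sub>R edge_vec n x (\<kappa>, i) else 0) =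
      (\<Sum>i<n \<kappa>. if \<kappa> = \<mu> \<and> i = j then c i *\<^sub>R edge_vec n x (\<kappa>, i) else 0)"
    "(\<Sum>i<n \<kappa>. if chain_vertex n \<mu> (Suc j) = chain_vertex n \<kappa> i then c i *\<^sub>R edge_vec n x (\<kappa>, i) else 0) =
      (\<Sum>i<n \<kappa>. if \<kappa> = \<mu> \<and> i = Suc j then c i *\<^sub>R edge_vec n x (\<kappa>, i) else 0)"
    by (auto intro!: sum.cong)
  then show ?thesis unfolding sum_stress[of n \<kappa>, OF assms(1)] using assms(2)
    by (cases "\<kappa> = \<mu>") (simp_all add: sum.delta)
qed

text \<open>The force \<open>c i *\<^sub>R edge_vec n x (\<kappa>, i)\<close> is constant along a chain in equilibrium.\<close>

lemma constant_force_straight: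
  assumes "\<And>i. i < n \<kappa> \<Longrightarrow> c i *\<^sub>R edge_vec n x (\<kappa>, i) = F" "F \<noteq> 0"
  shows "straight n x \<kappa>"
  unfolding straight_def
proof (intro exI[of _ "sgn F"] conjI allI impI)
  fix i assume "i < n \<kappa>"
  from assms(1)[OF this] assms(2) have "edge_vec n x (\<kappa>, i) = (cmod F / c i) *\<^sub>R sgn F"
    by (auto simp: sgn_div_norm field_simps)
  then show "\<exists>s. edge_vec n x (\<kappa>, i) = of_real s * sgn F" by (metis scaleR_conv_of_real)
qed (use assms(2) in \<open>simp add: norm_sgn\<close>)

text \<open>Equilibrium at the inner vertices makes the force constant along each chain, and at I
  the three forces add up to zero. A chain carrying a non-zero force is straight, so at most one of
  the forces is non-zero, and then all of them vanish.\<close>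

lemma three_chain_stress_zero:
  assumes pos: "\<And>\<kappa>. n \<kappa> \<ge> 1" and gen: "generic_lengths n len"
    and x: "\<And>\<kappa> i. i < n \<kappa> \<Longrightarrow> cmod (edge_vec n x (\<kappa>, i)) = len (\<kappa>, i)"
    and eq: "\<And>\<kappa> i. i \<le> n \<kappa> \<Longrightarrow>
      (\<Sum>e\<in>edge_indices n. c e *\<^sub>R stress n x (chain_vertex n \<kappa> i) e) = 0"
    and e: "e \<in> edge_indices n"
  shows "c e = 0"
proof -
  define F where "F \<kappa> = c (\<kappa>, 0) *\<^sub>R edge_vec n x (\<kappa>, 0)" for \<kappa>
  have nz: "edge_vec n x (\<kappa>, i) \<noteq> 0" if "i < n \<kappa>" for \<kappa> i
    using x[OF that] generic_lengths_pos[OF gen that] by auto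
  have F: "c (\<kappa>, i) *\<^sub>R edge_vec n x (\<kappa>, i) = F \<kappa>" if "i < n \<kappa>" for \<kappa> i
    using that
  proof (induction i)
    case (Suc j)
    have "(\<Sum>\<mu>\<in>UNIV. if \<mu> = \<kappa> then c (\<mu>, j) *\<^sub>R edge_vec n x (\<kappa>, j) - c (\<mu>, Suc j) *\<^sub>R edge_vec n x (\<kappa>, Suc j) else 0) = 0"
      using eq[of "Suc j" \<kappa>] Suc.prems
      unfolding sum_edge_indices_chain
      by (simp add: sum_stress_inner[of n _ j \<kappa>, OF pos Suc.prems])
    then show ?case using Suc by (cases \<kappa>) (simp_all add: UNIV_chain)
  qed (simp add: F_def)
  have "(\<Sum>\<mu>\<in>UNIV. F \<mu>) = 0"
    using eq[of 0 ChA] unfolding sum_edge_indices_chain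
    by (simp add: sum_stress_initial[of n, OF pos] F_def sum_negf)
  then have sum: "F ChA + F ChB + F ChZ = 0" by (simp add: UNIV_chain add_ac)
  have str: "straight n x \<kappa>" if "F \<kappa> \<noteq> 0" for \<kappa>
    using constant_force_straight[of n \<kappa> "\<lambda>i. c (\<kappa>, i)" x "F \<kappa>"] F that by blast
  have two: "F \<kappa> = 0 \<or> F \<kappa>' = 0" if "\<kappa> \<noteq> \<kappa>'" for \<kappa> \<kappa>'
    using not_two_straight[OF pos gen that, of x] str x by blast
  have "F \<kappa> = 0" for \<kappa>
    using sum two[of ChA ChB] two[of ChA ChZ] two[of ChB ChZ] by (cases \<kappa>) auto
  then show ?thesis using e F nz by (cases e) (auto simp: edge_indices_def)
qed

definition bar_stress :: "(vertex \<Rightarrow> complex) \<Rightarrow> vertex \<Rightarrow> complex" where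
  "bar_stress x w = (if w = VT then x VT - x VI else if w = VI then - (x VT - x VI) else 0)"

lemma partial_bar_length:
  "partial w b (\<lambda>x. (cmod (x VT - x VI))\<^sup>2 - l) x = 2 * (bar_stress x w \<bullet> b)"
  by (simp add: partial_sqdist bar_stress_def)

text \<open>A chain closed by a bar is a cycle: since the chain is not straight, its constant force
  is zero, and the balance at I, where the bar has non-zero length, leaves no stress in the
  bar.\<close>

lemma chain_bar_stress_zero:
  assumes pos: "n \<kappa> \<ge> 1" and nz: "\<And>i. i < n \<kappa> \<Longrightarrow> edge_vec n x (\<kappa>, i) \<noteq> 0"
    and x: "x VI \<noteq> x VT" "\<not> straight n x \<kappa>"
    and eq: "\<And>i. i \<le> n \<kappa> \<Longrightarrow>
      (\<Sum>j<n \<kappa>. c j *\<^sub>R stress n x (chain_vertex n \<kappa> i) (\<kappa>, j)) + c' *\<^sub>R bar_stress x (chain_vertex n \<kappa> i) = 0"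
  shows "i < n \<kappa> \<Longrightarrow> c i = 0" "c' = 0"
proof -
  define F where "F = c 0 *\<^sub>R edge_vec n x (\<kappa>, 0)"
  have F: "c i *\<^sub>R edge_vec n x (\<kappa>, i) = F" if "i < n \<kappa>" for i
    using that
  proof (induction i)
    case (Suc j)
    have "bar_stress x (chain_vertex n \<kappa> (Suc j)) = 0"
      using Suc.prems by (simp add: bar_stress_def chain_vertex_def)
    then show ?case
      using eq[of "Suc j"] Suc sum_stress_inner[of n \<kappa>, OF pos Suc.prems, of c x] by simp
  qed (simp add: F_def)
  have "F = 0" using constant_force_straight[of n \<kappa> c x F] F x(2) by blast
  with F nz show "i < n \<kappa> \<Longrightarrow> c i = 0" by fastforce
  show "c' = 0"
  proof -
    have "(\<Sum>j<n \<kappa>. c j *\<^sub>R stress n x VI (\<kappa>, j)) = 0"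
      using sum_stress_initial[of n \<kappa> c x, OF pos] \<open>F = 0\<close>[unfolded F_def]
      by (simp only: minus_zero)
    then show ?thesis using eq[of 0] x(1) by (simp add: bar_stress_def)
  qed
qed

lemma verts_three_chain:
  assumes "\<And>\<kappa>. n \<kappa> \<ge> 1"
  shows "verts (three_chain n len) = (\<Union>\<kappa>. chain_vertex n \<kappa> ` {..n \<kappa>})"
  using assms by (auto simp: three_chain_def verts_Un verts_open_chain UNIV_chain)

lemma chain_vertex_in_verts:
  assumes "\<And>\<kappa>. n \<kappa> \<ge> 1" "i \<le> n \<kappa>"
  shows "chain_vertex n \<kappa> i \<in> verts (three_chain n len)"
  unfolding verts_three_chain[of n len, OF assms(1)] using assms(2) by blast

lemma configs_eq_zero_set:
  assumes "\<And>e. e \<in> edge_indices n \<Longrightarrow> len e > 0"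
  shows "configs (three_chain n len) = {x \<in> verts (three_chain n len) \<rightarrow>\<^sub>E UNIV.
    \<forall>e\<in>edge_indices n. (cmod (edge_vec n x e))\<^sup>2 - (len e)\<^sup>2 = 0}"
proof -
  have "(\<forall>e\<in>edge_indices n. cmod (edge_vec n x e) = len e) \<longleftrightarrow>
      (\<forall>e\<in>edge_indices n. (cmod (edge_vec n x e))\<^sup>2 - (len e)\<^sup>2 = 0)" for x
    using assms by (intro ball_cong refl) (simp add: power2_eq_iff_nonneg less_imp_le)
  then show ?thesis by (auto simp: configs_three_chain_iff)
qed

lemma complex_eq_0_if_inner:
  assumes "\<And>b. b \<in> Basis \<Longrightarrow> (z::complex) \<bullet> b = 0" shows "z = 0"
  using assms by (simp add: euclidean_eq_iff[of z 0])

text \<open>Squared lengths are used because they are polynomial; with positive lengths nothing is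
  lost. A linear relation between their gradients at a configuration is an equilibrium
  stress.\<close>

lemma three_chain_configs_submanifold:
  assumes pos: "\<And>\<kappa>. n \<kappa> \<ge> 1" and gen: "generic_lengths n len"
  shows "submanifold (verts (three_chain n len)) (n ChA + n ChB + n ChZ) (configs (three_chain n len))"
proof (rule submanifoldI)
  let ?V = "verts (three_chain n len)"
  show "card (edge_indices n) = n ChA + n ChB + n ChZ" by (rule card_edge_indices)
  show "configs (three_chain n len) =
      {x \<in> ?V \<rightarrow>\<^sub>E UNIV. \<forall>e\<in>edge_indices n. (cmod (edge_vec n x e))\<^sup>2 - (len e)\<^sup>2 = 0}"
    by (rule configs_eq_zero_set) (use generic_lengths_pos[OF gen] in \<open>auto simp: edge_indices_def\<close>)
  show "polynomial_fun ?V (\<lambda>x. (cmod (edge_vec n x e))\<^sup>2 - (len e)\<^sup>2)" if "e \<in> edge_indices n" for e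
    unfolding edge_vec_def
    using that
    by (intro polynomial_fun_sqdist chain_vertex_in_verts pos) (auto simp: edge_indices_def)
  fix x c
  assume x: "x \<in> configs (three_chain n len)"
    and c: "\<And>v b. v \<in> ?V \<Longrightarrow> b \<in> Basis \<Longrightarrow>
      (\<Sum>e\<in>edge_indices n. c e * partial v b (\<lambda>x. (cmod (edge_vec n x e))\<^sup>2 - (len e)\<^sup>2) x) = 0"
  have len: "cmod (edge_vec n x (\<kappa>, i)) = len (\<kappa>, i)" if "i < n \<kappa>" for \<kappa> i
    using x that by (auto simp: configs_three_chain_iff edge_indices_def)
  have "(\<Sum>e\<in>edge_indices n. c e *\<^sub>R stress n x (chain_vertex n \<kappa> i) e) = 0" if i: "i \<le> n \<kappa>" for \<kappa> i
  proof (rule complex_eq_0_if_inner)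
    fix b :: complex assume b: "b \<in> Basis"
    let ?w = "chain_vertex n \<kappa> i"
    have "?w \<in> ?V" using i by (intro chain_vertex_in_verts pos)
    have "(\<Sum>e\<in>edge_indices n. c e * (2 * (stress n x ?w e \<bullet> b))) =
        (\<Sum>e\<in>edge_indices n. c e * partial ?w b (\<lambda>x. (cmod (edge_vec n x e))\<^sup>2 - (len e)\<^sup>2) x)"
      by (intro sum.cong) (auto simp: edge_indices_def partial_edge_length)
    with c[OF \<open>?w \<in> ?V\<close> b] have "(\<Sum>e\<in>edge_indices n. c e * (2 * (stress n x ?w e \<bullet> b))) = 0" by simp
    then show "(\<Sum>e\<in>edge_indices n. c e *\<^sub>R stress n x ?w e) \<bullet> b = 0"
      by (simp add: inner_sum_left mult.left_commute[of _ 2] flip: sum_distrib_left)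
  qed
  then show "\<forall>e\<in>edge_indices n. c e = 0"
    using three_chain_stress_zero[OF pos gen len] by blast
qed simp

section \<open>Critical manifolds of circular type\<close>

lemma config_class_cong: "(\<And>v. v \<in> verts L \<Longrightarrow> x v = y v) \<Longrightarrow> config_class L x = config_class L y"
  by (auto simp: set_eq_iff mem_config_class cong: restrict_cong)

lemma restrict_class_config_class:
  assumes "verts L' \<subseteq> verts L"
  shows "restrict_class L' (config_class L x) = config_class L' x"
proof (intro set_eqI iffI)
  fix y assume "y \<in> restrict_class L' (config_class L x)"
  then show "y \<in> config_class L' x"
    using assms unfolding restrict_class_def mem_config_class image_iff Bex_def
    by (auto simp: fun_eq_iff subset_iff)
next
  fix y assume "y \<in> config_class L' x"
  then obtain w t where w: "cmod w = 1" "y = (\<lambda>v\<in>verts L'. w * x v + t)"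
    using mem_config_class by blast
  then have "y = restrict (\<lambda>v\<in>verts L. w * x v + t) (verts L')"
    using assms by (auto simp: fun_eq_iff)
  moreover have "(\<lambda>v\<in>verts L. w * x v + t) \<in> config_class L x"
    using w(1) mem_config_class by blast
  ultimately show "y \<in> restrict_class L' (config_class L x)"
    unfolding restrict_class_def by blast
qed

lemma config_class_eq_iff:
  "config_class L x = config_class L y \<longleftrightarrow>
    (\<exists>w t. cmod w = 1 \<and> (\<forall>v\<in>verts L. x v = w * y v + t))"
proof
  assume eq: "config_class L x = config_class L y"
  have "(\<lambda>v\<in>verts L. x v) \<in> config_class L x"
    unfolding mem_config_class by (intro exI[of _ 1] exI[of _ 0]) (auto simp: fun_eq_iff)
  then obtain w t where w: "cmod w = 1" "(\<lambda>v\<in>verts L. x v) = (\<lambda>v\<in>verts L. w * y v + t)"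
    unfolding eq mem_config_class by blast
  then have "\<forall>v\<in>verts L. x v = w * y v + t" by (metis restrict_apply')
  with w(1) show "\<exists>w t. cmod w = 1 \<and> (\<forall>v\<in>verts L. x v = w * y v + t)" by blast
next
  assume "\<exists>w t. cmod w = 1 \<and> (\<forall>v\<in>verts L. x v = w * y v + t)"
  then obtain w t where w: "cmod w = 1" "\<forall>v\<in>verts L. x v = w * y v + t" by blast
  then have "(\<lambda>v\<in>verts L. w * y v + t) \<in> config_class L y"
    using mem_config_class by blast
  then have "config_class L (\<lambda>v\<in>verts L. w * y v + t) = config_class L y"
    by (rule config_class_eq)
  moreover have "config_class L (\<lambda>v\<in>verts L. w * y v + t) = config_class L x"
    using w(2) by (intro config_class_cong) simp
  ultimately show "config_class L x = config_class L y" by simp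
qed

lemma smooth_curve_add_mult:
  assumes "smooth_curve a" "smooth_curve b"
  shows "smooth_curve (\<lambda>t. a t + k * b t)"
proof -
  obtain A B where A: "A 0 = a" "\<And>j t. (A j has_vector_derivative A (Suc j) t) (at t)"
    and B: "B 0 = b" "\<And>j t. (B j has_vector_derivative B (Suc j) t) (at t)"
    using assms unfolding smooth_curve_def by metis
  show ?thesis
    unfolding smooth_curve_def
    by (rule exI[of _ "\<lambda>j t. A j t + k * B j t"])
       (auto intro!: has_vector_derivative_add has_vector_derivative_mult_right A(2) B(2) simp: A(1) B(1))
qed

lemma verts_two_chain:
  "n \<kappa> \<ge> 1 \<Longrightarrow> n \<kappa>' \<ge> 1 \<Longrightarrow>
    verts (two_chain_cycle n len \<kappa> \<kappa>') = chain_vertex n \<kappa> ` {..n \<kappa>} \<union> chain_vertex n \<kappa>' ` {..n \<kappa>'}"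
  by (simp add: two_chain_cycle_def verts_Un verts_open_chain)

lemma ends_in_chain: "n \<kappa> \<ge> 1 \<Longrightarrow> VI \<in> chain_vertex n \<kappa> ` {..n \<kappa>} \<and> VT \<in> chain_vertex n \<kappa> ` {..n \<kappa>}"
  by (metis atMost_iff chain_vertex_0 chain_vertex_end image_eqI le_refl zero_le)

lemma verts_chain_with_bar:
  "n \<kappa> \<ge> 1 \<Longrightarrow> verts (chain_with_bar n len \<kappa> d) = chain_vertex n \<kappa> ` {..n \<kappa>}"
proof -
  assume "n \<kappa> \<ge> 1"
  moreover have "verts (insert (VI, VT, d) L) = {VI, VT} \<union> verts L" for L by (auto simp: verts_def)
  ultimately show ?thesis
    using ends_in_chain[of n \<kappa>] by (auto simp: chain_with_bar_def verts_open_chain)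
qed

lemma configs_chain_with_bar:
  "x \<in> configs (chain_with_bar n len \<kappa> d) \<longleftrightarrow> x \<in> verts (chain_with_bar n len \<kappa> d) \<rightarrow>\<^sub>E UNIV \<and>
    (\<forall>i<n \<kappa>. cmod (edge_vec n x (\<kappa>, i)) = len (\<kappa>, i)) \<and> cmod (x VT - x VI) = d"
  by (auto simp: configs_def chain_with_bar_def open_chain_def edge_vec_def dist_norm norm_minus_commute)

text \<open>The index \<open>n ChZ\<close> stands for the bar, so the indices up to
  \<open>n ChZ\<close> inclusive enumerate the \<open>r + 1\<close> edges of the flexible
  polygon.\<close>

definition bar_equation ::
  "(chain \<Rightarrow> nat) \<Rightarrow> (chain \<times> nat \<Rightarrow> real) \<Rightarrow> real \<Rightarrow> nat \<Rightarrow> (vertex \<Rightarrow> complex) \<Rightarrow> real" where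
  "bar_equation n len d i x = (if i < n ChZ then (cmod (edge_vec n x (ChZ, i)))\<^sup>2 - (len (ChZ, i))\<^sup>2
     else (cmod (x VT - x VI))\<^sup>2 - d\<^sup>2)"

lemma partial_bar_equation:
  "partial w b (bar_equation n len d i) x =
    2 * ((if i < n ChZ then stress n x w (ChZ, i) else bar_stress x w) \<bullet> b)"
  unfolding bar_equation_def
  by (cases "i < n ChZ") (simp_all add: partial_edge_length partial_bar_length)

lemma polynomial_fun_bar_equation:
  assumes "n ChZ \<ge> 1" "chain_vertex n ChZ ` {..n ChZ} \<subseteq> V"
  shows "polynomial_fun V (bar_equation n len d i)"
proof (cases "i < n ChZ")
  case True
  with assms(2) have "chain_vertex n ChZ i \<in> V" "chain_vertex n ChZ (Suc i) \<in> V"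
    by (auto simp: image_subset_iff)
  with True show ?thesis
    unfolding bar_equation_def edge_vec_def by (simp add: polynomial_fun_sqdist)
next
  case False
  have "VI \<in> V" "VT \<in> V" using assms ends_in_chain[of n ChZ] by auto
  with False show ?thesis
    unfolding bar_equation_def by (simp add: polynomial_fun_sqdist)
qed

definition inner_vertices :: "(chain \<Rightarrow> nat) \<Rightarrow> vertex set" where
  "inner_vertices n = Inner ChA ` {1..<n ChA} \<union> Inner ChB ` {1..<n ChB}"

lemma card_inner_vertices: "finite (inner_vertices n)" "card (inner_vertices n) = (n ChA - 1) + (n ChB - 1)"
proof -
  have "card (Inner ChA ` {1..<n ChA} \<union> Inner ChB ` {1..<n ChB}) =
      card (Inner ChA ` {1..<n ChA}) + card (Inner ChB ` {1..<n ChB})"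
    by (intro card_Un_disjoint) auto
  then show "card (inner_vertices n) = (n ChA - 1) + (n ChB - 1)"
    by (simp add: inner_vertices_def card_image inj_on_def)
qed (simp add: inner_vertices_def)

lemma chain_vertices_inner:
  "n \<kappa> \<ge> 1 \<Longrightarrow> chain_vertex n \<kappa> ` {..n \<kappa>} = {VI, VT} \<union> Inner \<kappa> ` {1..<n \<kappa>}"
proof (intro equalityI subsetI)
  fix v assume "n \<kappa> \<ge> 1" "v \<in> {VI, VT} \<union> Inner \<kappa> ` {1..<n \<kappa>}"
  moreover have "Inner \<kappa> i \<in> chain_vertex n \<kappa> ` {..n \<kappa>}" if "1 \<le> i" "i < n \<kappa>" for i
    using that by (intro image_eqI[of _ _ i]) (auto simp: chain_vertex_def)
  ultimately show "v \<in> chain_vertex n \<kappa> ` {..n \<kappa>}" using ends_in_chain[of n \<kappa>] by auto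
qed (auto simp: chain_vertex_def)

section \<open>The critical manifold of one cyclic polygon\<close>

context
  fixes n :: "chain \<Rightarrow> nat" and len :: "chain \<times> nat \<Rightarrow> real" and g :: "vertex \<Rightarrow> complex"
  assumes pos: "n \<kappa> \<ge> 1" and gen: "generic_lengths n len"
    and g: "g \<in> configs (two_chain_cycle n len ChA ChB)"
    and cyc: "cyclic (two_chain_cycle n len ChA ChB) g"
begin

private abbreviation (input) "d \<equiv> dist (g VI) (g VT)"
private abbreviation (input) "L \<equiv> three_chain n len"
private abbreviation (input) "Gam \<equiv> two_chain_cycle n len ChA ChB"
private abbreviation (input) "Q \<equiv> chain_with_bar n len ChZ d"

private lemmas verts_chain = verts_open_chain[of n _ len, OF pos]
private lemmas verts_bar = verts_chain_with_bar[of n ChZ len, OF pos]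
private lemmas verts_cycle = verts_two_chain[of n _ _ len, OF pos pos]

private lemma ends: "g VI \<noteq> g VT"
  by (rule cyclic_ends_distinct[of n len g, OF pos gen g cyc])

private lemma verts_Gam: "verts Gam = {VI, VT} \<union> inner_vertices n"
  unfolding verts_cycle chain_vertices_inner[of n, OF pos] inner_vertices_def by blast

private lemma verts_Q: "verts Q = {VI, VT} \<union> Inner ChZ ` {1..<n ChZ}"
  unfolding verts_bar chain_vertices_inner[of n, OF pos] ..

private lemma verts_L: "verts L = verts Gam \<union> verts Q"
  unfolding three_chain_def two_chain_cycle_def verts_Un verts_chain verts_bar ..

private lemma bar_equations_iff:
  "(\<forall>i\<le>n ChZ. bar_equation n len d i x = 0) \<longleftrightarrow>
    (\<forall>i<n ChZ. cmod (edge_vec n x (ChZ, i)) = len (ChZ, i)) \<and> cmod (x VT - x VI) = d"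
proof -
  have sq: "(cmod z)\<^sup>2 - l\<^sup>2 = 0 \<longleftrightarrow> cmod z = l" if "l > 0" for z l
    using that by (simp add: power2_eq_iff_nonneg)
  have "bar_equation n len d i x = 0 \<longleftrightarrow> cmod (edge_vec n x (ChZ, i)) = len (ChZ, i)" if "i < n ChZ" for i
    using that by (simp only: bar_equation_def if_True sq[OF generic_lengths_pos[OF gen that]])
  moreover have "bar_equation n len d (n ChZ) x = 0 \<longleftrightarrow> cmod (x VT - x VI) = d"
    unfolding bar_equation_def using sq[of d] ends by (simp only: less_irrefl if_False) simp
  ultimately show ?thesis by (auto simp: le_less)
qed

text \<open>Stated for any family of points satisfying the equations, because it is needed twice:
  for the flexible polygon itself, and for the stratum inside the configuration space of the whole
  linkage.\<close>

private lemma bar_equations_independent: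
  assumes x: "\<forall>i\<le>n ChZ. bar_equation n len d i x = 0"
    and c: "\<And>v b. v \<in> verts Q \<Longrightarrow> b \<in> Basis \<Longrightarrow>
      (\<Sum>i\<le>n ChZ. c i * partial v b (bar_equation n len d i) x) = 0"
    and i: "i \<le> n ChZ"
  shows "c i = 0"
proof -
  have len: "cmod (edge_vec n x (ChZ, i)) = len (ChZ, i)" if "i < n ChZ" for i
    using x bar_equations_iff that by blast
  have d: "cmod (x VT - x VI) = d" using x bar_equations_iff by blast
  have "(\<Sum>j<n ChZ. c j *\<^sub>R stress n x (chain_vertex n ChZ k) (ChZ, j)) +
      c (n ChZ) *\<^sub>R bar_stress x (chain_vertex n ChZ k) = 0" if k: "k \<le> n ChZ" for k
  proof (rule complex_eq_0_if_inner)
    fix b :: complex assume b: "b \<in> Basis"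
    let ?w = "chain_vertex n ChZ k"
    have "?w \<in> verts Q" using k unfolding verts_bar by blast
    from c[OF this b] have "(\<Sum>j<n ChZ. c j * (2 * (stress n x ?w (ChZ, j) \<bullet> b))) +
        c (n ChZ) * (2 * (bar_stress x ?w \<bullet> b)) = 0"
      by (simp add: partial_bar_equation lessThan_Suc_atMost[symmetric] del: lessThan_Suc_atMost)
    then have "2 * ((\<Sum>j<n ChZ. c j * (stress n x ?w (ChZ, j) \<bullet> b)) + c (n ChZ) * (bar_stress x ?w \<bullet> b)) = 0"
      by (simp add: distrib_left sum_distrib_left mult.left_commute[of _ 2])
    then show "((\<Sum>j<n ChZ. c j *\<^sub>R stress n x ?w (ChZ, j)) + c (n ChZ) *\<^sub>R bar_stress x ?w) \<bullet> b = 0"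
      by (simp add: inner_add_left inner_sum_left)
  qed
  note zero = chain_bar_stress_zero[of n ChZ x c "c (n ChZ)", OF pos _ _ _ this]
  have "edge_vec n x (ChZ, i) \<noteq> 0" if "i < n ChZ" for i
    using len[OF that] generic_lengths_pos[OF gen that] by auto
  moreover have "x VI \<noteq> x VT" using d ends by auto
  moreover have "\<not> straight n x ChZ"
    using cyclic_not_straight[of n len g x, OF pos gen g cyc d] len by blast
  ultimately have "i < n ChZ \<Longrightarrow> c i = 0" "c (n ChZ) = 0" using zero by blast+
  then show ?thesis using i by (cases "i < n ChZ") auto
qed

lemma bar_configs_submanifold: "submanifold (verts Q) (n ChZ + 1) (configs Q)"
proof (rule submanifoldI[where J = "{..n ChZ}" and F = "bar_equation n len d"])
  show "configs Q = {y \<in> verts Q \<rightarrow>\<^sub>E UNIV. \<forall>j\<in>{..n ChZ}. bar_equation n len d j y = 0}"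
    unfolding set_eq_iff mem_Collect_eq configs_chain_with_bar bar_equations_iff[symmetric]
    by (simp add: Ball_def)
  show "polynomial_fun (verts Q) (bar_equation n len d j)" for j
    by (rule polynomial_fun_bar_equation) (simp_all only: verts_bar pos order_refl)
  fix x c
  assume "x \<in> configs Q" "\<And>v b. v \<in> verts Q \<Longrightarrow> b \<in> Basis \<Longrightarrow>
      (\<Sum>j\<in>{..n ChZ}. c j * partial v b (bar_equation n len d j) x) = 0"
  then show "\<forall>j\<in>{..n ChZ}. c j = 0"
    using bar_equations_independent[of x c] bar_equations_iff by (simp add: configs_chain_with_bar)
qed auto

text \<open>An orientation-preserving isometry is determined by the images of two distinct points.
  This is the factor of the similarity that takes I and T in \<open>g\<close> to I and T in
  \<open>x\<close>; it has modulus one exactly when the distances agree.\<close>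

private definition rotation :: "(vertex \<Rightarrow> complex) \<Rightarrow> complex" where
  "rotation x = (x VT - x VI) / (g VT - g VI)"

private lemma norm_rotation: "cmod (x VT - x VI) = d \<Longrightarrow> cmod (rotation x) = 1"
  using ends by (simp add: rotation_def norm_divide dist_norm norm_minus_commute)

private lemma circular_stratum_iff:
  "x \<in> configs L \<Longrightarrow> config_class L x \<in> circular_stratum n len g \<longleftrightarrow>
    (\<exists>w t. cmod w = 1 \<and> (\<forall>v\<in>verts Gam. x v = w * g v + t))"
proof -
  assume "x \<in> configs L"
  then have "config_class L x \<in> reduced_configs L" using reduced_configs_iff by blast
  moreover have "restrict_class Gam (config_class L x) = config_class Gam x"
    using verts_L by (intro restrict_class_config_class) auto
  ultimately show ?thesis unfolding circular_stratum_def mem_Collect_eq by (simp only: config_class_eq_iff) simp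
qed

private lemma Union_circular_stratum:
  "\<Union>(circular_stratum n len g) = {x \<in> configs L. config_class L x \<in> circular_stratum n len g}"
proof -
  have sub: "circular_stratum n len g \<subseteq> reduced_configs L" by (auto simp: circular_stratum_def)
  show ?thesis
  proof (intro equalityI subsetI)
    fix x assume "x \<in> \<Union>(circular_stratum n len g)"
    then obtain \<xi> where "\<xi> \<in> circular_stratum n len g" "x \<in> \<xi>" by blast
    with sub mem_reduced_config[of \<xi> L x]
    show "x \<in> {x \<in> configs L. config_class L x \<in> circular_stratum n len g}" by auto
  qed (use config_class_self in blast)
qed

text \<open>Eliminates the unknown isometry: membership in the stratum becomes the length equations
  of Z and the bar, together with explicit positions of the inner vertices of A and B in terms of I
  and T.\<close>

private lemma stratum_config_iff:
  "x \<in> configs L \<and> config_class L x \<in> circular_stratum n len g \<longleftrightarrow>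
    x \<in> verts L \<rightarrow>\<^sub>E UNIV \<and> (\<forall>i<n ChZ. cmod (edge_vec n x (ChZ, i)) = len (ChZ, i)) \<and>
      cmod (x VT - x VI) = d \<and> (\<forall>v\<in>inner_vertices n. x v = x VI + rotation x * (g v - g VI))"
  (is "?l \<longleftrightarrow> ?r")
proof
  assume l: ?l
  then obtain w t where w: "cmod w = 1" "\<And>v. v \<in> verts Gam \<Longrightarrow> x v = w * g v + t"
    using circular_stratum_iff by blast
  have I: "x VI = w * g VI + t" "x VT = w * g VT + t" using w(2) verts_Gam by auto
  then have "x VT - x VI = w * (g VT - g VI)" by (simp add: algebra_simps)
  then have "rotation x = w" "cmod (x VT - x VI) = d"
    using ends w(1) by (simp_all add: rotation_def norm_mult dist_norm norm_minus_commute)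
  moreover have "x v = x VI + w * (g v - g VI)" if "v \<in> inner_vertices n" for v
    using w(2)[of v] I that verts_Gam by (simp add: algebra_simps)
  moreover have "x \<in> verts L \<rightarrow>\<^sub>E UNIV" "\<And>i. i < n ChZ \<Longrightarrow> cmod (edge_vec n x (ChZ, i)) = len (ChZ, i)"
    using l by (auto simp: configs_three_chain_iff edge_indices_def)
  ultimately show ?r by simp
next
  assume r: ?r
  define w where "w = rotation x"
  have w: "cmod w = 1" using r norm_rotation w_def by simp
  have wI: "x VT - x VI = w * (g VT - g VI)" using ends by (simp add: w_def rotation_def)
  have xv: "x v = w * g v + (x VI - w * g VI)" if v: "v \<in> verts Gam" for v
  proof -
    consider "v \<in> inner_vertices n" | "v = VI" | "v = VT" using v verts_Gam by auto
    then show ?thesis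
    proof cases
      case 1
      then have "x v = x VI + w * (g v - g VI)" using r w_def by blast
      then show ?thesis by (simp add: algebra_simps)
    next
      case 3
      then show ?thesis using wI by (simp add: algebra_simps)
    qed simp
  qed
  have "cmod (edge_vec n x (\<kappa>, i)) = len (\<kappa>, i)" if i: "i < n \<kappa>" for \<kappa> i
  proof (cases "\<kappa> = ChZ")
    case True
    then show ?thesis using r i by simp
  next
    case False
    then have \<kappa>: "\<kappa> = ChA \<or> \<kappa> = ChB" by (cases \<kappa>) auto
    then have "chain_vertex n \<kappa> i \<in> verts Gam" "chain_vertex n \<kappa> (Suc i) \<in> verts Gam"
      using i unfolding verts_cycle by auto
    then have "edge_vec n x (\<kappa>, i) = w * edge_vec n g (\<kappa>, i)"
      by (simp add: edge_vec_def xv algebra_simps)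
    then show ?thesis using w configs_two_chain_edge[OF g \<kappa> i] by (simp add: norm_mult)
  qed
  then have "x \<in> configs L" using r by (auto simp: configs_three_chain_iff edge_indices_def)
  then show ?l using circular_stratum_iff[of x] w xv by blast
qed

text \<open>One real coordinate of the position condition for an inner vertex. It is linear in
  \<open>x\<close>, as the quotient formed from \<open>g\<close> is a constant.\<close>

private definition shape_equation :: "vertex \<times> complex \<Rightarrow> (vertex \<Rightarrow> complex) \<Rightarrow> real" where
  "shape_equation j x =
    (x (fst j) - x VI - (g (fst j) - g VI) / (g VT - g VI) * (x VT - x VI)) \<bullet> snd j"

private lemma shape_equations_iff:
  "(\<forall>j\<in>inner_vertices n \<times> Basis. shape_equation j x = 0) \<longleftrightarrow>
    (\<forall>v\<in>inner_vertices n. x v = x VI + rotation x * (g v - g VI))"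
proof -
  have "(\<forall>b\<in>Basis. shape_equation (v, b) x = 0) \<longleftrightarrow> x v = x VI + rotation x * (g v - g VI)" for v
  proof -
    have "(\<forall>b\<in>Basis. shape_equation (v, b) x = 0) \<longleftrightarrow>
        x v - x VI - (g v - g VI) / (g VT - g VI) * (x VT - x VI) = 0"
      unfolding shape_equation_def by (subst euclidean_eq_iff) simp
    then show ?thesis by (simp add: rotation_def algebra_simps)
  qed
  then show ?thesis by auto
qed

private lemma polynomial_fun_shape_equation:
  "v \<in> inner_vertices n \<Longrightarrow> polynomial_fun (verts L) (shape_equation (v, b))"
proof -
  assume v: "v \<in> inner_vertices n"
  define k where "k = (g v - g VI) / (g VT - g VI)"
  have m: "v \<in> verts L" "VI \<in> verts L" "VT \<in> verts L"
    using v verts_L verts_Gam by auto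
  have "polynomial_fun (verts L) (\<lambda>x.
      (Re (x v) - Re (x VI) - (Re k * (Re (x VT) - Re (x VI)) - Im k * (Im (x VT) - Im (x VI)))) * Re b +
      (Im (x v) - Im (x VI) - (Re k * (Im (x VT) - Im (x VI)) + Im k * (Re (x VT) - Re (x VI)))) * Im b)"
    using m by (intro polynomial_fun_intros)
  then show ?thesis
    unfolding shape_equation_def inner_complex_def fst_conv snd_conv k_def[symmetric] by simp
qed

private lemma partial_shape_equation:
  assumes "v \<in> inner_vertices n" "v' \<in> inner_vertices n" "b \<in> Basis" "b' \<in> Basis"
  shows "partial v b (shape_equation (v', b')) x = (if (v', b') = (v, b) then 1 else 0)"
proof (rule partialI)
  have "v \<noteq> VI" "v \<noteq> VT" using assms(1) by (auto simp: inner_vertices_def)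
  then have "shape_equation (v', b') (x(v := x v + t *\<^sub>R b)) =
      shape_equation (v', b') x + t * (if (v', b') = (v, b) then 1 else 0)" for t
    using assms(3,4) inner_Basis[OF assms(3,4)]
    by (auto simp: shape_equation_def inner_diff_left inner_add_left)
  then show "((\<lambda>t. shape_equation (v', b') (x(v := x v + t *\<^sub>R b))) has_real_derivative
      (if (v', b') = (v, b) then 1 else 0)) (at 0)"
    by (simp only:) (auto intro!: derivative_eq_intros)
qed

text \<open>The gradients are block triangular: the bar equations do not involve the inner vertices
  of A and B, and each shape equation involves just its own one, with derivative 1. Differentiating
  there kills the shape coefficients, and the bar equations remain. The count is
  \<open>r + 1\<close> bar equations and two shape equations for each of the
  \<open>p + q - 2\<close> inner vertices.\<close>

lemma circular_stratum_submanifold: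
  "submanifold (verts L) (2 * (n ChA + n ChB) + n ChZ - 3) (\<Union>(circular_stratum n len g))"
proof (rule submanifoldI)
  let ?W = "inner_vertices n \<times> (Basis :: complex set)"
  let ?J = "{..n ChZ} <+> ?W"
  let ?F = "\<lambda>j. case j of Inl i \<Rightarrow> bar_equation n len d i | Inr j \<Rightarrow> shape_equation j"
  have finW: "finite ?W" using card_inner_vertices(1) by simp
  show "finite ?J" using finW by simp
  have "card ?J = Suc (n ChZ) + ((n ChA - 1) + (n ChB - 1)) * 2"
    using finW by (simp add: card_Plus card_cartesian_product card_inner_vertices)
  then show "card ?J = 2 * (n ChA + n ChB) + n ChZ - 3"
    using pos[of ChA] pos[of ChB] by simp
  have all: "(\<forall>j\<in>?J. P j) \<longleftrightarrow> (\<forall>i\<le>n ChZ. P (Inl i)) \<and> (\<forall>j\<in>?W. P (Inr j))" for P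
    by (auto simp: Plus_def)
  show *: "\<Union>(circular_stratum n len g) = {x \<in> verts L \<rightarrow>\<^sub>E UNIV. \<forall>j\<in>?J. ?F j x = 0}"
    unfolding all sum.case bar_equations_iff shape_equations_iff Union_circular_stratum
    using stratum_config_iff by blast
  show "polynomial_fun (verts L) (?F j)" if "j \<in> ?J" for j
    using that polynomial_fun_bar_equation[of n "verts L" len d, OF pos] polynomial_fun_shape_equation
      verts_L verts_bar by (auto simp: Plus_def)
  fix x c
  assume x: "x \<in> \<Union>(circular_stratum n len g)"
    and c: "\<And>v b. v \<in> verts L \<Longrightarrow> b \<in> Basis \<Longrightarrow> (\<Sum>j\<in>?J. c j * partial v b (?F j) x) = 0"
  have split: "(\<Sum>i\<le>n ChZ. c (Inl i) * partial v b (bar_equation n len d i) x) +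
      (\<Sum>j\<in>?W. c (Inr j) * partial v b (shape_equation j) x) = 0" if "v \<in> verts L" "b \<in> Basis" for v b
    using c[OF that] finW by (simp add: sum.Plus)
  have W: "c (Inr (v, b)) = 0" if vb: "v \<in> inner_vertices n" "b \<in> Basis" for v b
  proof -
    have "stress n x v (ChZ, i) = 0" if "i < n ChZ" for i
      using vb(1) that by (auto simp: stress_def inner_vertices_def chain_vertex_def)
    moreover have "bar_stress x v = 0" using vb(1) by (auto simp: bar_stress_def inner_vertices_def)
    ultimately have "(\<Sum>i\<le>n ChZ. c (Inl i) * partial v b (bar_equation n len d i) x) = 0"
      by (intro sum.neutral) (auto simp: partial_bar_equation)
    moreover have "(\<Sum>j\<in>?W. c (Inr j) * partial v b (shape_equation j) x) =
        (\<Sum>j\<in>?W. if j = (v, b) then c (Inr j) else 0)"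
      using vb by (intro sum.cong) (auto simp: partial_shape_equation split: if_splits)
    ultimately show ?thesis
      using split[of v b] vb finW verts_L verts_Gam by (simp add: sum.delta)
  qed
  have "c (Inl i) = 0" if "i \<le> n ChZ" for i
  proof (rule bar_equations_independent[of x "\<lambda>i. c (Inl i)", OF _ _ that])
    show "\<forall>i\<le>n ChZ. bar_equation n len d i x = 0" using x unfolding * all by auto
    fix v and b :: complex assume vb: "v \<in> verts Q" "b \<in> Basis"
    have "(\<Sum>j\<in>?W. c (Inr j) * partial v b (shape_equation j) x) = 0"
      using W by (intro sum.neutral) auto
    then show "(\<Sum>i\<le>n ChZ. c (Inl i) * partial v b (bar_equation n len d i) x) = 0"
      using split[of v b] vb verts_L by simp
  qed
  with W show "\<forall>j\<in>?J. c j = 0" unfolding all by auto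
qed

text \<open>The inverse of the restriction: the rigid polygon is glued back onto the bar.\<close>

private definition extend :: "(vertex \<Rightarrow> complex) \<Rightarrow> vertex \<Rightarrow> complex" where
  "extend y = (\<lambda>v\<in>verts L. if v \<in> inner_vertices n then y VI + rotation y * (g v - g VI) else y v)"

private lemma extend_Q: "v \<in> verts Q \<Longrightarrow> extend y v = y v"
  using verts_Q verts_L by (auto simp: extend_def inner_vertices_def)

private lemma Q_mem: "VI \<in> verts Q" "VT \<in> verts Q" "i \<le> n ChZ \<Longrightarrow> chain_vertex n ChZ i \<in> verts Q"
  unfolding verts_bar using ends_in_chain[of n ChZ, OF pos] by auto

private lemma extend_config:
  assumes "y \<in> configs Q"
  shows "extend y \<in> configs L \<and> config_class L (extend y) \<in> circular_stratum n len g"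
  unfolding stratum_config_iff
proof (intro conjI allI impI ballI)
  have rot: "rotation (extend y) = rotation y"
    by (simp add: rotation_def extend_Q Q_mem)
  show "extend y \<in> verts L \<rightarrow>\<^sub>E UNIV" by (simp add: extend_def)
  show "cmod (edge_vec n (extend y) (ChZ, i)) = len (ChZ, i)" if "i < n ChZ" for i
    using assms that by (simp add: edge_vec_def extend_Q Q_mem configs_chain_with_bar)
  show "cmod (extend y VT - extend y VI) = d"
    using assms by (simp add: extend_Q Q_mem configs_chain_with_bar)
  show "extend y v = extend y VI + rotation (extend y) * (g v - g VI)" if "v \<in> inner_vertices n" for v
    using that verts_L verts_Gam unfolding rot by (simp add: extend_Q Q_mem) (simp add: extend_def)
qed

private lemma restrict_class_Q: "restrict_class Q (config_class L x) = config_class Q x"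
  using verts_L by (intro restrict_class_config_class) auto

private lemma restrict_Q:
  assumes "x \<in> configs L" "config_class L x \<in> circular_stratum n len g"
  shows "restrict x (verts Q) \<in> configs Q"
  using stratum_config_iff[of x] assms
  by (simp add: configs_chain_with_bar edge_vec_def Q_mem)

private lemma stratum_class_inj:
  assumes "x \<in> configs L" "config_class L x \<in> circular_stratum n len g"
    and "y \<in> configs L" "config_class L y \<in> circular_stratum n len g"
    and "config_class Q x = config_class Q y"
  shows "config_class L x = config_class L y"
proof -
  obtain w t where w: "cmod w = 1" "\<And>v. v \<in> verts Q \<Longrightarrow> x v = w * y v + t"
    using assms(5)[unfolded config_class_eq_iff] by auto
  have "x VT - x VI = w * (y VT - y VI)" by (simp add: w(2) Q_mem algebra_simps)
  then have rot: "rotation x = w * rotation y" by (simp add: rotation_def)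
  have "x v = w * y v + t" if v: "v \<in> verts L" for v
  proof (cases "v \<in> inner_vertices n")
    case True
    then have "x v = x VI + rotation x * (g v - g VI)" and y: "y v = y VI + rotation y * (g v - g VI)"
      using assms(1-4) stratum_config_iff by blast+
    then have "x v = w * y VI + t + w * rotation y * (g v - g VI)"
      by (simp only: w(2)[OF Q_mem(1)] rot)
    also have "\<dots> = w * y v + t" unfolding y by (simp only: algebra_simps)
    finally show ?thesis .
  next
    case False
    then have "v \<in> verts Q" using v verts_L verts_Gam Q_mem by auto
    then show ?thesis by (rule w(2))
  qed
  with w(1) show ?thesis unfolding config_class_eq_iff by blast
qed

private lemma stratum_rep:
  assumes "\<xi> \<in> circular_stratum n len g"
  obtains x where "x \<in> configs L" "\<xi> = config_class L x"
  using assms unfolding circular_stratum_def reduced_configs_iff by blast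

text \<open>Smooth curves are transported on the level of configurations, by restriction in one
  direction and by \<open>extend\<close> in the other.\<close>

lemma circular_stratum_diffeomorphism:
  "reduced_diffeomorphism L (circular_stratum n len g) Q (reduced_configs Q) (restrict_class Q)"
  unfolding reduced_diffeomorphism_def
proof (intro conjI allI impI)
  let ?K = "circular_stratum n len g"
  have inj: "inj_on (restrict_class Q) ?K"
  proof (rule inj_onI)
    fix \<xi> \<eta> assume K: "\<xi> \<in> ?K" "\<eta> \<in> ?K" and eq: "restrict_class Q \<xi> = restrict_class Q \<eta>"
    obtain x where x: "x \<in> configs L" "\<xi> = config_class L x" using K(1) by (rule stratum_rep)
    obtain y where y: "y \<in> configs L" "\<eta> = config_class L y" using K(2) by (rule stratum_rep)
    have "config_class Q x = config_class Q y" using eq unfolding x(2) y(2) restrict_class_Q .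
    then show "\<xi> = \<eta>" using stratum_class_inj[of x y] K x y by simp
  qed
  have sub: "restrict_class Q \<xi> \<in> reduced_configs Q" if K: "\<xi> \<in> ?K" for \<xi>
  proof -
    obtain x where x: "x \<in> configs L" "\<xi> = config_class L x" using K by (rule stratum_rep)
    have "restrict x (verts Q) \<in> configs Q" using restrict_Q x K by simp
    moreover have "restrict_class Q \<xi> = config_class Q (restrict x (verts Q))"
      unfolding x(2) restrict_class_Q by (rule config_class_cong) simp
    ultimately show ?thesis unfolding reduced_configs_iff by blast
  qed
  have ext: "restrict_class Q (config_class L (extend y)) = config_class Q y" for y
    unfolding restrict_class_Q by (rule config_class_cong) (simp add: extend_Q)
  have "\<eta> \<in> restrict_class Q ` ?K" if K: "\<eta> \<in> reduced_configs Q" for \<eta>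
  proof -
    obtain y where y: "y \<in> configs Q" "\<eta> = config_class Q y" using K reduced_configs_iff by blast
    then show ?thesis using ext[of y] extend_config[of y] by (metis image_eqI)
  qed
  with inj sub show "bij_betw (restrict_class Q) ?K (reduced_configs Q)"
    unfolding bij_betw_def by blast
  fix c :: "real \<Rightarrow> (vertex \<Rightarrow> complex) set" assume "range c \<subseteq> ?K"
  then have c: "c t \<in> ?K" for t by blast
  show "reduced_smooth_curve L c \<longleftrightarrow> reduced_smooth_curve Q (restrict_class Q \<circ> c)"
  proof
    assume "reduced_smooth_curve L c"
    then obtain \<gamma> where \<gamma>: "\<And>t. \<gamma> t \<in> configs L" "\<And>t. c t = config_class L (\<gamma> t)"
      "\<And>v. v \<in> verts L \<Longrightarrow> smooth_curve (\<lambda>t. \<gamma> t v)"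
      unfolding reduced_smooth_curve_def by blast
    show "reduced_smooth_curve Q (restrict_class Q \<circ> c)"
      unfolding reduced_smooth_curve_def
    proof (intro exI[of _ "\<lambda>t. restrict (\<gamma> t) (verts Q)"] conjI allI ballI)
      show "restrict (\<gamma> t) (verts Q) \<in> configs Q" for t
        using restrict_Q[of "\<gamma> t"] \<gamma> c by metis
      show "(restrict_class Q \<circ> c) t = config_class Q (restrict (\<gamma> t) (verts Q))" for t
        unfolding comp_def \<gamma>(2) restrict_class_Q by (rule config_class_cong) simp
      show "smooth_curve (\<lambda>t. restrict (\<gamma> t) (verts Q) v)" if "v \<in> verts Q" for v
        using \<gamma>(3)[of v] that verts_L by simp
    qed
  next
    assume "reduced_smooth_curve Q (restrict_class Q \<circ> c)"
    then obtain \<delta> where \<delta>: "\<And>t. \<delta> t \<in> configs Q" "\<And>t. restrict_class Q (c t) = config_class Q (\<delta> t)"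
      "\<And>v. v \<in> verts Q \<Longrightarrow> smooth_curve (\<lambda>t. \<delta> t v)"
      unfolding reduced_smooth_curve_def comp_def by blast
    show "reduced_smooth_curve L c"
      unfolding reduced_smooth_curve_def
    proof (intro exI[of _ "\<lambda>t. extend (\<delta> t)"] conjI allI ballI)
      show "extend (\<delta> t) \<in> configs L" for t using extend_config \<delta>(1) by blast
      \<comment> \<open>Restriction is injective on the stratum, so the extended curve, which
        restricts to the same class of the polygon, must lie over \<open>c\<close>.\<close>
      show "c t = config_class L (extend (\<delta> t))" for t
      proof (rule inj_onD[OF inj _ c])
        show "restrict_class Q (c t) = restrict_class Q (config_class L (extend (\<delta> t)))"
          unfolding ext by (rule \<delta>(2))
      qed (rule conjunct2[OF extend_config[OF \<delta>(1)]])
      show "smooth_curve (\<lambda>t. extend (\<delta> t) v)" if v: "v \<in> verts L" for v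
      proof (cases "v \<in> inner_vertices n")
        case True
        define k where "k = (g v - g VI) / (g VT - g VI)"
        \<comment> \<open>The reinserted vertices are complex linear combinations of I and T with
          constant coefficients; hence smoothness is inherited.\<close>
        have "extend (\<delta> t) v = (\<delta> t VI + (- k) * \<delta> t VI) + k * \<delta> t VT" for t
          using True v by (simp add: extend_def rotation_def k_def divide_inverse algebra_simps)
        moreover have "smooth_curve (\<lambda>t. (\<delta> t VI + (- k) * \<delta> t VI) + k * \<delta> t VT)"
          by (intro smooth_curve_add_mult \<delta>(3) Q_mem)
        ultimately show ?thesis by simp
      next
        case False
        then have "v \<in> verts Q" using v verts_L verts_Gam Q_mem by auto
        then show ?thesis using \<delta>(3) by (simp add: extend_Q)
      qed
    qed
  qed
qed

end

section \<open>The derivative of the area\<close>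

definition cross :: "complex \<Rightarrow> complex \<Rightarrow> real" where
  "cross a b = Re a * Im b - Re b * Im a"

lemma cross_simps:
  "cross (a + b) c = cross a c + cross b c" "cross a (b + c) = cross a b + cross a c"
  "cross (a - b) c = cross a c - cross b c" "cross a (b - c) = cross a b - cross a c"
  "cross (- a) b = - cross a b" "cross a (- b) = - cross a b"
  "cross 0 a = 0" "cross a 0 = 0" "cross a a = 0"
  by (simp_all add: cross_def algebra_simps)

lemma cross_sum: "cross a (\<Sum>i\<in>I. f i) = (\<Sum>i\<in>I. cross a (f i))"
  by (induction I rule: infinite_finite_induct) (simp_all add: cross_simps)

lemma cross_swap: "cross a b = - cross b a"
  by (simp add: cross_def)

lemma cross_mult_left: "cross (w * a) (w * b) = (cmod w)\<^sup>2 * cross a b"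
  unfolding cmod_power2 by (simp add: cross_def algebra_simps power2_eq_square)

lemma cross_rotate: "cross m (of_real \<alpha> * (\<i> * u)) = \<alpha> * (m \<bullet> u)"
  by (simp add: cross_def inner_complex_def algebra_simps)

lemma cross_zero_if_orthogonal:
  assumes "a \<bullet> u = 0" "b \<bullet> u = 0" "u \<noteq> 0"
  shows "cross a b = 0"
proof -
  have *: "Re a * Re u + Im a * Im u = 0" "Re b * Re u + Im b * Im u = 0"
    using assms by (simp_all add: inner_complex_def)
  have "Re u * cross a b = Im b * (Re a * Re u + Im a * Im u) - Im a * (Re b * Re u + Im b * Im u)"
    "Im u * cross a b = Re a * (Re b * Re u + Im b * Im u) - Re b * (Re a * Re u + Im a * Im u)"
    by (simp_all add: cross_def algebra_simps)
  then have "Re u * cross a b = 0" "Im u * cross a b = 0" using * by simp_all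
  then show ?thesis using assms(3) by (auto simp: complex_eq_iff)
qed

text \<open>Both chains are traversed from I to T on the right-hand side; as the cycle runs through
  B backwards, B contributes with a minus sign.\<close>

lemma oriented_area_Gamma:
  assumes "n ChA \<ge> 1" "n ChB \<ge> 1"
  shows "oriented_area (map x (Gamma_vertices n)) =
    ((\<Sum>i<n ChA. cross (x (chain_vertex n ChA i)) (x (chain_vertex n ChA (Suc i)))) -
     (\<Sum>i<n ChB. cross (x (chain_vertex n ChB i)) (x (chain_vertex n ChB (Suc i))))) / 2"
proof -
  define p q where "p = n ChA" and "q = n ChB"
  have pq: "p \<ge> 1" "q \<ge> 1" using assms by (simp_all add: p_def q_def)
  define a b where "a i = x (chain_vertex n ChA i)" and "b i = x (chain_vertex n ChB i)" for i
  have ends: "a 0 = b 0" "a p = b q" using assms by (simp_all add: a_def b_def p_def q_def)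
  \<comment> \<open>The vertices of the cycle as one sequence with indices from 0 to
    \<open>p + q\<close>; the last one is I again, which replaces the index modulo the
    length.\<close>
  define F where "F i = (if i \<le> p then a i else b (q - (i - p)))" for i
  let ?l = "map x (Gamma_vertices n)"
  have len: "length ?l = p + q" by (simp add: Gamma_vertices_def p_def q_def)
  have nth: "?l ! i = F i" if "i < p + q" for i
    using that ends(2)
    by (auto simp: Gamma_vertices_def nth_append F_def p_def[symmetric] q_def[symmetric] a_def b_def)
  have nth': "?l ! (Suc i mod (p + q)) = F (Suc i)" if "i < p + q" for i
  proof (cases "Suc i = p + q")
    case True
    then show ?thesis using nth[of 0] pq ends(1) by (simp add: F_def)
  next
    case False
    then show ?thesis using nth[of "Suc i"] that by simp
  qed
  have "oriented_area ?l = (\<Sum>i<p + q. cross (F i) (F (Suc i))) / 2"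
    unfolding oriented_area_def len Let_def cross_def
    by (intro arg_cong2[where f = "(/)"] sum.cong refl) (auto simp: nth nth')
  also have "(\<Sum>i<p + q. cross (F i) (F (Suc i))) =
      (\<Sum>i<p. cross (F i) (F (Suc i))) + (\<Sum>i=p..<p + q. cross (F i) (F (Suc i)))"
    unfolding lessThan_atLeast0 by (simp add: sum.atLeastLessThan_concat)
  also have "(\<Sum>i<p. cross (F i) (F (Suc i))) = (\<Sum>i<p. cross (a i) (a (Suc i)))"
    by (intro sum.cong) (auto simp: F_def)
  also have "(\<Sum>i=p..<p + q. cross (F i) (F (Suc i))) = (\<Sum>i<q. cross (F (i + p)) (F (Suc (i + p))))"
    using sum.shift_bounds_nat_ivl[of "\<lambda>i. cross (F i) (F (Suc i))" 0 p q]
    by (simp add: lessThan_atLeast0 add.commute)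
  also have "\<dots> = (\<Sum>i<q. - cross (b (q - Suc i)) (b (Suc (q - Suc i))))"
  proof (intro sum.cong refl)
    fix i assume "i \<in> {..<q}"
    then have "F (i + p) = b (Suc (q - Suc i))" "F (Suc (i + p)) = b (q - Suc i)"
      using ends(2) by (auto simp: F_def Suc_diff_Suc)
    then show "cross (F (i + p)) (F (Suc (i + p))) = - cross (b (q - Suc i)) (b (Suc (q - Suc i)))"
      by (simp add: cross_swap[of "b (q - Suc i)"])
  qed
  also have "\<dots> = - (\<Sum>i<q. cross (b i) (b (Suc i)))"
    using sum.nat_diff_reindex[of "\<lambda>i. - cross (b i) (b (Suc i))" q] by (simp add: sum_negf)
  finally show ?thesis by (simp add: a_def b_def p_def q_def)
qed

text \<open>The translation contributes only a boundary term in the end points. It is the same for A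
  and B and cancels in the area.\<close>

lemma sum_cross_congruent:
  fixes z :: "nat \<Rightarrow> complex"
  assumes "cmod w = 1"
  shows "(\<Sum>i<N. cross (w * z i + t) (w * z (Suc i) + t)) =
    (\<Sum>i<N. cross (z i) (z (Suc i))) + cross t (w * z N - w * z 0)"
proof -
  have "cross (w * z i + t) (w * z (Suc i) + t) = cross (z i) (z (Suc i)) + cross t (w * z (Suc i) - w * z i)" for i
    using cross_mult_left[of w "z i" "z (Suc i)"] assms cross_swap[of "w * z i" t] by (simp add: cross_simps)
  then show ?thesis
    using sum_lessThan_telescope[of "\<lambda>i. w * z i" N] by (simp add: sum.distrib flip: cross_sum)
qed

lemma Gamma_area_config_class:
  assumes pos: "\<And>\<kappa>. n \<kappa> \<ge> 1"
  shows "Gamma_area n (config_class (three_chain n len) x) = oriented_area (map x (Gamma_vertices n))"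
proof -
  let ?L = "three_chain n len"
  have "oriented_area (map y (Gamma_vertices n)) = oriented_area (map x (Gamma_vertices n))"
    if y: "y \<in> config_class ?L x" for y
  proof -
    obtain w t where w: "cmod w = 1" "y = (\<lambda>v\<in>verts ?L. w * x v + t)"
      using y mem_config_class by blast
    have yv: "y (chain_vertex n \<kappa> i) = w * x (chain_vertex n \<kappa> i) + t" if "i \<le> n \<kappa>" for \<kappa> i
      using chain_vertex_in_verts[of n i \<kappa> len, OF pos that] w(2) by simp
    have "(\<Sum>i<n \<kappa>. cross (y (chain_vertex n \<kappa> i)) (y (chain_vertex n \<kappa> (Suc i)))) =
        (\<Sum>i<n \<kappa>. cross (x (chain_vertex n \<kappa> i)) (x (chain_vertex n \<kappa> (Suc i)))) +
        cross t (w * x VT - w * x VI)" for \<kappa>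
      using sum_cross_congruent[OF w(1), of "\<lambda>i. x (chain_vertex n \<kappa> i)" t "n \<kappa>"] pos[of \<kappa>]
      by (simp add: yv)
    then show ?thesis unfolding oriented_area_Gamma[of n, OF pos pos] by simp
  qed
  then have "(\<lambda>y. oriented_area (map y (Gamma_vertices n))) ` config_class ?L x =
      (\<lambda>y. oriented_area (map x (Gamma_vertices n))) ` config_class ?L x"
    by (intro image_cong refl)
  moreover have "(\<lambda>v\<in>verts ?L. 1 * x v + 0) \<in> config_class ?L x"
    unfolding mem_config_class by (intro exI[of _ 1] exI[of _ 0]) simp
  then have "config_class ?L x \<noteq> {}" by blast
  ultimately have "(\<lambda>y. oriented_area (map y (Gamma_vertices n))) ` config_class ?L x =
      {oriented_area (map x (Gamma_vertices n))}" by (simp add: image_constant_conv)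
  then show ?thesis by (simp add: Gamma_area_def)
qed

section \<open>Differentiating the area along a motion\<close>

lemma has_real_derivative_cross:
  assumes "(f has_vector_derivative f') (at t)" "(g has_vector_derivative g') (at t)"
  shows "((\<lambda>t. cross (f t) (g t)) has_real_derivative cross f' (g t) + cross (f t) g') (at t)"
proof -
  note * = assms[unfolded has_vector_derivative_complex_iff]
  show ?thesis
    unfolding cross_def
    using * by (intro DERIV_cong[OF DERIV_diff[OF DERIV_mult DERIV_mult]]) (auto simp: algebra_simps)
qed

text \<open>Summation by parts: the derivative is rewritten with edge velocities only, at the cost
  of a boundary term at I and T that is common to A and B.\<close>

lemma sum_cross_derivative:
  fixes z z' :: "nat \<Rightarrow> complex"
  shows "(\<Sum>i<N. cross (z' i) (z (Suc i)) + cross (z i) (z' (Suc i))) =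
    2 * (\<Sum>i<N. cross ((z i + z (Suc i)) / 2) (z' (Suc i) - z' i)) - (cross (z N) (z' N) - cross (z 0) (z' 0))"
proof -
  have "cross (z' i) (z (Suc i)) + cross (z i) (z' (Suc i)) =
      2 * cross ((z i + z (Suc i)) / 2) (z' (Suc i) - z' i) - (cross (z (Suc i)) (z' (Suc i)) - cross (z i) (z' i))" for i
    by (simp add: cross_def field_simps)
  then show ?thesis
    using sum_lessThan_telescope[of "\<lambda>i. cross (z i) (z' i)" N]
    by (simp add: sum_subtractf sum_distrib_left)
qed

definition edge_mid :: "(chain \<Rightarrow> nat) \<Rightarrow> (vertex \<Rightarrow> complex) \<Rightarrow> chain \<times> nat \<Rightarrow> complex" where
  "edge_mid n x e = (x (chain_vertex n (fst e) (snd e)) + x (chain_vertex n (fst e) (Suc (snd e)))) / 2"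

lemma Gamma_area_derivative:
  assumes pos: "\<And>\<kappa>. n \<kappa> \<ge> 1"
    and D: "\<And>v. v \<in> verts (three_chain n len) \<Longrightarrow> ((\<lambda>t. \<gamma> t v) has_vector_derivative D v) (at 0)"
  shows "((\<lambda>t. Gamma_area n (config_class (three_chain n len) (\<gamma> t))) has_real_derivative
    (\<Sum>i<n ChA. cross (edge_mid n (\<gamma> 0) (ChA, i)) (edge_vec n D (ChA, i))) -
    (\<Sum>i<n ChB. cross (edge_mid n (\<gamma> 0) (ChB, i)) (edge_vec n D (ChB, i)))) (at 0)"
proof -
  define C where "C \<kappa> x = (\<Sum>i<n \<kappa>. cross (x (chain_vertex n \<kappa> i)) (x (chain_vertex n \<kappa> (Suc i))))" for \<kappa> x
  define C' where "C' \<kappa> = 2 * (\<Sum>i<n \<kappa>. cross (edge_mid n (\<gamma> 0) (\<kappa>, i)) (edge_vec n D (\<kappa>, i))) -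
      (cross (\<gamma> 0 VT) (D VT) - cross (\<gamma> 0 VI) (D VI))" for \<kappa>
  have Dc: "((\<lambda>t. \<gamma> t (chain_vertex n \<kappa> i)) has_vector_derivative D (chain_vertex n \<kappa> i)) (at 0)"
    if "i \<le> n \<kappa>" for \<kappa> i
    using D chain_vertex_in_verts[of n i \<kappa> len, OF pos that] by blast
  have "((\<lambda>t. C \<kappa> (\<gamma> t)) has_real_derivative C' \<kappa>) (at 0)" for \<kappa>
  proof -
    have "((\<lambda>t. C \<kappa> (\<gamma> t)) has_real_derivative
       (\<Sum>i<n \<kappa>. cross (D (chain_vertex n \<kappa> i)) (\<gamma> 0 (chain_vertex n \<kappa> (Suc i))) +
         cross (\<gamma> 0 (chain_vertex n \<kappa> i)) (D (chain_vertex n \<kappa> (Suc i))))) (at 0)"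
      unfolding C_def by (intro DERIV_sum has_real_derivative_cross Dc) auto
    then show ?thesis
      unfolding sum_cross_derivative[of "\<lambda>i. D (chain_vertex n \<kappa> i)" "\<lambda>i. \<gamma> 0 (chain_vertex n \<kappa> i)"]
      using pos[of \<kappa>] by (simp add: C'_def edge_mid_def edge_vec_def)
  qed
  then have "((\<lambda>t. (C ChA (\<gamma> t) - C ChB (\<gamma> t)) / 2) has_real_derivative (C' ChA - C' ChB) / 2) (at 0)"
    by (intro DERIV_cdivide DERIV_diff)
  moreover have "(C' ChA - C' ChB) / 2 =
      (\<Sum>i<n ChA. cross (edge_mid n (\<gamma> 0) (ChA, i)) (edge_vec n D (ChA, i))) -
      (\<Sum>i<n ChB. cross (edge_mid n (\<gamma> 0) (ChB, i)) (edge_vec n D (ChB, i)))"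
    by (simp add: C'_def)
  ultimately show ?thesis
    unfolding Gamma_area_config_class[of n, OF pos] oriented_area_Gamma[of n, OF pos pos] C_def by simp
qed

section \<open>Circumcentres and the sufficient condition for criticality\<close>

lemma equidistant_iff_midpoint: "cmod (a - c) = cmod (b - c) \<longleftrightarrow> ((a + b) / 2 - c) \<bullet> (b - a) = 0"
proof -
  have "cmod (a - c) = cmod (b - c) \<longleftrightarrow> (cmod (a - c))\<^sup>2 = (cmod (b - c))\<^sup>2"
    by (simp add: power2_eq_iff_nonneg)
  also have "\<dots> \<longleftrightarrow> (cmod (b - c))\<^sup>2 - (cmod (a - c))\<^sup>2 = 0" by auto
  also have "(cmod (b - c))\<^sup>2 - (cmod (a - c))\<^sup>2 = 2 * (((a + b) / 2 - c) \<bullet> (b - a))"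
    unfolding cmod_power2 by (simp add: inner_complex_def field_simps power2_eq_square)
  finally show ?thesis by simp
qed

lemma edge_velocity_orthogonal:
  assumes "\<And>t. cmod (f t) = l" "(f has_vector_derivative f') (at (0::real))"
  shows "f' \<bullet> f 0 = 0"
proof -
  have "((\<lambda>t. f t \<bullet> f t) has_vector_derivative (f 0 \<bullet> f' + f' \<bullet> f 0)) (at 0)"
    using bounded_bilinear.has_vector_derivative[OF bounded_bilinear_inner assms(2) assms(2)] by simp
  moreover have "(\<lambda>t. f t \<bullet> f t) = (\<lambda>t. l\<^sup>2)" using assms(1) by (simp add: power2_norm_eq_inner[symmetric])
  moreover have "((\<lambda>t. l\<^sup>2) has_vector_derivative 0) (at (0::real))" by simp
  ultimately have "f 0 \<bullet> f' + f' \<bullet> f 0 = 0" using vector_derivative_unique_at by metis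
  then show ?thesis by (simp add: inner_commute)
qed

text \<open>The radius is measured at I, which lies on all chains, so a common centre of A and B
  automatically gives a common circle. A positive radius is not demanded; it follows from the first
  edge being non-zero.\<close>

definition centre :: "(chain \<Rightarrow> nat) \<Rightarrow> (vertex \<Rightarrow> complex) \<Rightarrow> chain \<Rightarrow> complex \<Rightarrow> bool" where
  "centre n x \<kappa> c \<longleftrightarrow> (\<forall>i\<le>n \<kappa>. cmod (x (chain_vertex n \<kappa> i) - c) = cmod (x VI - c))"

lemma centre_iff_midpoints:
  "centre n x \<kappa> c \<longleftrightarrow> (\<forall>i<n \<kappa>. (edge_mid n x (\<kappa>, i) - c) \<bullet> edge_vec n x (\<kappa>, i) = 0)"
proof -
  have "centre n x \<kappa> c \<longleftrightarrow>
      (\<forall>i<n \<kappa>. cmod (x (chain_vertex n \<kappa> i) - c) = cmod (x (chain_vertex n \<kappa> (Suc i)) - c))"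
  proof
    assume r: "\<forall>i<n \<kappa>. cmod (x (chain_vertex n \<kappa> i) - c) = cmod (x (chain_vertex n \<kappa> (Suc i)) - c)"
    have "i \<le> n \<kappa> \<Longrightarrow> cmod (x (chain_vertex n \<kappa> i) - c) = cmod (x VI - c)" for i
      using r by (induction i) auto
    then show "centre n x \<kappa> c" by (simp add: centre_def)
  next
    assume "centre n x \<kappa> c"
    then show "\<forall>i<n \<kappa>. cmod (x (chain_vertex n \<kappa> i) - c) = cmod (x (chain_vertex n \<kappa> (Suc i)) - c)"
      unfolding centre_def by (metis Suc_leI less_imp_le)
  qed
  then show ?thesis unfolding equidistant_iff_midpoint by (simp add: edge_mid_def edge_vec_def)
qed

lemma centre_circumscribed:
  assumes "n \<kappa> \<ge> 1" "centre n x \<kappa> c" "edge_vec n x (\<kappa>, 0) \<noteq> 0"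
  shows "circumscribed (open_chain n len \<kappa>) x (sphere c (cmod (x VI - c)))" "cmod (x VI - c) > 0"
proof -
  have on: "cmod (x (chain_vertex n \<kappa> i) - c) = cmod (x VI - c)" if "i \<le> n \<kappa>" for i
    using assms(2) that by (simp add: centre_def)
  show r: "cmod (x VI - c) > 0"
  proof (rule ccontr)
    assume "\<not> cmod (x VI - c) > 0"
    then have "x (chain_vertex n \<kappa> i) = c" if "i \<le> n \<kappa>" for i using on[OF that] by simp
    then have "edge_vec n x (\<kappa>, 0) = 0"
      using assms(1) \<open>\<not> cmod (x VI - c) > 0\<close> by (simp add: edge_vec_def)
    then show False using assms(3) by simp
  qed
  show "circumscribed (open_chain n len \<kappa>) x (sphere c (cmod (x VI - c)))"
    unfolding circumscribed_def verts_open_chain[of n \<kappa>, OF assms(1)]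
    using r on by (intro conjI exI[of _ c] exI[of _ "cmod (x VI - c)"]) (auto simp: dist_norm norm_minus_commute)
qed

lemma circumscribed_centre:
  assumes "circumscribed L x C"
  obtains c where "\<And>\<kappa>. n \<kappa> \<ge> 1 \<Longrightarrow> verts (open_chain n len \<kappa>) \<subseteq> verts L \<Longrightarrow> centre n x \<kappa> c"
proof -
  obtain c r where c: "C = sphere c r" "x ` verts L \<subseteq> C"
    using assms unfolding circumscribed_def by blast
  have "centre n x \<kappa> c" if \<kappa>: "n \<kappa> \<ge> 1" "verts (open_chain n len \<kappa>) \<subseteq> verts L" for \<kappa>
  proof -
    have "dist c (x (chain_vertex n \<kappa> i)) = r" if "i \<le> n \<kappa>" for i
    proof -
      have "chain_vertex n \<kappa> i \<in> verts L"
        using that \<kappa>(2) unfolding verts_open_chain[of n \<kappa>, OF \<kappa>(1)] by blast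
      then show ?thesis using c by auto
    qed
    from this this[of 0] show ?thesis by (simp add: centre_def dist_norm norm_minus_commute)
  qed
  then show ?thesis by (rule that)
qed

text \<open>For a chain with centre \<open>c\<close> the area term collapses to
  \<open>cross c (D VT - D VI)\<close>, so the derivative is the cross product of the difference of
  the two centres with the relative velocity of the ends. For the circular type the difference is
  zero; for the aligned type both vectors are orthogonal to the line of Z.\<close>

lemma critical_if_type:
  assumes pos: "\<And>\<kappa>. n \<kappa> \<ge> 1" and gen: "generic_lengths n len"
    and \<xi>: "\<xi> \<in> reduced_configs (three_chain n len)"
    and type: "circular_type n len \<xi> \<or> aligned_type n len \<xi>"
  shows "critical_point (three_chain n len) (Gamma_area n) \<xi>"
  unfolding critical_point_def
proof (intro conjI allI impI)
  let ?L = "three_chain n len"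
  fix \<gamma> assume "(\<forall>t::real. \<gamma> t \<in> configs ?L) \<and> config_class ?L (\<gamma> 0) = \<xi> \<and>
      (\<forall>v\<in>verts ?L. (\<lambda>t. \<gamma> t v) differentiable at 0)"
  then have \<gamma>: "\<And>t. \<gamma> t \<in> configs ?L" "config_class ?L (\<gamma> 0) = \<xi>"
    "\<And>v. v \<in> verts ?L \<Longrightarrow> (\<lambda>t. \<gamma> t v) differentiable at 0" by blast+
  define D where "D v = vector_derivative (\<lambda>t. \<gamma> t v) (at 0)" for v
  have D: "((\<lambda>t. \<gamma> t v) has_vector_derivative D v) (at 0)" if "v \<in> verts ?L" for v
    using \<gamma>(3)[OF that] unfolding D_def by (simp add: vector_derivative_works)
  define x where "x = \<gamma> 0"
  have x: "x \<in> \<xi>" using config_class_self[OF \<gamma>(1)[of 0]] \<gamma>(2) by (simp add: x_def)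
  have len: "cmod (edge_vec n (\<gamma> t) (\<kappa>, i)) = len (\<kappa>, i)" if "i < n \<kappa>" for t \<kappa> i
    using \<gamma>(1)[of t] that by (auto simp: configs_three_chain_iff edge_indices_def)
  have nz: "edge_vec n x (\<kappa>, i) \<noteq> 0" if "i < n \<kappa>" for \<kappa> i
    using len[OF that, of 0] generic_lengths_pos[OF gen that] by (auto simp: x_def)
  have orth: "edge_vec n D (\<kappa>, i) \<bullet> edge_vec n x (\<kappa>, i) = 0" if i: "i < n \<kappa>" for \<kappa> i
  proof -
    have "((\<lambda>t. edge_vec n (\<gamma> t) (\<kappa>, i)) has_vector_derivative edge_vec n D (\<kappa>, i)) (at 0)"
      unfolding edge_vec_def fst_conv snd_conv
      using i by (intro has_vector_derivative_diff D chain_vertex_in_verts pos) auto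
    from edge_velocity_orthogonal[OF len[OF i] this] show ?thesis by (simp add: x_def)
  qed
  \<comment> \<open>Relative to the centre, the midpoint of an edge is orthogonal to the edge, and
    so is the velocity of the edge vector; in the plane they are parallel and their cross product
    vanishes.\<close>
  have cA: "(\<Sum>i<n \<kappa>. cross (edge_mid n x (\<kappa>, i)) (edge_vec n D (\<kappa>, i))) = cross c (D VT - D VI)"
    if c: "centre n x \<kappa> c" for \<kappa> c
  proof -
    have "cross (edge_mid n x (\<kappa>, i)) (edge_vec n D (\<kappa>, i)) = cross c (edge_vec n D (\<kappa>, i))" if "i < n \<kappa>" for i
      using cross_zero_if_orthogonal[OF _ orth[OF that] nz[OF that], of "edge_mid n x (\<kappa>, i) - c"]
        c[unfolded centre_iff_midpoints] that by (simp add: cross_simps)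
    then have "(\<Sum>i<n \<kappa>. cross (edge_mid n x (\<kappa>, i)) (edge_vec n D (\<kappa>, i))) = (\<Sum>i<n \<kappa>. cross c (edge_vec n D (\<kappa>, i)))"
      by simp
    also have "\<dots> = cross c (D VT - D VI)"
      using sum_edge_vec[of n \<kappa> D, OF pos] by (simp flip: cross_sum)
    finally show ?thesis .
  qed
  have "(\<Sum>i<n ChA. cross (edge_mid n x (ChA, i)) (edge_vec n D (ChA, i))) -
      (\<Sum>i<n ChB. cross (edge_mid n x (ChB, i)) (edge_vec n D (ChB, i))) = 0"
    using type
  proof
    assume "circular_type n len \<xi>"
    then obtain C where C: "circumscribed (two_chain_cycle n len ChA ChB) x C"
      using x unfolding circular_type_def cyclic_def by blast
    obtain c where c: "\<And>\<kappa>. n \<kappa> \<ge> 1 \<Longrightarrow>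
        verts (open_chain n len \<kappa>) \<subseteq> verts (two_chain_cycle n len ChA ChB) \<Longrightarrow> centre n x \<kappa> c"
      using circumscribed_centre[OF C] by blast
    have "centre n x ChA c" "centre n x ChB c"
      by (rule c[OF pos]; simp add: two_chain_cycle_def verts_Un)+
    then show ?thesis using cA by simp
  next
    assume al: "aligned_type n len \<xi>"
    then have Z: "straight n x ChZ"
      using x pos by (simp add: aligned_type_def aligned_iff_straight)
    obtain C where C: "circumscribed (open_chain n len ChA) x C"
      using x al unfolding aligned_type_def cyclic_def by blast
    obtain c where c: "centre n x ChA c"
      using circumscribed_centre[OF C, of n len] pos by blast
    obtain C' where C': "circumscribed (open_chain n len ChB) x C'"
      using x al unfolding aligned_type_def cyclic_def by blast
    obtain c' where c': "centre n x ChB c'"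
      using circumscribed_centre[OF C', of n len] pos by blast
    have lenx: "cmod (edge_vec n x (\<kappa>, i)) = len (\<kappa>, i)" if "i < n \<kappa>" for \<kappa> i
      using len[OF that] by (simp add: x_def)
    \<comment> \<open>Both centres lie on the perpendicular bisector of IT; only for distinct end
      points does this make their difference orthogonal to the direction of Z.\<close>
    have IT: "x VI \<noteq> x VT"
      using straight_ends_distinct[of n len x ChZ, OF pos gen Z] lenx by blast
    have IT_c: "((x VI + x VT) / 2 - c) \<bullet> (x VT - x VI) = 0" if "centre n x \<kappa> c" for \<kappa> c
      using that pos[of \<kappa>] unfolding equidistant_iff_midpoint[symmetric] centre_def
      by (metis chain_vertex_end order_refl)
    obtain d s where d: "cmod d = 1" "\<And>i. i < n ChZ \<Longrightarrow> edge_vec n x (ChZ, i) = of_real (s i) * d"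
      using Z unfolding straight_def by metis
    have ITd: "x VT - x VI = of_real (\<Sum>i<n ChZ. s i) * d"
      using d(2) sum_edge_vec[of n ChZ x, OF pos] by (simp add: sum_distrib_right)
    have "edge_vec n D (ChZ, i) \<bullet> d = 0" if i: "i < n ChZ" for i
    proof -
      have "s i * (edge_vec n D (ChZ, i) \<bullet> d) = 0"
        using orth[OF i] d(2)[OF i] by (simp flip: scaleR_conv_of_real)
      moreover have "s i \<noteq> 0" using nz[OF i] d(2)[OF i] by auto
      ultimately show ?thesis by simp
    qed
    then have D': "(D VT - D VI) \<bullet> d = 0"
      unfolding sum_edge_vec[of n ChZ D, OF pos, symmetric] by (simp add: inner_sum_left)
    have "(c - c') \<bullet> (x VT - x VI) = 0"
      using IT_c[OF c] IT_c[OF c'] by (simp add: inner_diff_left)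
    moreover have "(\<Sum>i<n ChZ. s i) \<noteq> 0" using ITd IT by (auto simp del: of_real_sum)
    ultimately have "(c - c') \<bullet> d = 0"
      unfolding ITd by (simp del: of_real_sum flip: scaleR_conv_of_real)
    with D' d(1) have "cross (c - c') (D VT - D VI) = 0"
      by (intro cross_zero_if_orthogonal[of _ d]) auto
    then show ?thesis using cA[OF c] cA[OF c'] by (simp add: cross_simps)
  qed
  then show "((\<lambda>t. Gamma_area n (config_class ?L (\<gamma> t))) has_real_derivative 0) (at 0)"
    using Gamma_area_derivative[of n len \<gamma> D, OF pos D] by (simp add: x_def)
qed (rule \<xi>)

section \<open>Realizing infinitesimal motions\<close>

text \<open>The existence of Lagrange multipliers. If the last functional vanishes on the common
  kernel of the others, it is redundant; otherwise a vector \<open>\<beta>\<close> of that kernel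
  detects it and fixes its coefficient as a quotient.\<close>

lemma functional_duality:
  fixes f :: "nat \<Rightarrow> 'e \<Rightarrow> real" and g :: "'e \<Rightarrow> real"
  assumes "finite E"
    and "\<And>\<alpha>. (\<And>m. m < M \<Longrightarrow> (\<Sum>e\<in>E. f m e * \<alpha> e) = 0) \<Longrightarrow> (\<Sum>e\<in>E. g e * \<alpha> e) = 0"
  shows "\<exists>c. \<forall>e\<in>E. g e = (\<Sum>m<M. c m * f m e)"
  using assms(2)
proof (induction M arbitrary: g)
  case 0
  \<comment> \<open>With no constraints \<open>g\<close> may be tested against itself.\<close>
  have "(\<Sum>e\<in>E. g e * g e) = 0" by (rule 0) simp
  then show ?case using sum_nonneg_eq_0_iff[OF assms(1), of "\<lambda>e. g e * g e"] by auto
next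
  case (Suc M)
  let ?K = "\<lambda>\<alpha>. \<forall>m<M. (\<Sum>e\<in>E. f m e * \<alpha> e) = 0"
  show ?case
  proof (cases "\<forall>\<alpha>. ?K \<alpha> \<longrightarrow> (\<Sum>e\<in>E. f M e * \<alpha> e) = 0")
    case True
    have "\<exists>c. \<forall>e\<in>E. g e = (\<Sum>m<M. c m * f m e)"
    proof (rule Suc.IH)
      fix \<alpha> assume "\<And>m. m < M \<Longrightarrow> (\<Sum>e\<in>E. f m e * \<alpha> e) = 0"
      with True show "(\<Sum>e\<in>E. g e * \<alpha> e) = 0" by (intro Suc.prems) (auto simp: less_Suc_eq)
    qed
    then obtain c where "\<forall>e\<in>E. g e = (\<Sum>m<M. c m * f m e)" by blast
    then show ?thesis by (intro exI[of _ "c(M := 0)"]) simp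
  next
    case False
    then obtain \<beta> where \<beta>: "?K \<beta>" "(\<Sum>e\<in>E. f M e * \<beta> e) \<noteq> 0" by blast
    define k where "k = (\<Sum>e\<in>E. g e * \<beta> e) / (\<Sum>e\<in>E. f M e * \<beta> e)"
    have "\<exists>c. \<forall>e\<in>E. g e - k * f M e = (\<Sum>m<M. c m * f m e)"
    proof (rule Suc.IH)
      fix \<alpha> assume \<alpha>: "\<And>m. m < M \<Longrightarrow> (\<Sum>e\<in>E. f m e * \<alpha> e) = 0"
      define r where "r = (\<Sum>e\<in>E. f M e * \<alpha> e) / (\<Sum>e\<in>E. f M e * \<beta> e)"
      have lin: "(\<Sum>e\<in>E. h e * (\<alpha> e - r * \<beta> e)) = (\<Sum>e\<in>E. h e * \<alpha> e) - r * (\<Sum>e\<in>E. h e * \<beta> e)" for h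
        by (simp add: right_diff_distrib sum_subtractf sum_distrib_left mult.left_commute)
      have "(\<Sum>e\<in>E. g e * (\<alpha> e - r * \<beta> e)) = 0"
      proof (rule Suc.prems)
        show "(\<Sum>e\<in>E. f m e * (\<alpha> e - r * \<beta> e)) = 0" if "m < Suc M" for m
          unfolding lin using that \<alpha> \<beta> by (cases "m = M") (simp_all add: r_def)
      qed
      then have "(\<Sum>e\<in>E. g e * \<alpha> e) = k * (\<Sum>e\<in>E. f M e * \<alpha> e)"
        unfolding lin by (simp add: r_def k_def)
      then show "(\<Sum>e\<in>E. (g e - k * f M e) * \<alpha> e) = 0"
        by (simp add: left_diff_distrib sum_subtractf sum_distrib_left mult.assoc)
    qed
    then obtain c where "\<forall>e\<in>E. g e - k * f M e = (\<Sum>m<M. c m * f m e)" by blast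
    then show ?thesis by (intro exI[of _ "c(M := k)"]) (auto simp: algebra_simps)
  qed
qed

lemma orthogonal_to_independent:
  assumes "z \<bullet> u = 0" "z \<bullet> v = 0" "cross u v \<noteq> 0"
  shows "z = 0"
  using cross_zero_if_orthogonal[of u z v] assms by (auto simp: inner_commute)

lemma orthogonal_multiple:
  assumes "z \<noteq> 0" "z \<bullet> y = 0"
  shows "\<exists>s. y = of_real s * (\<i> * sgn z)"
proof -
  define r where "r = cross z y"
  have "y * cnj z = of_real r * \<i>"
    using assms(2) by (simp add: r_def complex_eq_iff cross_def inner_complex_def mult.commute)
  then have "y * (z * cnj z) = of_real r * \<i> * z" by (simp add: mult.left_commute mult.commute)
  moreover have "z * cnj z = (of_real (cmod z))\<^sup>2" using complex_norm_square[of z] by simp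
  moreover have "z = of_real (cmod z) * sgn z" using assms(1) by (simp add: sgn_eq)
  ultimately have "y * (of_real (cmod z))\<^sup>2 = of_real r * \<i> * (of_real (cmod z) * sgn z)" by simp
  then have "of_real (cmod z) * (y * of_real (cmod z)) = of_real (cmod z) * (of_real r * (\<i> * sgn z))"
    by (simp only: power2_eq_square mult_ac)
  then have "y * of_real (cmod z) = of_real r * (\<i> * sgn z)"
    using assms(1) by (simp only: mult_cancel_left of_real_eq_0_iff norm_eq_zero) simp
  then have "y = of_real (r / cmod z) * (\<i> * sgn z)"
    using assms(1) by (simp add: nonzero_eq_divide_eq[symmetric])
  then show ?thesis by blast
qed

section \<open>Motions of single chains\<close>

lemma has_vector_derivative_rotation:
  "((\<lambda>t. u * cis (a * t)) has_vector_derivative of_real a * (\<i> * u)) (at 0)"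
  unfolding has_vector_derivative_complex_iff by (auto intro!: derivative_eq_intros)

text \<open>The position of the middle joint of a two-bar linkage is given by the law of cosines.\<close>

lemma two_bar_motion:
  fixes w :: "real \<Rightarrow> complex"
  assumes ind: "cross u v \<noteq> 0" and w: "w 0 = u + v"
    and w': "(w has_vector_derivative (of_real a * (\<i> * u) + of_real b * (\<i> * v))) (at 0)"
  obtains \<epsilon> U V where "\<epsilon> > 0" "U 0 = u" "V 0 = v"
    "\<And>t. \<bar>t\<bar> < \<epsilon> \<Longrightarrow> cmod (U t) = cmod u \<and> cmod (V t) = cmod v \<and> U t + V t = w t"
    "(U has_vector_derivative (of_real a * (\<i> * u))) (at 0)"
    "(V has_vector_derivative (of_real b * (\<i> * v))) (at 0)"
proof -
  define W where "W t = (Re (w t))\<^sup>2 + (Im (w t))\<^sup>2" for t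
  have Wn: "W t = (cmod (w t))\<^sup>2" for t by (simp add: W_def cmod_power2)
  \<comment> \<open>The first bar in units of the total vector. That the bars are not parallel means
    \<open>Im z \<noteq> 0\<close>, which keeps the square root below away from its singularity at
    0.\<close>
  define z where "z = u / w 0"
  have w0: "w 0 \<noteq> 0"
  proof
    assume "w 0 = 0"
    then have "v = - u" using w by (simp add: add_eq_0_iff)
    then show False using ind by (simp add: cross_simps)
  qed
  then have W0: "W 0 > 0" by (simp add: Wn)
  have uz: "u = w 0 * z" and vz: "v = w 0 * (1 - z)"
    using w0 w by (simp_all add: z_def field_simps)
  have Imz: "Im z \<noteq> 0"
  proof
    assume "Im z = 0"
    then have "cross u v = 0"
      unfolding uz vz cross_mult_left by (simp add: cross_def algebra_simps)
    then show False using ind by simp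
  qed
  define l where "l = (cmod u)\<^sup>2"
  define k where "k = (cmod v)\<^sup>2"
  have l: "l = W 0 * ((Re z)\<^sup>2 + (Im z)\<^sup>2)"
    unfolding l_def uz Wn by (simp add: norm_mult power_mult_distrib cmod_power2)
  have k: "k = W 0 * ((1 - Re z)\<^sup>2 + (Im z)\<^sup>2)"
    unfolding k_def vz Wn by (simp add: norm_mult power_mult_distrib cmod_power2)
  \<comment> \<open>Writing the first bar as \<open>w t\<close> times a complex number, the two
    length conditions force the real part \<open>A t\<close> and the squared imaginary part
    \<open>B t\<close> of that number.\<close>
  define A where "A t = (l + W t - k) / (2 * W t)" for t
  define B where "B t = l / W t - (A t)\<^sup>2" for t
  \<comment> \<open>Keeps the joint on the side of the diagonal where it starts.\<close>
  define \<sigma> :: real where "\<sigma> = (if Im z > 0 then 1 else -1)"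
  define U where "U t = w t * Complex (A t) (\<sigma> * sqrt (B t))" for t
  define V where "V t = w t - U t" for t
  have A0: "A 0 = Re z" unfolding A_def l k using W0 by (simp add: field_simps power2_eq_square)
  have B0: "B 0 = (Im z)\<^sup>2" unfolding B_def A0 l using W0 by simp
  have U0: "U 0 = u"
    unfolding U_def A0 B0 uz using Imz by (auto simp: \<sigma>_def complex_eq_iff)
  then have V0: "V 0 = v" by (simp add: V_def w)
  have "((\<lambda>t. Re (w t)) has_real_derivative Re (of_real a * (\<i> * u) + of_real b * (\<i> * v))) (at 0)"
    "((\<lambda>t. Im (w t)) has_real_derivative Im (of_real a * (\<i> * u) + of_real b * (\<i> * v))) (at 0)"
    using w' unfolding has_vector_derivative_complex_iff by blast+
  then obtain W' where dW: "(W has_real_derivative W') (at 0)"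
    unfolding W_def using DERIV_add[OF DERIV_power DERIV_power] by blast
  have "\<exists>A'. (A has_real_derivative A') (at 0)"
  proof -
    have "(A has_real_derivative (W' * (2 * W 0) - (l + W 0 - k) * (2 * W')) / (2 * W 0 * (2 * W 0))) (at 0)"
      unfolding A_def using W0 by (auto intro!: derivative_eq_intros dW)
    then show ?thesis by blast
  qed
  then obtain A' where dA: "(A has_real_derivative A') (at 0)" by blast
  have "\<exists>B'. (B has_real_derivative B') (at 0)"
  proof -
    have "(B has_real_derivative (0 * W 0 - l * W') / (W 0 * W 0) - 2 * A 0 * A') (at 0)"
      unfolding B_def using W0 by (auto intro!: derivative_eq_intros dW dA)
    then show ?thesis by blast
  qed
  then obtain B' where dB: "(B has_real_derivative B') (at 0)" by blast
  have "((\<lambda>t. sqrt (B t)) has_real_derivative (inverse (sqrt (B 0)) / 2 * B')) (at 0)"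
    by (rule DERIV_chain2[OF DERIV_real_sqrt dB]) (use B0 Imz in simp)
  then have "((\<lambda>t. \<sigma> * sqrt (B t)) has_real_derivative \<sigma> * (inverse (sqrt (B 0)) / 2 * B')) (at 0)"
    by (rule DERIV_cmult)
  then have "((\<lambda>t. Complex (A t) (\<sigma> * sqrt (B t))) has_vector_derivative
      Complex A' (\<sigma> * (inverse (sqrt (B 0)) / 2 * B'))) (at 0)"
    unfolding has_vector_derivative_complex_iff using dA by simp
  from has_vector_derivative_mult[OF w' this] obtain U' where dU: "(U has_vector_derivative U') (at 0)"
    unfolding U_def by blast
  define V' where "V' = of_real a * (\<i> * u) + of_real b * (\<i> * v) - U'"
  have dV: "(V has_vector_derivative V') (at 0)"
    unfolding V_def V'_def by (rule has_vector_derivative_diff[OF w' dU])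
  have "isCont W 0" "isCont B 0" using dW dB DERIV_isCont by blast+
  then have "eventually (\<lambda>t. W t > 0) (at 0)" "eventually (\<lambda>t. B t > 0) (at 0)"
    using W0 B0 Imz unfolding isCont_def by (auto intro!: order_tendstoD(1))
  then have "eventually (\<lambda>t. W t > 0 \<and> B t > 0) (at 0)" by (rule eventually_conj)
  then obtain \<epsilon> where \<epsilon>: "\<epsilon> > 0" "\<And>t. t \<noteq> 0 \<Longrightarrow> \<bar>t\<bar> < \<epsilon> \<Longrightarrow> W t > 0 \<and> B t > 0"
    unfolding eventually_at by (auto simp: dist_real_def)
  have near: "cmod (U t) = cmod u \<and> cmod (V t) = cmod v" if "\<bar>t\<bar> < \<epsilon>" for t
  proof -
    have pos: "W t > 0" "B t > 0" using \<epsilon>(2)[of t] that W0 B0 Imz by (cases "t = 0"; simp)+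
    have \<sigma>2: "\<sigma>\<^sup>2 = 1" by (simp add: \<sigma>_def)
    have "(cmod (U t))\<^sup>2 = W t * ((A t)\<^sup>2 + B t)"
      unfolding U_def Wn using pos \<sigma>2 by (simp add: norm_mult power_mult_distrib cmod_power2)
    then have U: "(cmod (U t))\<^sup>2 = (cmod u)\<^sup>2" using pos by (simp add: B_def l_def)
    have "V t = w t * Complex (1 - A t) (- (\<sigma> * sqrt (B t)))"
      by (simp add: V_def U_def complex_eq_iff algebra_simps)
    then have "(cmod (V t))\<^sup>2 = W t * ((1 - A t)\<^sup>2 + B t)"
      unfolding Wn using pos \<sigma>2 by (simp add: norm_mult power_mult_distrib cmod_power2)
    also have "\<dots> = W t + l - 2 * (W t * A t)"
      using pos by (simp add: B_def power2_eq_square field_simps)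
    also have "\<dots> = k" using pos by (simp add: A_def field_simps)
    finally have "(cmod (V t))\<^sup>2 = (cmod v)\<^sup>2" by (simp add: k_def)
    with U show ?thesis by (simp add: power2_eq_iff_nonneg)
  qed
  have orth: "f' \<bullet> f 0 = 0"
    if "\<And>t. \<bar>t\<bar> < \<epsilon> \<Longrightarrow> cmod (f t) = cmod (f 0)" "(f has_vector_derivative f') (at 0)" for f :: "real \<Rightarrow> complex" and f'
  proof -
    \<comment> \<open>\<open>edge_velocity_orthogonal\<close> wants constant length for all times,
      so the curve is frozen outside the interval, which does not change its derivative at
      0.\<close>
    define h where "h t = (if \<bar>t\<bar> < \<epsilon> then f t else f 0)" for t
    have hd: "(h has_vector_derivative f') (at 0)"
      by (rule has_vector_derivative_transform_within[OF that(2) \<epsilon>(1)]) (auto simp: h_def)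
    have "cmod (h t) = cmod (f 0)" for t using that(1)[of t] by (simp add: h_def)
    from edge_velocity_orthogonal[OF this hd] have "f' \<bullet> h 0 = 0" .
    then show ?thesis using \<epsilon>(1) by (simp add: h_def)
  qed
  have iu: "(of_real r * (\<i> * y)) \<bullet> y = 0" for r y
    by (simp add: inner_complex_def algebra_simps)
  \<comment> \<open>The derivative is identified without computing it: constancy of both lengths
    makes \<open>U' - of_real a * (\<i> * u)\<close> orthogonal to \<open>u\<close> and, through
    \<open>V'\<close>, also to \<open>v\<close>, and these two vectors are independent.\<close>
  have "(U' - of_real a * (\<i> * u)) \<bullet> u = 0"
    using orth[OF _ dU] near U0 iu[of a u] by (simp add: inner_diff_left)
  moreover have "(U' - of_real a * (\<i> * u)) \<bullet> v = 0"
    using orth[OF _ dV] near V0 iu[of b v] by (simp add: V'_def inner_diff_left inner_add_left)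
  ultimately have "U' - of_real a * (\<i> * u) = 0" using orthogonal_to_independent ind by blast
  then have "U' = of_real a * (\<i> * u)" "V' = of_real b * (\<i> * v)" by (simp_all add: V'_def)
  with dU dV near U0 V0 \<epsilon>(1) show ?thesis by (intro that[of \<epsilon> U V]) (auto simp: V_def)
qed

lemma not_straight_independent:
  assumes "n \<kappa> \<ge> 1" "\<And>i. i < n \<kappa> \<Longrightarrow> edge_vec n x (\<kappa>, i) \<noteq> 0" "\<not> straight n x \<kappa>"
  obtains k where "k < n \<kappa>" "cross (edge_vec n x (\<kappa>, 0)) (edge_vec n x (\<kappa>, k)) \<noteq> 0"
proof (rule ccontr)
  assume "\<not> thesis"
  with that have par: "cross (edge_vec n x (\<kappa>, 0)) (edge_vec n x (\<kappa>, k)) = 0" if "k < n \<kappa>" for k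
    using that by blast
  define u where "u = edge_vec n x (\<kappa>, 0)"
  have u: "u \<noteq> 0" using assms(1) assms(2)[of 0] by (simp add: u_def)
  \<comment> \<open>If every edge is parallel to the first one, it is orthogonal to
    \<open>\<i> * u\<close>; and \<open>\<i> * sgn (\<i> * u)\<close> is a unit vector along
    \<open>u\<close>.\<close>
  have "\<exists>s. edge_vec n x (\<kappa>, i) = of_real s * (\<i> * sgn (\<i> * u))" if "i < n \<kappa>" for i
    by (rule orthogonal_multiple)
       (use par[OF that] u in \<open>simp_all add: u_def cross_def inner_complex_def algebra_simps\<close>)
  then have "straight n x \<kappa>"
    unfolding straight_def using u by (intro exI[of _ "\<i> * sgn (\<i> * u)"]) (simp add: norm_mult norm_sgn)
  then show False using assms(3) by simp
qed

text \<open>\<open>T\<close> prescribes the vector from I to T, so motions of different chains with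
  the same \<open>T\<close> can be glued; \<open>\<alpha> i\<close> is the initial angular velocity
  of edge \<open>i\<close>.\<close>

definition chain_motion ::
  "(nat \<Rightarrow> complex) \<Rightarrow> (nat \<Rightarrow> real) \<Rightarrow> nat \<Rightarrow> (real \<Rightarrow> complex) \<Rightarrow> real \<Rightarrow> (nat \<Rightarrow> real \<Rightarrow> complex) \<Rightarrow> bool" where
  "chain_motion u \<alpha> N T \<epsilon> U \<longleftrightarrow> \<epsilon> > 0 \<and>
    (\<forall>i<N. U i 0 = u i \<and> (U i has_vector_derivative of_real (\<alpha> i) * (\<i> * u i)) (at 0)) \<and>
    (\<forall>t. \<bar>t\<bar> < \<epsilon> \<longrightarrow> (\<forall>i<N. cmod (U i t) = cmod (u i)) \<and> (\<Sum>i<N. U i t) = T t)"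

lemma free_chain_motion:
  "chain_motion u \<alpha> N (\<lambda>t. \<Sum>i<N. u i * cis (\<alpha> i * t)) 1 (\<lambda>i t. u i * cis (\<alpha> i * t))"
  by (simp add: chain_motion_def has_vector_derivative_rotation norm_mult)

text \<open>All edges except \<open>j\<close> and \<open>k\<close> rotate uniformly; these two,
  being non-parallel, form a two-bar linkage that makes up for the rest of the prescribed
  vector.\<close>

lemma guided_chain_motion:
  assumes "j < N" "k < N" "cross (u j) (u k) \<noteq> 0"
    and T: "T 0 = (\<Sum>i<N. u i)"
      "(T has_vector_derivative (\<Sum>i<N. of_real (\<alpha> i) * (\<i> * u i))) (at 0)"
  shows "\<exists>\<epsilon> U. chain_motion u \<alpha> N T \<epsilon> U"
proof -
  have "j \<noteq> k" using assms(3) by (auto simp: cross_simps)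
  define I where "I = {..<N} - {j, k}"
  have split: "(\<Sum>i<N. f i) = f j + f k + (\<Sum>i\<in>I. f i)" for f :: "nat \<Rightarrow> complex"
    using sum.remove[of "{..<N}" j f] sum.remove[of "{..<N} - {j}" k f] assms(1,2) \<open>j \<noteq> k\<close>
    by (simp add: I_def Diff_insert2[symmetric] insert_commute add.assoc)
  define w where "w t = T t - (\<Sum>i\<in>I. u i * cis (\<alpha> i * t))" for t
  have "w 0 = u j + u k" using T(1) split[of u] by (simp add: w_def)
  moreover have "(w has_vector_derivative ((\<Sum>i<N. of_real (\<alpha> i) * (\<i> * u i)) -
      (\<Sum>i\<in>I. of_real (\<alpha> i) * (\<i> * u i)))) (at 0)"
    unfolding w_def
    by (intro has_vector_derivative_diff T(2) has_vector_derivative_sum has_vector_derivative_rotation)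
  then have "(w has_vector_derivative (of_real (\<alpha> j) * (\<i> * u j) + of_real (\<alpha> k) * (\<i> * u k))) (at 0)"
    unfolding split by simp
  ultimately obtain \<epsilon> U V where UV: "\<epsilon> > 0" "U 0 = u j" "V 0 = u k"
    "\<And>t. \<bar>t\<bar> < \<epsilon> \<Longrightarrow> cmod (U t) = cmod (u j) \<and> cmod (V t) = cmod (u k) \<and> U t + V t = w t"
    "(U has_vector_derivative (of_real (\<alpha> j) * (\<i> * u j))) (at 0)"
    "(V has_vector_derivative (of_real (\<alpha> k) * (\<i> * u k))) (at 0)"
    using two_bar_motion[OF assms(3), of w "\<alpha> j" "\<alpha> k"] by blast
  define X where "X i = (if i = j then U else if i = k then V else (\<lambda>t. u i * cis (\<alpha> i * t)))" for i
  have "(\<Sum>i<N. X i t) = T t" if "\<bar>t\<bar> < \<epsilon>" for t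
  proof -
    have "(\<Sum>i\<in>I. X i t) = (\<Sum>i\<in>I. u i * cis (\<alpha> i * t))"
      by (intro sum.cong) (auto simp: X_def I_def)
    then show ?thesis
      unfolding split using UV(4)[OF that] \<open>j \<noteq> k\<close> by (simp add: X_def w_def)
  qed
  then have "chain_motion u \<alpha> N T \<epsilon> X"
    using UV \<open>j \<noteq> k\<close>
    by (auto simp: chain_motion_def X_def has_vector_derivative_rotation norm_mult)
  then show ?thesis by blast
qed

text \<open>At most one chain is straight; it moves freely and guides the other two.\<close>

lemma infinitesimal_motion_realized:
  assumes pos: "\<And>\<kappa>. n \<kappa> \<ge> 1" and gen: "generic_lengths n len"
    and x: "x \<in> configs (three_chain n len)"
    and \<alpha>: "\<And>\<kappa>. (\<Sum>i<n \<kappa>. of_real (\<alpha> (\<kappa>, i)) * edge_vec n x (\<kappa>, i)) = w"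
  obtains \<gamma> D where "\<And>t::real. \<gamma> t \<in> configs (three_chain n len)" "\<gamma> 0 = x"
    "\<And>v. ((\<lambda>t. \<gamma> t v) has_vector_derivative D v) (at 0)"
    "\<And>\<kappa> i. i < n \<kappa> \<Longrightarrow> edge_vec n D (\<kappa>, i) = of_real (\<alpha> (\<kappa>, i)) * (\<i> * edge_vec n x (\<kappa>, i))"
proof -
  let ?L = "three_chain n len"
  define u where "u \<kappa> i = edge_vec n x (\<kappa>, i)" for \<kappa> i
  have len: "cmod (u \<kappa> i) = len (\<kappa>, i)" if "i < n \<kappa>" for \<kappa> i
    using x that by (auto simp: u_def configs_three_chain_iff edge_indices_def)
  have nz: "u \<kappa> i \<noteq> 0" if "i < n \<kappa>" for \<kappa> i
    using len[OF that] generic_lengths_pos[OF gen that] by auto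
  have one: "\<kappa> = \<kappa>'" if "straight n x \<kappa>" "straight n x \<kappa>'" for \<kappa> \<kappa>'
    using not_two_straight[of n len \<kappa> \<kappa>' x, OF pos gen _ that] len by (auto simp: u_def)
  \<comment> \<open>The straight chain if there is one, and an arbitrary chain otherwise.\<close>
  obtain \<kappa>0 where \<kappa>0: "\<And>\<kappa>. straight n x \<kappa> \<Longrightarrow> \<kappa> = \<kappa>0" using one by metis
  define T where "T t = (\<Sum>i<n \<kappa>0. u \<kappa>0 i * cis (\<alpha> (\<kappa>0, i) * t))" for t
  have sums: "(\<Sum>i<n \<kappa>. u \<kappa> i) = (\<Sum>i<n \<kappa>0. u \<kappa>0 i)" for \<kappa>
    unfolding u_def by (simp add: sum_edge_vec[of n, OF pos])
  have dsums: "(\<Sum>i<n \<kappa>. of_real (\<alpha> (\<kappa>, i)) * (\<i> * u \<kappa> i)) = \<i> * w" for \<kappa>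
    unfolding \<alpha>[of \<kappa>, symmetric] u_def by (simp add: sum_distrib_left mult.left_commute)
  have T: "T 0 = (\<Sum>i<n \<kappa>. u \<kappa> i)"
    "(T has_vector_derivative (\<Sum>i<n \<kappa>. of_real (\<alpha> (\<kappa>, i)) * (\<i> * u \<kappa> i))) (at 0)" for \<kappa>
  proof -
    show "T 0 = (\<Sum>i<n \<kappa>. u \<kappa> i)" unfolding T_def sums[of \<kappa>] by simp
    have "(T has_vector_derivative (\<Sum>i<n \<kappa>0. of_real (\<alpha> (\<kappa>0, i)) * (\<i> * u \<kappa>0 i))) (at 0)"
      unfolding T_def by (intro has_vector_derivative_sum has_vector_derivative_rotation)
    then show "(T has_vector_derivative (\<Sum>i<n \<kappa>. of_real (\<alpha> (\<kappa>, i)) * (\<i> * u \<kappa> i))) (at 0)"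
      unfolding dsums .
  qed
  have "\<exists>\<epsilon> U. chain_motion (u \<kappa>) (\<lambda>i. \<alpha> (\<kappa>, i)) (n \<kappa>) T \<epsilon> U" for \<kappa>
  proof (cases "\<kappa> = \<kappa>0")
    case True
    then show ?thesis unfolding T_def using free_chain_motion by blast
  next
    case False
    then have "\<not> straight n x \<kappa>" using \<kappa>0 by blast
    then obtain k where k: "k < n \<kappa>" "cross (u \<kappa> 0) (u \<kappa> k) \<noteq> 0"
      using not_straight_independent[of n \<kappa> x, OF pos] nz unfolding u_def by blast
    have "0 < n \<kappa>" using pos[of \<kappa>] by simp
    from guided_chain_motion[OF this k T] show ?thesis .
  qed
  then obtain \<epsilon> U where U: "\<And>\<kappa>. chain_motion (u \<kappa>) (\<lambda>i. \<alpha> (\<kappa>, i)) (n \<kappa>) T (\<epsilon> \<kappa>) (U \<kappa>)" by metis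
  define \<delta> where "\<delta> = min (\<epsilon> ChA) (min (\<epsilon> ChB) (\<epsilon> ChZ))"
  have \<delta>: "\<delta> > 0" "\<delta> \<le> \<epsilon> \<kappa>" for \<kappa>
    using U by (auto simp: \<delta>_def chain_motion_def) (cases \<kappa>; auto)
  \<comment> \<open>\<open>critical_point\<close> asks for configurations at all times but for
    differentiability only at 0, so outside the common interval the motion may jump back to the
    start.\<close>
  define X where "X \<kappa> i t = (if \<bar>t\<bar> < \<delta> then U \<kappa> i t else u \<kappa> i)" for \<kappa> i t
  have X0: "X \<kappa> i 0 = u \<kappa> i" if "i < n \<kappa>" for \<kappa> i
    using U[of \<kappa>] that by (simp add: X_def chain_motion_def)
  have Xlen: "cmod (X \<kappa> i t) = len (\<kappa>, i)" if "i < n \<kappa>" for \<kappa> i t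
    using U[of \<kappa>] that len[OF that] \<delta>(2)[of \<kappa>] by (auto simp: X_def chain_motion_def)
  have Xsum: "(\<Sum>i<n \<kappa>. X \<kappa> i t) = (\<Sum>i<n ChA. X ChA i t)" for \<kappa> t
  proof (cases "\<bar>t\<bar> < \<delta>")
    case True
    then have "(\<Sum>i<n \<mu>. X \<mu> i t) = T t" for \<mu>
      using U[of \<mu>] \<delta>(2)[of \<mu>] by (auto simp: X_def chain_motion_def)
    then show ?thesis by simp
  next
    case False
    then show ?thesis using sums[of \<kappa>] sums[of ChA] by (simp add: X_def)
  qed
  have Xd: "(X \<kappa> i has_vector_derivative of_real (\<alpha> (\<kappa>, i)) * (\<i> * u \<kappa> i)) (at 0)" if "i < n \<kappa>" for \<kappa> i
  proof (rule has_vector_derivative_transform_within)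
    show "(U \<kappa> i has_vector_derivative of_real (\<alpha> (\<kappa>, i)) * (\<i> * u \<kappa> i)) (at 0)"
      using U[of \<kappa>] that by (simp add: chain_motion_def)
  qed (use \<delta>(1) in \<open>auto simp: X_def\<close>)
  \<comment> \<open>Rebuilds a family of points from the position of I and the edge vectors. The
    position of T is computed along A, which is consistent with the other chains because all edge
    sums agree.\<close>
  define pth where "pth z f v = (if v \<in> verts ?L then
      (case v of VI \<Rightarrow> z | VT \<Rightarrow> z + (\<Sum>i<n ChA. f ChA i) | Inner \<kappa> j \<Rightarrow> z + (\<Sum>i<j. f \<kappa> i)) else undefined)"
    for z :: complex and f :: "chain \<Rightarrow> nat \<Rightarrow> complex" and v
  have pth: "pth z f (chain_vertex n \<kappa> j) = z + (\<Sum>i<j. f \<kappa> i)"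
    if "j \<le> n \<kappa>" "\<And>\<kappa>. (\<Sum>i<n \<kappa>. f \<kappa> i) = (\<Sum>i<n ChA. f ChA i)" for z f \<kappa> j
    using chain_vertex_in_verts[of n j \<kappa> len, OF pos that(1)] that(2)[of \<kappa>]
    by (auto simp: pth_def chain_vertex_def)
  define \<gamma> where "\<gamma> t = pth (x VI) (\<lambda>\<kappa> i. X \<kappa> i t)" for t
  \<comment> \<open>Off the vertices the motion has the constant value \<open>undefined\<close>, so
    its velocity there must be set to 0.\<close>
  define D where "D v = (if v \<in> verts ?L then pth 0 (\<lambda>\<kappa> i. of_real (\<alpha> (\<kappa>, i)) * (\<i> * u \<kappa> i)) v else 0)" for v
  have \<gamma>: "\<gamma> t (chain_vertex n \<kappa> j) = x VI + (\<Sum>i<j. X \<kappa> i t)" if "j \<le> n \<kappa>" for t \<kappa> j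
    unfolding \<gamma>_def using that Xsum by (intro pth)
  have D: "D (chain_vertex n \<kappa> j) = (\<Sum>i<j. of_real (\<alpha> (\<kappa>, i)) * (\<i> * u \<kappa> i))" if "j \<le> n \<kappa>" for \<kappa> j
    unfolding D_def using chain_vertex_in_verts[of n j \<kappa> len, OF pos that] that
    by (simp add: pth dsums)
  have verts: "\<exists>\<kappa> j. v = chain_vertex n \<kappa> j \<and> j \<le> n \<kappa>" if "v \<in> verts ?L" for v
    using that unfolding verts_three_chain[of n len, OF pos] by auto
  have ext: "\<gamma> t \<in> verts ?L \<rightarrow>\<^sub>E UNIV" for t by (auto simp: \<gamma>_def pth_def)
  show ?thesis
  proof (rule that[of \<gamma> D])
    show "\<gamma> t \<in> configs ?L" for t
      unfolding configs_three_chain_iff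
      using ext Xlen by (auto simp: edge_indices_def edge_vec_def \<gamma>)
    show "\<gamma> 0 = x"
    proof
      fix v
      show "\<gamma> 0 v = x v"
      proof (cases "v \<in> verts ?L")
        case True
        then obtain \<kappa> j where v: "v = chain_vertex n \<kappa> j" "j \<le> n \<kappa>" using verts by blast
        then have "\<gamma> 0 v = x VI + (\<Sum>i<j. u \<kappa> i)" using X0 by (simp add: \<gamma>)
        then show ?thesis by (simp add: u_def sum_edge_vec_upto v)
      next
        case False
        then show ?thesis using ext x by (auto simp: configs_three_chain_iff PiE_iff extensional_def)
      qed
    qed
    show "((\<lambda>t. \<gamma> t v) has_vector_derivative D v) (at 0)" for v
    proof (cases "v \<in> verts ?L")
      case True
      then obtain \<kappa> j where v: "v = chain_vertex n \<kappa> j" "j \<le> n \<kappa>" using verts by blast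
      have "((\<lambda>t. x VI + (\<Sum>i<j. X \<kappa> i t)) has_vector_derivative
          0 + (\<Sum>i<j. of_real (\<alpha> (\<kappa>, i)) * (\<i> * u \<kappa> i))) (at 0)"
        using v(2) by (intro has_vector_derivative_add has_vector_derivative_const has_vector_derivative_sum Xd) auto
      then show ?thesis by (simp add: v \<gamma> D)
    next
      case False
      then show ?thesis by (simp add: \<gamma>_def D_def pth_def)
    qed
    show "edge_vec n D (\<kappa>, i) = of_real (\<alpha> (\<kappa>, i)) * (\<i> * edge_vec n x (\<kappa>, i))" if "i < n \<kappa>" for \<kappa> i
      using that by (simp add: edge_vec_def[of n D] D) (simp add: u_def)
  qed
qed

section \<open>Classification of the critical points\<close>

lemma cyclic_congruent:
  assumes "cmod w = 1" "\<And>v. v \<in> verts L \<Longrightarrow> y v = w * x v + t" "cyclic L x"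
  shows "cyclic L y"
proof -
  obtain m \<rho> where m: "\<rho> > 0" "x ` verts L \<subseteq> sphere m \<rho>"
    using assms(3) unfolding cyclic_def circumscribed_def by blast
  have "dist (w * m + t) (w * z + t) = dist m z" for z
    using assms(1) by (simp add: dist_norm norm_mult flip: right_diff_distrib)
  then have "y ` verts L \<subseteq> sphere (w * m + t) \<rho>"
    using m(2) assms(2) by (auto simp: image_subset_iff)
  with m(1) show ?thesis unfolding cyclic_def circumscribed_def by blast
qed

lemma straight_congruent:
  assumes "cmod w = 1" "\<And>i. i < n \<kappa> \<Longrightarrow> edge_vec n y (\<kappa>, i) = w * edge_vec n x (\<kappa>, i)" "straight n x \<kappa>"
  shows "straight n y \<kappa>"
proof -
  obtain d s where d: "cmod d = 1" "\<And>i. i < n \<kappa> \<Longrightarrow> edge_vec n x (\<kappa>, i) = of_real (s i) * d"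
    using assms(3) unfolding straight_def by metis
  show ?thesis
    unfolding straight_def using assms(1,2) d
    by (intro exI[of _ "w * d"]) (auto simp: norm_mult mult.left_commute)
qed

text \<open>The multipliers of the closure conditions of \<open>A\<close> and \<open>B\<close> are the circumcentres of these chains.\<close>

lemma critical_config:
  assumes pos: "\<And>\<kappa>. n \<kappa> \<ge> 1" and gen: "generic_lengths n len"
    and x: "x \<in> configs (three_chain n len)"
    and crit: "critical_point (three_chain n len) (Gamma_area n) (config_class (three_chain n len) x)"
  shows "cyclic (two_chain_cycle n len ChA ChB) x \<or>
    straight n x ChZ \<and> cyclic (open_chain n len ChA) x \<and> cyclic (open_chain n len ChB) x"
proof -
  let ?L = "three_chain n len" and ?E = "edge_indices n"
  define u where "u = edge_vec n x"
  define m where "m = edge_mid n x"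
  have nz: "u (\<kappa>, i) \<noteq> 0" if "i < n \<kappa>" for \<kappa> i
    using x generic_lengths_pos[OF gen that] that
    by (fastforce simp: u_def configs_three_chain_iff edge_indices_def)
  \<comment> \<open>As functionals of the angular velocities, \<open>a\<close> and \<open>b\<close>
    express that A, respectively B, closes up with Z; real and imaginary parts give the four real
    constraints.\<close>
  define a where "a e = (case fst e of ChA \<Rightarrow> u e | ChB \<Rightarrow> 0 | ChZ \<Rightarrow> - u e)" for e
  define b where "b e = (case fst e of ChA \<Rightarrow> 0 | ChB \<Rightarrow> u e | ChZ \<Rightarrow> - u e)" for e
  \<comment> \<open>The derivative of the area as a functional of the angular velocities, with the
    minus sign of B and no contribution of Z.\<close>
  define g where "g e = (case fst e of ChA \<Rightarrow> m e \<bullet> u e | ChB \<Rightarrow> - (m e \<bullet> u e) | ChZ \<Rightarrow> 0)" for e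
  define f where "f k e = [Re (a e), Im (a e), Re (b e), Im (b e)] ! k" for k e
  have "(\<Sum>e\<in>?E. g e * \<alpha> e) = 0"
    if \<alpha>: "\<And>k. k < 4 \<Longrightarrow> (\<Sum>e\<in>?E. f k e * \<alpha> e) = 0" for \<alpha>
  proof -
    define w where "w \<kappa> = (\<Sum>i<n \<kappa>. of_real (\<alpha> (\<kappa>, i)) * u (\<kappa>, i))" for \<kappa>
    have "(\<Sum>e\<in>?E. Re (a e) * \<alpha> e) = 0" "(\<Sum>e\<in>?E. Im (a e) * \<alpha> e) = 0"
      "(\<Sum>e\<in>?E. Re (b e) * \<alpha> e) = 0" "(\<Sum>e\<in>?E. Im (b e) * \<alpha> e) = 0"
      using \<alpha>[of 0] \<alpha>[of 1] \<alpha>[of 2] \<alpha>[of 3] by (simp_all add: f_def numeral_2_eq_2 numeral_3_eq_3)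
    then have "w ChA = w ChZ" "w ChB = w ChZ"
      unfolding sum_edge_indices
      by (simp_all add: a_def b_def w_def complex_eq_iff sum_negf mult.commute)
    then have "w \<kappa> = w ChZ" for \<kappa> by (cases \<kappa>) auto
    then have *: "(\<Sum>i<n \<kappa>. of_real (\<alpha> (\<kappa>, i)) * edge_vec n x (\<kappa>, i)) = w ChZ" for \<kappa>
      by (simp add: w_def u_def)
    obtain \<gamma> D where \<gamma>: "\<And>t::real. \<gamma> t \<in> configs ?L" "\<gamma> 0 = x"
      "\<And>v. ((\<lambda>t. \<gamma> t v) has_vector_derivative D v) (at 0)"
      "\<And>\<kappa> i. i < n \<kappa> \<Longrightarrow> edge_vec n D (\<kappa>, i) = of_real (\<alpha> (\<kappa>, i)) * (\<i> * edge_vec n x (\<kappa>, i))"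
      using infinitesimal_motion_realized[of n len x \<alpha>, OF pos gen x *] by blast
    have "(\<lambda>t. \<gamma> t v) differentiable at 0" for v
      using \<gamma>(3)[of v] by (rule differentiableI_vector)
    then have "((\<lambda>t. Gamma_area n (config_class ?L (\<gamma> t))) has_real_derivative 0) (at 0)"
      using crit \<gamma>(1,2) unfolding critical_point_def by blast
    from DERIV_unique[OF Gamma_area_derivative[of n len \<gamma> D, OF pos \<gamma>(3)] this]
    have "(\<Sum>i<n ChA. cross (m (ChA, i)) (edge_vec n D (ChA, i))) -
        (\<Sum>i<n ChB. cross (m (ChB, i)) (edge_vec n D (ChB, i))) = 0"
      by (simp add: m_def \<gamma>(2))
    moreover have "(\<Sum>i<n \<kappa>. cross (m (\<kappa>, i)) (edge_vec n D (\<kappa>, i))) =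
        (\<Sum>i<n \<kappa>. (m (\<kappa>, i) \<bullet> u (\<kappa>, i)) * \<alpha> (\<kappa>, i))" for \<kappa>
      by (intro sum.cong) (auto simp: \<gamma>(4) cross_rotate u_def)
    ultimately show ?thesis
      unfolding sum_edge_indices by (simp add: g_def sum_negf)
  qed
  from functional_duality[OF finite_edge_indices this]
  obtain c where c: "\<And>e. e \<in> ?E \<Longrightarrow> g e = (\<Sum>k<4. c k * f k e)" by blast
  \<comment> \<open>The four real multipliers combined into two points of the plane. As B enters the
    area negatively, its centre is \<open>- \<nu>\<close>, and \<open>\<mu> + \<nu>\<close> is the
    difference of the two centres.\<close>
  define \<mu> \<nu> where "\<mu> = Complex (c 0) (c 1)" and "\<nu> = Complex (c 2) (c 3)"
  have g: "g e = \<mu> \<bullet> a e + \<nu> \<bullet> b e" if "e \<in> ?E" for e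
    using c[OF that]
    by (simp add: f_def \<mu>_def \<nu>_def inner_complex_def eval_nat_numeral)
  have A: "centre n x ChA \<mu>"
    unfolding centre_iff_midpoints
  proof (intro allI impI)
    fix i assume "i < n ChA"
    then show "(edge_mid n x (ChA, i) - \<mu>) \<bullet> edge_vec n x (ChA, i) = 0"
      using g[of "(ChA, i)"] by (simp add: g_def a_def b_def m_def u_def inner_diff_left edge_indices_def)
  qed
  have B: "centre n x ChB (- \<nu>)"
    unfolding centre_iff_midpoints
  proof (intro allI impI)
    fix i assume "i < n ChB"
    then show "(edge_mid n x (ChB, i) - - \<nu>) \<bullet> edge_vec n x (ChB, i) = 0"
      using g[of "(ChB, i)"] by (simp add: g_def a_def b_def m_def u_def inner_add_left edge_indices_def)
  qed
  have Z: "(\<mu> + \<nu>) \<bullet> u (ChZ, i) = 0" if "i < n ChZ" for i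
    using g[of "(ChZ, i)"] that by (simp add: g_def a_def b_def inner_add_left edge_indices_def)
  have circ: "circumscribed (open_chain n len \<kappa>) x (sphere c (cmod (x VI - c)))"
    if "centre n x \<kappa> c" for \<kappa> c
    using centre_circumscribed(1)[of n \<kappa> x c len, OF pos that] nz[of 0 \<kappa>] pos[of \<kappa>] by (simp add: u_def)
  show ?thesis
  proof (cases "\<mu> + \<nu> = 0")
    case True
    then have "- \<nu> = \<mu>" by (simp add: add_eq_0_iff)
    with circ[OF A] circ[OF B] have "circumscribed (two_chain_cycle n len ChA ChB) x (sphere \<mu> (cmod (x VI - \<mu>)))"
      by (auto simp: circumscribed_def two_chain_cycle_def verts_Un)
    then show ?thesis unfolding cyclic_def by blast
  next
    case False
    \<comment> \<open>Every edge of Z is orthogonal to the non-zero difference of the centres, so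
      all of them have this direction.\<close>
    define d where "d = \<i> * sgn (\<mu> + \<nu>)"
    have d: "cmod d = 1" using False by (simp add: d_def norm_mult norm_sgn)
    have "\<exists>s. edge_vec n x (ChZ, i) = of_real s * d" if i: "i < n ChZ" for i
    proof -
      obtain s where "u (ChZ, i) = of_real s * (\<i> * sgn (\<mu> + \<nu>))"
        using orthogonal_multiple[OF False Z[OF i]] by blast
      then show ?thesis by (auto simp: u_def d_def)
    qed
    with d have "straight n x ChZ" unfolding straight_def by blast
    with circ[OF A] circ[OF B] show ?thesis unfolding cyclic_def by blast
  qed
qed

section \<open>The two types of critical points and their separation\<close>

context
  fixes n :: "chain \<Rightarrow> nat" and len :: "chain \<times> nat \<Rightarrow> real"
  assumes pos: "n \<kappa> \<ge> 1" and gen: "generic_lengths n len"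
begin

private lemma sub_verts: "verts (two_chain_cycle n len ChA ChB) \<subseteq> verts (three_chain n len)" "verts (open_chain n len \<kappa>) \<subseteq> verts (three_chain n len)"
  by (cases \<kappa>; auto simp: three_chain_def two_chain_cycle_def verts_Un)+

private lemma circular_typeI:
  assumes "x \<in> configs (three_chain n len)" "cyclic (two_chain_cycle n len ChA ChB) x"
  shows "circular_type n len (config_class (three_chain n len) x)"
  unfolding circular_type_def
proof
  fix y assume "y \<in> config_class (three_chain n len) x"
  then obtain w t where w: "cmod w = 1" "y = (\<lambda>v\<in>verts (three_chain n len). w * x v + t)" using mem_config_class by blast
  then show "cyclic (two_chain_cycle n len ChA ChB) y" using sub_verts(1) assms(2) by (intro cyclic_congruent[of w "two_chain_cycle n len ChA ChB" y x t]) auto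
qed

private lemma aligned_typeI:
  assumes "x \<in> configs (three_chain n len)" "straight n x ChZ" "cyclic (open_chain n len ChA) x" "cyclic (open_chain n len ChB) x"
  shows "aligned_type n len (config_class (three_chain n len) x)"
  unfolding aligned_type_def aligned_iff_straight[of n ChZ, OF pos]
proof (intro ballI conjI)
  fix y assume "y \<in> config_class (three_chain n len) x"
  then obtain w t where w: "cmod w = 1" "y = (\<lambda>v\<in>verts (three_chain n len). w * x v + t)" using mem_config_class by blast
  have yv: "y v = w * x v + t" if "v \<in> verts (open_chain n len \<kappa>)" for v \<kappa>
    using that sub_verts(2)[of \<kappa>] w(2) by auto
  show "cyclic (open_chain n len ChA) y" "cyclic (open_chain n len ChB) y"
    by (rule cyclic_congruent[OF w(1) yv]; use assms(3,4) in simp)+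
  show "straight n y ChZ"
  proof (rule straight_congruent[OF w(1) _ assms(2)])
    fix i assume "i < n ChZ"
    then have "chain_vertex n ChZ i \<in> verts (open_chain n len ChZ)"
      "chain_vertex n ChZ (Suc i) \<in> verts (open_chain n len ChZ)"
      unfolding verts_open_chain[of n ChZ, OF pos] by auto
    then show "edge_vec n y (ChZ, i) = w * edge_vec n x (ChZ, i)"
      by (simp add: edge_vec_def yv algebra_simps)
  qed
qed

lemma critical_iff_type:
  assumes "\<xi> \<in> reduced_configs (three_chain n len)"
  shows "critical_point (three_chain n len) (Gamma_area n) \<xi> \<longleftrightarrow> circular_type n len \<xi> \<or> aligned_type n len \<xi>"
proof
  assume crit: "critical_point (three_chain n len) (Gamma_area n) \<xi>"
  obtain x where x: "x \<in> configs (three_chain n len)" "\<xi> = config_class (three_chain n len) x" using assms reduced_configs_iff by blast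
  then show "circular_type n len \<xi> \<or> aligned_type n len \<xi>"
    using critical_config[of n len x, OF pos gen] crit circular_typeI aligned_typeI by blast
qed (rule critical_if_type[of n len, OF pos gen assms])

text \<open>Genericity is phrased for configurations of the cycle AB alone, hence the passage to the
  restriction \<open>g\<close>, which keeps the distance of I and T.\<close>

lemma cyclic_straight_disjoint:
  assumes x: "x \<in> configs (three_chain n len)" and "cyclic (two_chain_cycle n len ChA ChB) x" "straight n x ChZ"
  shows False
proof -
  define g where "g = restrict x (verts (two_chain_cycle n len ChA ChB))"
  have g: "g \<in> configs (two_chain_cycle n len ChA ChB)"
    unfolding configs_def
  proof (intro CollectI conjI ballI)
    fix e assume e: "e \<in> (two_chain_cycle n len ChA ChB)"
    obtain v v' l where vl: "e = (v, v', l)" by (cases e)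
    have "e \<in> (three_chain n len)" using e by (auto simp: three_chain_def two_chain_cycle_def)
    then have "dist (x v) (x v') = l" using x vl by (auto simp: configs_def)
    then show "case e of (v, v', l) \<Rightarrow> dist (g v) (g v') = l"
      using verts_edge[of v v' l "two_chain_cycle n len ChA ChB"] e vl by (simp add: g_def)
  qed (simp add: g_def)
  have gc: "cyclic (two_chain_cycle n len ChA ChB) g"
    by (rule cyclic_congruent[of 1 "two_chain_cycle n len ChA ChB" g x 0]) (use assms(2) in \<open>auto simp: g_def\<close>)
  have "VI \<in> verts (two_chain_cycle n len ChA ChB)" "VT \<in> verts (two_chain_cycle n len ChA ChB)"
    using ends_in_chain[of n ChA, OF pos] verts_two_chain[of n ChA ChB len, OF pos pos] by auto
  then have "cmod (x VT - x VI) = dist (g VI) (g VT)"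
    by (simp add: g_def dist_norm norm_minus_commute)
  moreover have "cmod (edge_vec n x (ChZ, i)) = len (ChZ, i)" if "i < n ChZ" for i
    using x that by (auto simp: configs_three_chain_iff edge_indices_def)
  ultimately show False
    using cyclic_not_straight[of n len g x, OF pos gen g gc] assms(3) by blast
qed

lemma types_disjoint:
  assumes "\<xi> \<in> reduced_configs (three_chain n len)"
  shows "\<not> (circular_type n len \<xi> \<and> aligned_type n len \<xi>)"
proof -
  obtain x where x: "x \<in> configs (three_chain n len)" "\<xi> = config_class (three_chain n len) x" using assms reduced_configs_iff by blast
  then have "x \<in> \<xi>" using config_class_self by blast
  then show ?thesis
    using cyclic_straight_disjoint[OF x(1)]
    unfolding circular_type_def aligned_type_def aligned_iff_straight[of n ChZ, OF pos] by blast
qed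

text \<open>A common circle would make AB cyclic while Z is straight, so this is again the
  disjointness of the types.\<close>

lemma aligned_type_circles:
  assumes "\<xi> \<in> reduced_configs (three_chain n len)" "aligned_type n len \<xi>" "x \<in> \<xi>"
    and "circumscribed (open_chain n len ChA) x C" "circumscribed (open_chain n len ChB) x C'"
  shows "C \<noteq> C'"
proof
  assume "C = C'"
  then have "circumscribed (two_chain_cycle n len ChA ChB) x C"
    using assms(4,5) by (auto simp: circumscribed_def two_chain_cycle_def verts_Un)
  moreover have "straight n x ChZ"
    using assms(2,3) unfolding aligned_type_def aligned_iff_straight[of n ChZ, OF pos] by blast
  ultimately show False
    using cyclic_straight_disjoint mem_reduced_config(1)[OF assms(1,3)] unfolding cyclic_def by blast
qed

lemma circular_stratum_critical:
  assumes "cyclic (two_chain_cycle n len ChA ChB) g" "\<xi> \<in> circular_stratum n len g"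
  shows "critical_point (three_chain n len) (Gamma_area n) \<xi>"
proof -
  have \<xi>: "\<xi> \<in> reduced_configs (three_chain n len)" using assms(2) by (simp add: circular_stratum_def)
  obtain x where x: "x \<in> configs (three_chain n len)" "\<xi> = config_class (three_chain n len) x" using \<xi> reduced_configs_iff by blast
  have "config_class (two_chain_cycle n len ChA ChB) x = config_class (two_chain_cycle n len ChA ChB) g"
    using assms(2) restrict_class_config_class[OF sub_verts(1), of x] by (simp add: circular_stratum_def x(2))
  then obtain w t where "cmod w = 1" "\<And>v. v \<in> verts (two_chain_cycle n len ChA ChB) \<Longrightarrow> x v = w * g v + t"
    unfolding config_class_eq_iff by blast
  then have "cyclic (two_chain_cycle n len ChA ChB) x" using assms(1) by (rule cyclic_congruent)
  then show ?thesis using critical_iff_type[OF \<xi>] circular_typeI[OF x(1)] x(2) by blast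
qed

end

theorem theorem5:
  fixes p q r :: nat and n :: "chain \<Rightarrow> nat"
  assumes "p \<ge> 1" and "q \<ge> 1" and "r \<ge> 1"
    and "n = (\<lambda>\<kappa>. case \<kappa> of ChA \<Rightarrow> p | ChB \<Rightarrow> q | ChZ \<Rightarrow> r)"
  shows "\<exists>G. generic_set (edge_indices n) G \<and>
    (\<forall>len\<in>G. configs (three_chain n len) \<noteq> {} \<longrightarrow>
      \<comment> \<open>no aligned cycles, and the reduced configuration space is a smooth manifold\<close>
      (\<forall>\<kappa> \<kappa>'. \<kappa> \<noteq> \<kappa>' \<longrightarrow>
         \<not> (\<exists>x \<in> configs (two_chain_cycle n len \<kappa> \<kappa>'). aligned (two_chain_cycle n len \<kappa> \<kappa>') x)) \<and>
      reduced_submanifold (three_chain n len) (p + q + r) (reduced_configs (three_chain n len)) \<and>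
      \<comment> \<open>the critical points and their two disjoint types\<close>
      (\<forall>\<xi> \<in> reduced_configs (three_chain n len).
         (critical_point (three_chain n len) (Gamma_area n) \<xi> \<longleftrightarrow>
            circular_type n len \<xi> \<or> aligned_type n len \<xi>) \<and>
         \<not> (circular_type n len \<xi> \<and> aligned_type n len \<xi>)) \<and>
      \<comment> \<open>the critical manifold belonging to a cyclic configuration of the cycle AB\<close>
      (\<forall>g \<in> configs (two_chain_cycle n len ChA ChB).
         cyclic (two_chain_cycle n len ChA ChB) g \<longrightarrow>
           dist (g VI) (g VT) > 0 \<and>
           (\<forall>\<xi> \<in> circular_stratum n len g.
              critical_point (three_chain n len) (Gamma_area n) \<xi>) \<and>
           reduced_submanifold (three_chain n len) (2 * (p + q) + r - 3) (circular_stratum n len g) \<and>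
           (let Q = chain_with_bar n len ChZ (dist (g VI) (g VT)) in
              reduced_submanifold Q (r + 1) (reduced_configs Q) \<and>
              reduced_diffeomorphism (three_chain n len) (circular_stratum n len g)
                Q (reduced_configs Q) (restrict_class Q))) \<and>
      \<comment> \<open>the two circumscribed circles of a configuration of aligned type do not coincide\<close>
      (\<forall>\<xi> \<in> reduced_configs (three_chain n len). aligned_type n len \<xi> \<longrightarrow>
         (\<forall>x\<in>\<xi>. \<forall>C C'. circumscribed (open_chain n len ChA) x C \<and>
            circumscribed (open_chain n len ChB) x C' \<longrightarrow> C \<noteq> C')))"
proof -
  have pos: "n \<kappa> \<ge> 1" for \<kappa> using assms by (cases \<kappa>) auto
  have n: "n ChA = p" "n ChB = q" "n ChZ = r" using assms(4) by simp_all
  obtain G where G: "generic_set (edge_indices n) G" "\<And>len. len \<in> G \<Longrightarrow> generic_lengths n len"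
    using ex_generic_lengths[of n, OF pos] by blast
  show ?thesis
  proof (intro exI[of _ G] conjI ballI impI allI)
    fix len assume "len \<in> G"
    then have gen: "generic_lengths n len" by (rule G(2))
    let ?L = "three_chain n len" and ?C = "two_chain_cycle n len ChA ChB"
    show "\<not> (\<exists>x\<in>configs (two_chain_cycle n len \<kappa> \<kappa>'). aligned (two_chain_cycle n len \<kappa> \<kappa>') x)"
      if "\<kappa> \<noteq> \<kappa>'" for \<kappa> \<kappa>'
      using not_aligned_cycle[of n len, OF pos gen that] by blast
    show "reduced_submanifold ?L (p + q + r) (reduced_configs ?L)"
      using three_chain_configs_submanifold[of n len, OF pos gen]
      by (simp add: reduced_submanifold_def Union_reduced_configs n)
    fix \<xi> assume \<xi>: "\<xi> \<in> reduced_configs ?L"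
    show "critical_point ?L (Gamma_area n) \<xi> \<longleftrightarrow> circular_type n len \<xi> \<or> aligned_type n len \<xi>"
      by (rule critical_iff_type[of n len, OF pos gen \<xi>])
    show "\<not> (circular_type n len \<xi> \<and> aligned_type n len \<xi>)"
      by (rule types_disjoint[of n len, OF pos gen \<xi>])
    show "C \<noteq> C'" if "aligned_type n len \<xi>" "x \<in> \<xi>"
      "circumscribed (open_chain n len ChA) x C \<and> circumscribed (open_chain n len ChB) x C'" for x C C'
      using aligned_type_circles[of n len, OF pos gen \<xi>] that by blast
  next
    fix len g assume "len \<in> G"
    then have gen: "generic_lengths n len" by (rule G(2))
    let ?L = "three_chain n len" and ?C = "two_chain_cycle n len ChA ChB"
    let ?K = "circular_stratum n len g" and ?Q = "chain_with_bar n len ChZ (dist (g VI) (g VT))"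
    assume g: "g \<in> configs ?C" and cyc: "cyclic ?C g"
    show "dist (g VI) (g VT) > 0" using cyclic_ends_distinct[of n len g, OF pos gen g cyc] by simp
    show "critical_point ?L (Gamma_area n) \<xi>" if "\<xi> \<in> ?K" for \<xi>
      by (rule circular_stratum_critical[of n len g, OF pos gen cyc that])
    show "reduced_submanifold ?L (2 * (p + q) + r - 3) ?K"
      using circular_stratum_submanifold[of n len g, OF pos gen g cyc]
      unfolding reduced_submanifold_def n by (auto simp: circular_stratum_def)
    show "let Q = ?Q in reduced_submanifold Q (r + 1) (reduced_configs Q) \<and>
        reduced_diffeomorphism ?L ?K Q (reduced_configs Q) (restrict_class Q)"
      using bar_configs_submanifold[of n len g, OF pos gen g cyc]
        circular_stratum_diffeomorphism[of n len g, OF pos gen g cyc]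
      by (simp add: Let_def reduced_submanifold_def Union_reduced_configs n)
  qed (rule G(1))
qed

end
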